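(* Let $n\geq 4$ be an integer and let $\xi_n$ be the location of the first (i.e. smallest) local minimum of the function $\widehat{\sigma}(a)=\sigma(\mathbf{v}_{n,2}(a))$ on the open interval $\big(\frac1{\sqrt n},\frac1{\sqrt2}\big)$. Then $\mathbf{w}=\mathbf{v}_{n,2}(\xi_n)$ is a non-diagonal critical direction of $\sigma$ on $S^{n-1}$ which is not locally extremal, i.e. it is a saddle point: $\mathbf{w}$ is neither a local minimum nor a local maximum of $\sigma$ restricted to $S^{n-1}$.
   Context: $Q_n = [-\frac12,\frac12]^n\subset\mathbb{R}^n$ is the centered unit cube. For a non-zero vector $\mathbf{v}\in\mathbb{R}^n$, the central section function is $\sigma(\mathbf{v}) = \mathrm{Vol}_{n-1}(Q_n\cap \mathbf{v}^\perp)$, the $(n-1)$-dimensional volume of the section of $Q_n$ by the linear hyperplane orthogonal to $\mathbf{v}$. $S^{n-1}$ is the Euclidean unit sphere in $\mathbb{R}^n$. A critical direction is a critical point of $\sigma$ on $S^{n-1}$. A direction is diagonal if, up to permuting coordinates and changing signs of coordinates, it equals $\frac{1}{\sqrt k}(1,\ldots,1,0,\ldots,0)$ ($k$ ones, $n-k$ zeros) for some $1\le k\le n$. For $a\in\big[\frac1{\sqrt n},\frac1{\sqrt2}\big]$, $\mathbf{v}_{n,2}(a) = (a,a,b,\ldots,b)\in S^{n-1}$, where the first two coordinates equal $a$ and the remaining $n-2$ coordinates equal $b=\sqrt{\frac{1-2a^2}{n-2}}$. *)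

theory Defs
  imports "HOL-Analysis.Analysis"
begin

definition orthonormal_basis_of :: "'a::euclidean_space set \<Rightarrow> 'a set \<Rightarrow> bool" where
  "orthonormal_basis_of L B \<longleftrightarrow> pairwise orthogonal B \<and> (\<forall>b\<in>B. norm b = 1) \<and> span B = L"

lemma orthonormal_basis_of_exists:
  assumes "subspace L"
  shows "\<exists>B. orthonormal_basis_of L B"
  using orthonormal_basis_subspace[OF assms] unfolding orthonormal_basis_of_def by metis

text \<open>The same construction as the library's \<^const>\<open>lborel\<close> (see \<open>lborel_def\<close>), with the
  standard basis replaced by an orthonormal basis of \<open>L\<close>: the image of the product Lebesgue
  measure on the coordinates. The measure does not depend on which basis is chosen.\<close>

definition subspace_lborel :: "'a::euclidean_space set \<Rightarrow> 'a measure" where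
  "subspace_lborel L =
     (let B = (SOME B. orthonormal_basis_of L B)
      in distr (\<Pi>\<^sub>M b\<in>B. (lborel :: real measure)) borel (\<lambda>f. \<Sum>b\<in>B. f b *\<^sub>R b))"

definition centered_cube :: "(real ^ 'n) set" where
  "centered_cube = cbox (\<chi> i. - 1 / 2) (\<chi> i. 1 / 2)"

definition orth_hyperplane :: "real ^ 'n \<Rightarrow> (real ^ 'n) set" where
  "orth_hyperplane v = {x. v \<bullet> x = 0}"

text \<open>Meaningful for \<open>v \<noteq> 0\<close> only, where \<open>orth_hyperplane v\<close> has dimension \<open>CARD('n) - 1\<close>.\<close>

definition central_section :: "real ^ 'n \<Rightarrow> real" where
  "central_section v =
     measure (subspace_lborel (orth_hyperplane v)) (centered_cube \<inter> orth_hyperplane v)"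

definition local_min_on :: "('a::topological_space \<Rightarrow> real) \<Rightarrow> 'a set \<Rightarrow> 'a \<Rightarrow> bool" where
  "local_min_on f S x \<longleftrightarrow> x \<in> S \<and> (\<forall>\<^sub>F y in at x within S. f x \<le> f y)"

definition local_max_on :: "('a::topological_space \<Rightarrow> real) \<Rightarrow> 'a set \<Rightarrow> 'a \<Rightarrow> bool" where
  "local_max_on f S x \<longleftrightarrow> x \<in> S \<and> (\<forall>\<^sub>F y in at x within S. f y \<le> f x)"

text \<open>Having derivative \<open>0\<close> at \<open>w\<close> within the sphere means
  \<open>f y - f w = o(norm (y - w))\<close> as \<open>y \<rightarrow> w\<close> along the sphere: the restriction of \<open>f\<close> to
  the manifold \<open>sphere 0 1\<close> is differentiable at \<open>w\<close> and its differential on the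
  tangent space vanishes. Values of \<open>f\<close> off the sphere play no role.\<close>

definition critical_on_sphere :: "(real ^ 'n \<Rightarrow> real) \<Rightarrow> real ^ 'n \<Rightarrow> bool" where
  "critical_on_sphere f w \<longleftrightarrow>
     w \<in> sphere 0 1 \<and> (f has_derivative (\<lambda>h. 0)) (at w within sphere 0 1)"

text \<open>The bijection \<open>p\<close> numbers the coordinates \<open>1, \<dots>, n\<close> (so letting it vary permutes
  them), and \<open>e\<close> is a choice of signs.\<close>

definition diagonal_direction :: "real ^ 'n \<Rightarrow> bool" where
  "diagonal_direction v \<longleftrightarrow>
     (\<exists>k\<in>{1..CARD('n)}. \<exists>p e.
        bij_betw p (UNIV :: 'n set) {1..CARD('n)} \<and> (\<forall>i. e i \<in> {- 1, 1}) \<and>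
        v = (\<chi> i. e i * (if p i \<le> k then 1 / sqrt (real k) else 0)))"

text \<open>The index type carries no order, so the ``first two'' coordinates are given as
  parameters \<open>i1 \<noteq> i2\<close>.\<close>

definition v_two :: "'n::finite \<Rightarrow> 'n \<Rightarrow> real \<Rightarrow> real ^ 'n" where
  "v_two i1 i2 a =
     (\<chi> i. if i = i1 \<or> i = i2 then a else sqrt ((1 - 2 * a\<^sup>2) / (real CARD('n) - 2)))"

definition sigma_hat :: "'n::finite \<Rightarrow> 'n \<Rightarrow> real \<Rightarrow> real" where
  "sigma_hat i1 i2 a = central_section (v_two i1 i2 a)"

definition first_local_min :: "'n::finite \<Rightarrow> 'n \<Rightarrow> real \<Rightarrow> bool" where
  "first_local_min i1 i2 \<xi> \<longleftrightarrow>
     (let I = {1 / sqrt (real CARD('n)) <..< 1 / sqrt 2}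
      in local_min_on (sigma_hat i1 i2) I \<xi> \<and>
         (\<forall>\<zeta>. local_min_on (sigma_hat i1 i2) I \<zeta> \<longrightarrow> \<xi> \<le> \<zeta>))"

end

theory Submission
  imports Defs "HOL-Computational_Algebra.Polynomial"
begin

text \<open>Put \<open>m = n - 2\<close>, let \<open>g\<close> be the density of a sum of \<open>m\<close> independent uniform variables on
  \<open>[-1/2, 1/2]\<close>, and let \<open>K'' = g\<close> with \<open>K 0 = K' 0 = 0\<close>. For a unit vector \<open>(x, y, b, \<dots>, b)\<close>
  with positive entries the section volume is
  \<open>2 b / (x y) (K ((x + y) / (2 b)) - K ((x - y) / (2 b)))\<close>.

  The key fact is that \<open>g\<close> is a convex function of \<open>z\<^sup>2\<close>, i.e. \<open>- g' z / z\<close> decreases in \<open>z > 0\<close>;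
  it follows by induction on \<open>m\<close>. It yields the strict inequality
  \<open>4 K c < c K' c + c\<^sup>2 g 0\<close> for \<open>c \<ge> 1\<close>, which is used twice. At \<open>c = 1\<close>, combined with the
  B-spline recurrence, it shows that the volume along the family \<open>(a, a, b, \<dots>, b)\<close> decreases
  when one leaves the main diagonal. At \<open>c = a / b\<close> it shows that rotating the first two
  coordinates away from \<open>(a, a)\<close> decreases the volume, so no member of the family is a local
  minimum on the sphere. The volume is eventually increasing in \<open>a\<close>, and the zeros of its
  derivative, piecewise polynomial in \<open>a / b\<close> up to a positive factor, cannot accumulate from the
  right unless the derivative vanishes there, so that a first local minimum exists; the volume
  decreases strictly up to it, hence it is no local maximum. It is critical because the volume is
  differentiable and symmetric in the coordinates.\<close>

section \<open>Cardinal B-splines\<close>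

text \<open>Convexity in \<open>z\<^sup>2\<close> alone gives the key inequality only with
  \<open>\<le>\<close>: equality holds when \<open>g z\<close> is \<open>g 0 - e * z\<^sup>2\<close>
  on \<open>[0, c]\<close>. Strictness needs an input of its own, that \<open>- g' z / z\<close> is
  smaller at 1 than at 1/2; it is carried through the induction and is the reason for the
  restriction \<open>c \<ge> 1\<close>. The induction uses two preceding levels, because for
  \<open>z < 1/2\<close> the arguments \<open>z - 1/2\<close> and \<open>z + 1/2\<close> of the
  recursion lie on different sides of 0.

  Two descriptions of the volume coexist. Splines serve the inequalities but cover only vectors with
  equal remaining entries. Criticality concerns all directions of the sphere, so a sum of truncated
  powers over all sign patterns is kept as well; it is visibly symmetric and differentiable.

  The measure on a hyperplane is defined by an unspecified orthonormal basis. Adding the normal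
  vector to it must give Lebesgue measure on the whole space, which follows from uniqueness of
  translation-invariant measures; the section volume then results from measuring one solid in two
  coordinate systems.\<close>

text \<open>For either sign of \<open>x\<close> one of the two intervals is empty or a single point,
  so this is the signed integral from 0. The base point 0 makes primitives of even functions odd and
  of odd functions even, with no constant to carry along.\<close>

definition prim :: "(real \<Rightarrow> real) \<Rightarrow> real \<Rightarrow> real" where
  "prim f x = integral {0..x} f - integral {x..0} f"

lemma prim_0 [simp]: "prim f 0 = 0"
  by (simp add: prim_def)

lemma DERIV_prim:
  assumes "continuous_on UNIV f"
  shows "(prim f has_real_derivative f x) (at x)"
proof -
  define N where "N = \<bar>x\<bar> + 1"
  have int: "f integrable_on {a..b}" for a b
    using assms continuous_on_subset integrable_continuous_real by blast
  \<comment> \<open>Moving the base point to \<open>-N\<close> gives one formula on both sides of 0,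
    so that differentiation of an integral with fixed left end covers every
    \<open>x\<close>.\<close>
  have eq: "prim f y = integral {-N..y} f - integral {-N..0} f" if "y \<in> {-N<..<N}" for y
  proof (cases "y \<ge> 0")
    case True
    have "integral {-N..0} f + integral {0..y} f = integral {-N..y} f"
      by (rule Henstock_Kurzweil_Integration.integral_combine) (use True int N_def in auto)
    moreover have "integral {y..0} f = 0"
      using True by (cases "y = 0") auto
    ultimately show ?thesis by (simp add: prim_def)
  next
    case False
    have "integral {-N..y} f + integral {y..0} f = integral {-N..0} f"
      by (rule Henstock_Kurzweil_Integration.integral_combine) (use False that int in auto)
    with False show ?thesis by (simp add: prim_def)
  qed
  have x: "x \<in> {-N<..<N}" by (auto simp: N_def)
  have "((\<lambda>y. integral {-N..y} f) has_real_derivative f x) (at x within {-N..N})"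
    by (rule integral_has_real_derivative) (use assms continuous_on_subset x in auto)
  then have "((\<lambda>y. integral {-N..y} f) has_real_derivative f x) (at x)"
    by (rule has_field_derivative_subset[of _ _ x "{-N..N}" "{-N<..<N}", 
          unfolded at_within_open[OF x open_greaterThanLessThan]]) auto
  then have "((\<lambda>y. integral {-N..y} f - integral {-N..0} f) has_real_derivative f x) (at x)"
    by (auto intro!: derivative_eq_intros)
  then show ?thesis
    by (rule has_field_derivative_transform_within_open[OF _ open_greaterThanLessThan x])
       (simp add: eq)
qed

lemma prim_unique:
  assumes "continuous_on UNIV f" "\<And>x. (F has_real_derivative f x) (at x)" "F 0 = 0"
  shows "F x = prim f x"
proof -
  have "((\<lambda>x. F x - prim f x) has_real_derivative 0) (at x)" for x
    by (auto intro!: derivative_eq_intros assms DERIV_prim)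
  then have "F x - prim f x = F 0 - prim f 0"
    by (intro DERIV_isconst_all) auto
  then show ?thesis using assms(3) by simp
qed

lemma prim_odd:
  assumes "continuous_on UNIV f" "\<And>x. f (-x) = f x"
  shows "prim f (-x) = - prim f x"
proof -
  have "((\<lambda>x. - prim f (-x)) has_real_derivative f x) (at x)" for x
    using assms by (auto intro!: derivative_eq_intros DERIV_chain2[OF DERIV_prim])
  from prim_unique[OF assms(1) this, of x] show ?thesis by simp
qed

lemma prim_even:
  assumes "continuous_on UNIV f" "\<And>x. f (-x) = - f x"
  shows "prim f (-x) = prim f x"
proof -
  have "((\<lambda>x. prim f (-x)) has_real_derivative f x) (at x)" for x
    using DERIV_prim[OF assms(1), of "-x"] assms(2)
    by (metis DERIV_mirror add.inverse_inverse)
  from prim_unique[OF assms(1) this, of x] show ?thesis by simp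
qed

lemma continuous_on_prim:
  assumes "continuous_on UNIV f" shows "continuous_on S (prim f)"
  using DERIV_prim[OF assms] by (meson DERIV_continuous_on has_field_derivative_at_within)

text \<open>\<open>bspline k\<close> is the density of a sum of \<open>k + 2\<close> independent uniform variables on
  \<open>[-1/2, 1/2]\<close>; the index is shifted so that all these functions are continuous.\<close>

fun bspline :: "nat \<Rightarrow> real \<Rightarrow> real" where
  "bspline 0 z = max 0 (1 - \<bar>z\<bar>)"
| "bspline (Suc k) z = prim (bspline k) (z + 1/2) - prim (bspline k) (z - 1/2)"

declare bspline.simps [simp del]

lemma continuous_bspline: "continuous_on S (bspline k)"
proof -
  have "continuous_on UNIV (bspline k)"
  proof (induction k)
    case 0
    have "continuous_on UNIV (\<lambda>z::real. max 0 (1 - \<bar>z\<bar>))"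
      by (intro continuous_intros)
    then show ?case by (simp add: bspline.simps(1)[abs_def])
  next
    case (Suc k)
    have "continuous_on UNIV (\<lambda>z. prim (bspline k) (z + 1/2) - prim (bspline k) (z - 1/2))"
      by (intro continuous_intros continuous_on_compose2[OF continuous_on_prim[OF Suc]]) auto
    then show ?case by (simp add: bspline.simps(2)[abs_def])
  qed
  then show ?thesis by (rule continuous_on_subset) simp
qed

lemma isCont_bspline: "isCont (bspline k) x"
  using continuous_bspline[of UNIV k] by (simp add: continuous_on_eq_continuous_at)

lemma DERIV_prim_bspline: "(prim (bspline k) has_real_derivative bspline k x) (at x)"
  by (intro DERIV_prim continuous_bspline)

lemma DERIV_prim2_bspline:
  "(prim (prim (bspline k)) has_real_derivative prim (bspline k) x) (at x)"
  by (intro DERIV_prim continuous_on_prim continuous_bspline)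

lemma bspline_even [simp]: "bspline k (-z) = bspline k z"
proof (induction k arbitrary: z)
  case (Suc k)
  have odd: "prim (bspline k) (-x) = - prim (bspline k) x" for x
    by (intro prim_odd continuous_bspline Suc)
  show ?case using odd[of "z + 1/2"] odd[of "z - 1/2"] by (simp add: bspline.simps)
qed (simp add: bspline.simps)

lemma prim_bspline_minus [simp]: "prim (bspline k) (-x) = - prim (bspline k) x"
  by (intro prim_odd continuous_bspline) simp

lemma prim2_bspline_minus [simp]: "prim (prim (bspline k)) (-x) = prim (prim (bspline k)) x"
  by (intro prim_even continuous_on_prim continuous_bspline) simp

lemma prim_mono:
  assumes "continuous_on UNIV f" "\<And>x. f x \<ge> 0" "x \<le> y"
  shows "prim f x \<le> prim f y"
  by (rule DERIV_nonneg_imp_nondecreasing[OF assms(3)]) (use DERIV_prim[OF assms(1)] assms(2) in blast)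

lemma bspline_nonneg: "bspline k z \<ge> 0"
proof (induction k arbitrary: z)
  case (Suc k)
  have "prim (bspline k) (z - 1/2) \<le> prim (bspline k) (z + 1/2)"
    by (intro prim_mono continuous_bspline Suc) simp
  then show ?case by (simp add: bspline.simps)
qed (simp add: bspline.simps)

lemma prim_bspline_mono: "x \<le> y \<Longrightarrow> prim (bspline k) x \<le> prim (bspline k) y"
  by (intro prim_mono continuous_bspline bspline_nonneg)

lemma prim_tri: "0 \<le> x \<Longrightarrow> x \<le> 1 \<Longrightarrow> prim (bspline 0) x = x - x\<^sup>2 / 2"
proof -
  assume x: "0 \<le> x" "x \<le> 1"
  have "prim (bspline 0) x - (x - x\<^sup>2 / 2) = prim (bspline 0) 0 - (0 - 0\<^sup>2 / 2)"
  proof (cases "x = 0")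
    case False
    show ?thesis
    proof (rule DERIV_isconst_end[where f = "\<lambda>x. prim (bspline 0) x - (x - x\<^sup>2 / 2)"])
      show "0 < x" using x False by simp
      show "continuous_on {0..x} (\<lambda>x. prim (bspline 0) x - (x - x\<^sup>2 / 2))"
        by (intro continuous_intros continuous_on_prim continuous_bspline) auto
      show "((\<lambda>x. prim (bspline 0) x - (x - x\<^sup>2 / 2)) has_real_derivative 0) (at y)"
        if "0 < y" "y < x" for y
        using that x by (auto intro!: derivative_eq_intros DERIV_prim_bspline simp: bspline.simps)
    qed
  qed simp
  then show ?thesis by simp
qed

text \<open>Averaging over a window of length 1 commutes with taking the primitive; no constant
  appears because the second primitive is even.\<close>

lemma prim_bspline_Suc:
  "prim (bspline (Suc k)) z = prim (prim (bspline k)) (z + 1/2) - prim (prim (bspline k)) (z - 1/2)"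
proof (rule prim_unique[symmetric])
  show "((\<lambda>z. prim (prim (bspline k)) (z + 1/2) - prim (prim (bspline k)) (z - 1/2)) 
     has_real_derivative bspline (Suc k) z) (at z)" for z
    by (auto intro!: derivative_eq_intros DERIV_chain2[OF DERIV_prim2_bspline] simp: bspline.simps)
  show "prim (prim (bspline k)) (0 + 1/2) - prim (prim (bspline k)) (0 - 1/2) = 0"
    using prim2_bspline_minus[of k "1/2"] by simp
qed (rule continuous_bspline)

text \<open>The claims are proved together: the next spline vanishes where
  \<open>prim (bspline k)\<close> has become constant, and its own primitive is there an average of
  those constant values. The value 1/2 is half of the total mass, since \<open>prim\<close> starts
  at the centre.\<close>

lemma bspline_support_and_mass:
  shows bspline_outside: "\<bar>z\<bar> \<ge> real (k + 2) / 2 \<Longrightarrow> bspline k z = 0"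
    and prim_bspline_outside: "z \<ge> real (k + 2) / 2 \<Longrightarrow> prim (bspline k) z = 1/2"
proof -
  have flat: "prim (bspline k) z = prim (bspline k) s" if "z \<ge> s" "\<And>y. y \<ge> s \<Longrightarrow> bspline k y = 0" for k z s
  proof (cases "z = s")
    case False
    show ?thesis
      by (rule DERIV_isconst_end) (use that False DERIV_prim_bspline[of k] in \<open>auto intro!: continuous_on_prim continuous_bspline, metis less_imp_le\<close>)
  qed simp
  have "(\<forall>z. \<bar>z\<bar> \<ge> real (k + 2) / 2 \<longrightarrow> bspline k z = 0) \<and>
        (\<forall>z \<ge> real (k + 2) / 2. prim (bspline k) z = 1/2)"
  proof (induction k)
    case 0
    have "prim (bspline 0) z = 1/2" if "z \<ge> 1" for z
      using flat[of 1 z 0] that prim_tri[of 1] by (simp add: bspline.simps)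
    moreover have "bspline 0 z = 0" if "\<bar>z\<bar> \<ge> 1" for z
      using that by (simp add: bspline.simps)
    ultimately show ?case by simp
  next
    case (Suc k)
    have pos: "bspline (Suc k) z = 0" if "z \<ge> real (Suc k + 2) / 2" for z
    proof -
      have "prim (bspline k) (z + 1/2) = 1/2" "prim (bspline k) (z - 1/2) = 1/2"
        using Suc that by (simp_all add: field_simps)
      then show ?thesis by (simp add: bspline.simps)
    qed
    have zero: "bspline (Suc k) z = 0" if "\<bar>z\<bar> \<ge> real (Suc k + 2) / 2" for z
      using pos[of "\<bar>z\<bar>"] that bspline_even[of "Suc k" z] by (metis abs_if)
    note conv = prim_bspline_Suc[of k, symmetric]
    have "prim (bspline (Suc k)) z = 1/2" if "z \<ge> real (Suc k + 2) / 2" for z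
    proof -
      \<comment> \<open>The whole window lies beyond the support of the preceding level, so the mean
        value is already 1/2.\<close>
      have "\<exists>\<xi>. z - 1/2 < \<xi> \<and> \<xi> < z + 1/2 \<and> prim (prim (bspline k)) (z + 1/2) - prim (prim (bspline k)) (z - 1/2)
         = ((z + 1/2) - (z - 1/2)) * prim (bspline k) \<xi>"
        by (rule MVT2) (auto intro: DERIV_prim2_bspline)
      then obtain \<xi> where "z - 1/2 < \<xi>" "prim (prim (bspline k)) (z + 1/2) - prim (prim (bspline k)) (z - 1/2)
         = prim (bspline k) \<xi>" by auto
      with Suc that conv show ?thesis by (simp add: field_simps)
    qed
    with zero show ?case by blast
  qed
  then show "\<bar>z\<bar> \<ge> real (k + 2) / 2 \<Longrightarrow> bspline k z = 0"
    and "z \<ge> real (k + 2) / 2 \<Longrightarrow> prim (bspline k) z = 1/2" by blast+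
qed

lemma DERIV_bspline_Suc:
  "(bspline (Suc k) has_real_derivative bspline k (x + 1/2) - bspline k (x - 1/2)) (at x)"
  unfolding bspline.simps(2)[abs_def]
  by (auto intro!: derivative_eq_intros DERIV_chain2[OF DERIV_prim_bspline])

text \<open>\<open>bdesc k x\<close> is \<open>- bspline k' x\<close> for \<open>x > 0\<close>, except at the kink \<open>x = 1\<close> of \<open>bspline 0\<close>.\<close>

fun bdesc :: "nat \<Rightarrow> real \<Rightarrow> real" where
  "bdesc 0 x = (if x < 1 then 1 else 0)"
| "bdesc (Suc k) x = bspline k (x - 1/2) - bspline k (x + 1/2)"

declare bdesc.simps [simp del]

lemma DERIV_bspline_pos:
  assumes "x > 0" "k = 0 \<Longrightarrow> x \<noteq> 1"
  shows "(bspline k has_real_derivative - bdesc k x) (at x)"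
proof (cases k)
  case (Suc l)
  then show ?thesis using DERIV_bspline_Suc[of l x] by (simp add: bdesc.simps)
next
  case 0
  show ?thesis
  proof (cases "x < 1")
    case True
    have "((\<lambda>x. 1 - x) has_real_derivative - bdesc k x) (at x)"
      using 0 True by (auto intro!: derivative_eq_intros simp: bdesc.simps)
    then show ?thesis
      by (rule has_field_derivative_transform_within_open[of _ _ _ "{0<..<1}"])
         (use True assms 0 in \<open>auto simp: bspline.simps\<close>)
  next
    case False
    have "((\<lambda>x. 0) has_real_derivative - bdesc k x) (at x)"
      using 0 False by (auto intro!: derivative_eq_intros simp: bdesc.simps)
    then show ?thesis
      by (rule has_field_derivative_transform_within_open[of _ _ _ "{1<..}"])
         (use False assms 0 in \<open>auto simp: bspline.simps\<close>)
  qed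
qed

section \<open>Convexity of the splines in the squared variable\<close>

text \<open>The first conjunct is \<open>d y / y \<le> d x / x\<close> multiplied out. The ratio may
  be constant near 0 (it is 2 for \<open>bdesc (Suc 0)\<close> up to 1/2), so strictness is recorded
  separately, between the points 1/2 and 1.\<close>

definition ratio_decreasing :: "(real \<Rightarrow> real) \<Rightarrow> bool" where
  "ratio_decreasing d \<longleftrightarrow> (\<forall>x y. 0 < x \<longrightarrow> x \<le> y \<longrightarrow> x * d y \<le> y * d x) \<and> d 1 < 2 * d (1/2)"

lemma ratio_decreasingD: "ratio_decreasing d \<Longrightarrow> 0 < x \<Longrightarrow> x \<le> y \<Longrightarrow> d y / y \<le> d x / x"
  unfolding ratio_decreasing_def by (simp add: field_simps)

lemma ratio_decreasing_mult: "ratio_decreasing d \<Longrightarrow> 0 < x \<Longrightarrow> x \<le> y \<Longrightarrow> x * d y \<le> y * d x"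
  unfolding ratio_decreasing_def by simp

lemma ratio_decreasing_0: "ratio_decreasing (bdesc 0)"
  by (auto simp: ratio_decreasing_def bdesc.simps)

lemma ratio_decreasing_1: "ratio_decreasing (bdesc (Suc 0))"
proof -
  have val: "bdesc (Suc 0) x = (if x \<le> 1/2 then 2 * x else if x \<le> 3/2 then 3/2 - x else 0)" if "x > 0" for x
    using that by (auto simp: bdesc.simps bspline.simps max_def abs_if)
  have "x * bdesc (Suc 0) y \<le> y * bdesc (Suc 0) x" if "0 < x" "x \<le> y" for x y :: real
  proof -
    have 1: "x * (3/2 - y) \<le> y * (2 * x)" if "y > 1/2"
    proof -
      have "x * (3/2 - y) \<le> x * (2 * y)" using that \<open>0 < x\<close> by (intro mult_left_mono) auto
      then show ?thesis by (simp add: mult_ac)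
    qed
    have 2: "x * (3/2 - y) \<le> y * (3/2 - x)"
      using that by (simp add: algebra_simps)
    have 3: "y * (3/2 - x) \<ge> 0" if "x \<le> 3/2" using that \<open>0 < x\<close> \<open>x \<le> y\<close> by auto
    show ?thesis using that 1 2 3 by (auto simp: val)
  qed
  then show ?thesis by (simp add: ratio_decreasing_def val)
qed

text \<open>Integrates \<open>bdesc (Suc k) u \<ge> a * u\<close> over \<open>{q..p}\<close>, where
  \<open>a\<close> is the ratio at the right end \<open>p\<close>, the smallest one on the
  interval.\<close>

lemma bspline_diff_ge:
  assumes Q: "ratio_decreasing (bdesc (Suc k))" and "0 \<le> q" "q < p"
  shows "bspline (Suc k) q - bspline (Suc k) p \<ge> bdesc (Suc k) p / p * (p\<^sup>2 - q\<^sup>2) / 2"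
proof -
  define a where "a = bdesc (Suc k) p / p"
  have "bspline (Suc k) p + a * p\<^sup>2 / 2 \<le> bspline (Suc k) q + a * q\<^sup>2 / 2"
  proof (rule DERIV_nonpos_imp_decreasing_open[where f = "\<lambda>u. bspline (Suc k) u + a * u\<^sup>2 / 2"])
    show "q \<le> p" using assms by simp
    show "continuous_on {q..p} (\<lambda>u. bspline (Suc k) u + a * u\<^sup>2 / 2)"
      by (intro continuous_intros continuous_bspline) auto
    fix u assume u: "q < u" "u < p"
    have "((\<lambda>u. bspline (Suc k) u + a * u\<^sup>2 / 2) has_real_derivative - bdesc (Suc k) u + a * u) (at u)"
      using u assms by (auto intro!: derivative_eq_intros DERIV_bspline_pos)
    moreover have "- bdesc (Suc k) u + a * u \<le> 0"
      using ratio_decreasingD[OF Q, of u p] u assms by (simp add: a_def field_simps)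
    ultimately show "\<exists>y. ((\<lambda>u. bspline (Suc k) u + a * u\<^sup>2 / 2) has_real_derivative y) (at u) \<and> y \<le> 0"
      by blast
  qed
  then show ?thesis
    unfolding a_def[symmetric] by (simp add: right_diff_distrib diff_divide_distrib)
qed

lemma continuous_bdesc_Suc: "continuous_on S (bdesc (Suc k))"
  unfolding bdesc.simps[abs_def]
  by (intro continuous_intros continuous_on_compose2[OF continuous_bspline[of UNIV]]) auto

text \<open>The aim is that the derivative of \<open>d\<close> at \<open>z\<close> is at most
  \<open>d z / z\<close>. Beyond 1/2 the arguments \<open>z - 1/2\<close> and \<open>z + 1/2\<close>
  are both positive and level \<open>Suc k\<close> suffices. Below 1/2 they have opposite signs, and
  concavity of \<open>d\<close>, drawn from level \<open>k\<close>, takes over.\<close>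

lemma ratio_decreasing_step:
  assumes Q0: "ratio_decreasing (bdesc k)" and Q1: "ratio_decreasing (bdesc (Suc k))"
  shows "ratio_decreasing (bdesc (Suc (Suc k)))"
proof -
  define d where "d = bdesc (Suc (Suc k))"
  define d' where "d' = (\<lambda>z. bdesc (Suc k) (z + 1/2) - bdesc (Suc k) (z - 1/2))"
  have der: "(d has_real_derivative d' z) (at z)" if "z > 1/2" for z
    unfolding d_def d'_def bdesc.simps(2)[of "Suc k", abs_def] using that
    by (auto intro!: derivative_eq_intros DERIV_chain2[OF DERIV_bspline_pos])
  have cont: "continuous_on S d" for S
    unfolding d_def by (rule continuous_bdesc_Suc)
  have key: "z * d' z \<le> d z" "z < 1 \<Longrightarrow> z * d' z < d z" if "z > 1/2" for z
  proof -
    define p q where "p = z + 1/2" and "q = z - 1/2"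
    have pq: "0 < q" "q < p" using that by (auto simp: p_def q_def)
    define a b where "a = bdesc (Suc k) p / p" and "b = bdesc (Suc k) q / q"
    \<comment> \<open>Since \<open>p\<^sup>2 - q\<^sup>2 = 2 * z\<close>, this lower bound is
      \<open>z * a\<close>; since \<open>p - q = 1\<close>, the derivative is
      \<open>a + q * (a - b)\<close>, at most the same \<open>a\<close>.\<close>
    have "d z \<ge> a * (p\<^sup>2 - q\<^sup>2) / 2"
      using bspline_diff_ge[OF Q1, of q p] pq by (simp add: d_def bdesc.simps(2)[of "Suc k"] p_def q_def a_def)
    also have "a * (p\<^sup>2 - q\<^sup>2) / 2 = z * a"
      by (simp add: p_def q_def power2_eq_square algebra_simps)
    finally have ge: "d z \<ge> z * a" .
    have d': "d' z = p * a - q * b"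
      using pq by (simp add: d'_def a_def b_def p_def q_def)
    have ab: "a \<le> b" using ratio_decreasingD[OF Q1, of q p] pq by (simp add: a_def b_def)
    have "p * a - q * b = a + q * (a - b)" by (simp add: p_def q_def field_simps)
    moreover have "q * (a - b) \<le> 0" using ab pq by (simp add: mult_nonneg_nonpos)
    ultimately have "d' z \<le> a" using d' by simp
    then have "z * d' z \<le> z * a" using that by simp
    then show "z * d' z \<le> d z" using ge by simp
    \<comment> \<open>Now \<open>q < 1/2\<close> and \<open>1 < p\<close>, so the strict gap between
      the ratios at 1/2 and 1, known at level \<open>Suc k\<close>, separates \<open>a\<close> from
      \<open>b\<close>.\<close>
    assume z1: "z < 1"
    have "a \<le> bdesc (Suc k) 1 / 1"
      using ratio_decreasingD[OF Q1, of 1 p] that by (simp add: a_def p_def)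
    also have "\<dots> < bdesc (Suc k) (1/2) / (1/2)"
      using Q1 by (simp add: ratio_decreasing_def)
    also have "\<dots> \<le> b"
      unfolding b_def by (rule ratio_decreasingD[OF Q1]) (use pq z1 in \<open>auto simp: q_def\<close>)
    finally have "q * (a - b) < 0" using pq by (simp add: mult_pos_neg)
    then have "d' z < a" using \<open>p * a - q * b = a + q * (a - b)\<close> d' by simp
    then have "z * d' z < z * a" using that by simp
    then show "z * d' z < d z" using ge by simp
  qed
  have rder: "((\<lambda>z. d z / z) has_real_derivative (z * d' z - d z) / z\<^sup>2) (at z)" if "z > 1/2" for z
    using der[OF that] that by (auto intro!: derivative_eq_intros simp: power2_eq_square field_simps)
  have far: "d y / y \<le> d x / x" if "1/2 \<le> x" "x \<le> y" for x y
  proof (rule DERIV_nonpos_imp_decreasing_open[where f = "\<lambda>z. d z / z"])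
    show "x \<le> y" by fact
    show "continuous_on {x..y} (\<lambda>z. d z / z)"
      using that by (intro continuous_intros cont) auto
    fix z assume "x < z" "z < y"
    then have "z > 1/2" using that by simp
    with rder[of z] key(1)[of z] show "\<exists>w. ((\<lambda>z. d z / z) has_real_derivative w) (at z) \<and> w \<le> 0"
      by (intro exI[of _ "(z * d' z - d z) / z\<^sup>2"]) (auto simp: divide_nonpos_nonneg)
  qed
  have strict: "d 1 / 1 < d (1/2) / (1/2)"
  proof (rule DERIV_neg_imp_decreasing_open[where f = "\<lambda>z. d z / z"])
    show "continuous_on {1/2..1} (\<lambda>z. d z / z)"
      by (intro continuous_intros cont) auto
    fix z :: real assume "1/2 < z" "z < 1"
    with rder[of z] key(2)[of z] show "\<exists>w. ((\<lambda>z. d z / z) has_real_derivative w) (at z) \<and> w < 0"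
      by (intro exI[of _ "(z * d' z - d z) / z\<^sup>2"]) (auto simp: divide_neg_pos)
  qed simp
  \<comment> \<open>On \<open>{0..1/2}\<close> the function \<open>d\<close> is concave: its derivative is \<open>s\<close>.\<close>
  define s where "s = (\<lambda>u. 2 * bspline k u - bspline k (1 - u) - bspline k (1 + u))"
  have dsder: "(d has_real_derivative s u) (at u)" if "0 < u" "u < 1/2" for u
  proof -
    have "bspline k (u - 1) = bspline k (1 - u)"
      using bspline_even[of k "1 - u"] by (simp del: bspline_even)
    then have eq: "s u = (bspline k u - bspline k (u - 1)) - (bspline k (u + 1) - bspline k u)"
      by (simp add: s_def add.commute)
    have 1: "((\<lambda>u. bspline (Suc k) (u - 1/2)) has_real_derivative bspline k u - bspline k (u - 1)) (at u)"
      using DERIV_bspline_Suc[of k "u - 1/2"] DERIV_shift[of "bspline (Suc k)" _ u "-1/2"] by simp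
    have 2: "((\<lambda>u. bspline (Suc k) (u + 1/2)) has_real_derivative bspline k (u + 1) - bspline k u) (at u)"
      using DERIV_bspline_Suc[of k "u + 1/2"] DERIV_shift[of "bspline (Suc k)" _ u "1/2"]
      by (simp add: add.assoc)
    show ?thesis
      unfolding d_def bdesc.simps(2)[of "Suc k", abs_def] eq by (intro DERIV_diff 1 2)
  qed
  have smono: "s y \<le> s x" if "0 \<le> x" "x \<le> y" "y \<le> 1/2" for x y
  proof (rule DERIV_nonpos_imp_decreasing_open[where f = s])
    show "x \<le> y" by fact
    show "continuous_on {x..y} s"
      unfolding s_def by (intro continuous_intros continuous_bspline continuous_on_compose2[OF continuous_bspline[of UNIV]]) auto
    fix u assume "x < u" "u < y"
    then have u: "0 < u" "u < 1/2" using that by auto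
    define D where "D = bdesc k"
    have "(s has_real_derivative - 2 * D u - D (1 - u) + D (1 + u)) (at u)"
      unfolding s_def D_def using u
      by (auto intro!: derivative_eq_intros DERIV_bspline_pos DERIV_chain2[OF DERIV_bspline_pos])
    moreover have "- 2 * D u - D (1 - u) + D (1 + u) \<le> 0"
    proof -
      \<comment> \<open>The point \<open>1 - u\<close> lies between \<open>u\<close> and
        \<open>1 + u\<close>. Using its ratio for all three terms bounds the expression by
        \<open>a * (- 2 * u - (1 - u) + (1 + u))\<close>, which is 0.\<close>
      define a where "a = D (1 - u) / (1 - u)"
      have "D (1 + u) / (1 + u) \<le> a" unfolding a_def D_def
        by (rule ratio_decreasingD[OF Q0]) (use u in auto)
      then have "D (1 + u) \<le> (1 + u) * a" using u by (simp add: field_simps)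
      moreover have "a \<le> D u / u" unfolding a_def D_def
        by (rule ratio_decreasingD[OF Q0]) (use u in auto)
      then have "D u \<ge> u * a" using u by (simp add: field_simps)
      moreover have "D (1 - u) = (1 - u) * a" using u by (simp add: a_def)
      ultimately show ?thesis by (simp add: algebra_simps)
    qed
    ultimately show "\<exists>w. (s has_real_derivative w) (at u) \<and> w \<le> 0" by blast
  qed
  have d0: "d 0 = 0" unfolding d_def bdesc.simps using bspline_even[of "Suc k" "1/2"] by simp
  have near: "d y / y \<le> d x / x" if "0 < x" "x \<le> y" "y \<le> 1/2" for x y
  proof (rule DERIV_nonpos_imp_decreasing_open[where f = "\<lambda>z. d z / z"])
    show "x \<le> y" by fact
    show "continuous_on {x..y} (\<lambda>z. d z / z)"
      using that by (intro continuous_intros cont) auto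
    fix z assume "x < z" "z < y"
    then have z: "0 < z" "z < 1/2" using that by auto
    \<comment> \<open>For a concave function vanishing at 0 the tangent slope at \<open>z\<close> is
      at most the chord slope \<open>d z / z\<close>.\<close>
    have "d 0 - 0 * s z \<le> d z - z * s z"
    proof (rule DERIV_nonneg_imp_increasing_open[where f = "\<lambda>u. d u - u * s z"])
      show "continuous_on {0..z} (\<lambda>u. d u - u * s z)" by (intro continuous_intros cont)
      fix u assume u: "0 < u" "u < z"
      have "((\<lambda>u. d u - u * s z) has_real_derivative s u - s z) (at u)"
        using dsder[of u] u z by (auto intro!: derivative_eq_intros)
      moreover have "s u - s z \<ge> 0" using smono[of u z] u z by simp
      ultimately show "\<exists>w. ((\<lambda>u. d u - u * s z) has_real_derivative w) (at u) \<and> w \<ge> 0" by blast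
    qed (use z in simp)
    then have le: "z * s z \<le> d z" by (simp add: d0)
    have "((\<lambda>z. d z / z) has_real_derivative (z * s z - d z) / z\<^sup>2) (at z)"
      using dsder[OF z] z by (auto intro!: derivative_eq_intros simp: power2_eq_square field_simps)
    with le show "\<exists>w. ((\<lambda>z. d z / z) has_real_derivative w) (at z) \<and> w \<le> 0"
      by (intro exI[of _ "(z * s z - d z) / z\<^sup>2"]) (auto simp: divide_nonpos_nonneg)
  qed
  have "d y / y \<le> d x / x" if "0 < x" "x \<le> y" for x y
  proof (cases "y \<le> 1/2 \<or> 1/2 \<le> x")
    case True then show ?thesis using near far that by blast
  next
    case False
    then show ?thesis using near[of x "1/2"] far[of "1/2" y] that by linarith
  qed
  then have "x * d y \<le> y * d x" if "0 < x" "x \<le> y" for x y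
    using that by (simp add: field_simps)
  with strict show ?thesis unfolding ratio_decreasing_def d_def[symmetric] by auto
qed

text \<open>Two explicit base cases, because the step consumes two consecutive levels.\<close>

lemma ratio_decreasing_bdesc: "ratio_decreasing (bdesc k)"
proof (induction k rule: less_induct)
  case (less k)
  consider "k = 0" | "k = Suc 0" | l where "k = Suc (Suc l)" by (metis not0_implies_Suc)
  then show ?case
    using less ratio_decreasing_0 ratio_decreasing_1 ratio_decreasing_step by cases auto
qed

text \<open>Chord slopes of a convex function of \<open>z\<^sup>2\<close>. The points
  \<open>z * s\<close> and \<open>c * s\<close> move out from 0 together, so that the ratio
  comparison decides the sign of the derivative in \<open>s\<close>. For \<open>k = 0\<close> the
  kink forbids this, and the drop is computed as \<open>min z 1\<close>.\<close>

lemma bspline_drop_scaled: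
  assumes "0 < z" "z \<le> c"
  shows "z\<^sup>2 * (bspline k 0 - bspline k c) \<le> c\<^sup>2 * (bspline k 0 - bspline k z)"
proof (cases k)
  case 0
  have "z\<^sup>2 * min c 1 \<le> c\<^sup>2 * min z 1"
  proof (cases "z \<le> 1")
    case True
    have "z\<^sup>2 * min c 1 \<le> z\<^sup>2 * c" using assms by (intro mult_left_mono) auto
    also have "\<dots> = z * c * z" by (simp add: power2_eq_square)
    also have "\<dots> \<le> c * c * z" using assms by (intro mult_right_mono) auto
    finally show ?thesis using True by (simp add: power2_eq_square)
  next
    case False
    then show ?thesis using assms by (auto simp: min_def intro: power_mono)
  qed
  moreover have "bspline k 0 - bspline k x = min x 1" if "x > 0" for x
    using that 0 by (auto simp: bspline.simps min_def max_def)
  ultimately show ?thesis using assms by auto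
next
  case (Suc l)
  define \<phi> where "\<phi> s = c\<^sup>2 * (bspline k 0 - bspline k (z * s)) - z\<^sup>2 * (bspline k 0 - bspline k (c * s))" for s
  have "\<phi> 0 \<le> \<phi> 1"
  proof (rule DERIV_nonneg_imp_increasing_open[where f = \<phi>])
    show "continuous_on {0..1} \<phi>" unfolding \<phi>_def
      by (intro continuous_intros continuous_on_compose2[OF continuous_bspline[of UNIV]]) auto
    fix s :: real assume s: "0 < s" "s < 1"
    have "(\<phi> has_real_derivative c\<^sup>2 * (z * bdesc k (z * s)) - z\<^sup>2 * (c * bdesc k (c * s))) (at s)"
      unfolding \<phi>_def using s assms Suc
      by (auto intro!: derivative_eq_intros DERIV_chain2[OF DERIV_bspline_pos])
    moreover have "c\<^sup>2 * (z * bdesc k (z * s)) - z\<^sup>2 * (c * bdesc k (c * s)) \<ge> 0"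
    proof -
      have "z * s * bdesc k (c * s) \<le> c * s * bdesc k (z * s)"
        using ratio_decreasing_mult[OF ratio_decreasing_bdesc[of k], of "z * s" "c * s"] assms s by auto
      then have "z * bdesc k (c * s) \<le> c * bdesc k (z * s)" using s by (simp add: mult.commute mult.left_commute)
      then have "c * z * (z * bdesc k (c * s)) \<le> c * z * (c * bdesc k (z * s))"
        using assms by (intro mult_left_mono) auto
      then show ?thesis by (simp add: power2_eq_square mult_ac)
    qed
    ultimately show "\<exists>y. (\<phi> has_real_derivative y) (at s) \<and> y \<ge> 0" by blast
  qed simp
  then show ?thesis by (simp add: \<phi>_def)
qed

text \<open>The strict conjunct of \<open>ratio_decreasing\<close> in integrated form:
  \<open>\<phi>\<close> is 0 at 0, nondecreasing before 1, and has positive derivative at 1.\<close>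

lemma bspline_drop_half: "bspline k 0 - bspline k 1 < 4 * (bspline k 0 - bspline k (1/2))"
proof (cases k)
  case 0 then show ?thesis by (simp add: bspline.simps)
next
  case (Suc l)
  define \<phi> where "\<phi> s = 4 * (bspline k 0 - bspline k (s / 2)) - (bspline k 0 - bspline k s)" for s :: real
  have der: "(\<phi> has_real_derivative 2 * bdesc k (s / 2) - bdesc k s) (at s)" if "s > 0" for s
    unfolding \<phi>_def using that Suc
    by (auto intro!: derivative_eq_intros DERIV_chain2[OF DERIV_bspline_pos] DERIV_bspline_pos)
  have "2 * bdesc k (1 / 2) - bdesc k 1 > 0"
    using ratio_decreasing_bdesc[of k] by (simp add: ratio_decreasing_def)
  from DERIV_pos_inc_left[OF der[of 1] this] obtain \<delta> where
    \<delta>: "\<delta> > 0" "\<And>h. 0 < h \<Longrightarrow> h < \<delta> \<Longrightarrow> \<phi> (1 - h) < \<phi> 1" by auto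
  define h where "h = min (\<delta> / 2) (1/2)"
  have h: "0 < h" "h < \<delta>" "h < 1" using \<delta>(1) by (auto simp: h_def)
  have "\<phi> 0 \<le> \<phi> (1 - h)"
  proof (rule DERIV_nonneg_imp_increasing_open[where f = \<phi>])
    show "continuous_on {0..1 - h} \<phi>" unfolding \<phi>_def
      by (intro continuous_intros continuous_bspline continuous_on_compose2[OF continuous_bspline[of UNIV]]) auto
    fix s assume s: "0 < s" "s < 1 - h"
    have "s / 2 * bdesc k s \<le> s * bdesc k (s / 2)"
      using ratio_decreasing_mult[OF ratio_decreasing_bdesc[of k], of "s / 2" s] s by auto
    then have "2 * bdesc k (s / 2) - bdesc k s \<ge> 0" using s by (simp add: field_simps)
    with der[OF s(1)] show "\<exists>y. (\<phi> has_real_derivative y) (at s) \<and> y \<ge> 0" by blast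
  qed (use h in simp)
  with \<delta>(2)[OF h(1,2)] show ?thesis by (simp add: \<phi>_def)
qed

text \<open>With \<open>D z = g 0 - g z\<close> and \<open>g = bspline k\<close>, right side minus
  left side is the integral of \<open>(3 * c - 4 * z) * D z\<close> over \<open>[0, c]\<close>. The
  weight integrates to 0 against \<open>z\<^sup>2\<close>, so \<open>D z\<close> may be replaced by
  \<open>D z - e * z\<^sup>2\<close> for any \<open>e\<close>.\<close>

lemma bspline_trapezoid:
  assumes "c \<ge> 1"
  shows "4 * prim (prim (bspline k)) c < c * prim (bspline k) c + c\<^sup>2 * bspline k 0"
proof -
  define D where "D z = bspline k 0 - bspline k z" for z
  \<comment> \<open>This \<open>e\<close> makes \<open>D z - e * z\<^sup>2\<close> vanish at
    \<open>3 * c / 4\<close>, the zero of the weight. As \<open>D z / z\<^sup>2\<close> decreases,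
    both factors change sign there together, and their product, the derivative of
    \<open>\<phi>\<close>, is nonnegative.\<close>
  define e where "e = D (3 * c / 4) / (3 * c / 4)\<^sup>2"
  define \<phi> where "\<phi> z = (3 * c * z - 2 * z\<^sup>2) * bspline k 0 - (3 * c - 4 * z) * prim (bspline k) z
       - 4 * prim (prim (bspline k)) z - e * (c * z ^ 3 - z ^ 4)" for z
  have der: "(\<phi> has_real_derivative (3 * c - 4 * z) * (D z - e * z\<^sup>2)) (at z)" for z
  proof -
    have "(\<phi> has_real_derivative (3 * c - 4 * z) * bspline k 0
       - ((0 - 4) * prim (bspline k) z + bspline k z * (3 * c - 4 * z)) - 4 * prim (bspline k) z
       - e * (c * (3 * z\<^sup>2) - 4 * z ^ 3)) (at z)"
      unfolding \<phi>_def
      by (intro DERIV_diff DERIV_mult DERIV_cmult DERIV_prim_bspline DERIV_prim2_bspline)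
         (auto intro!: derivative_eq_intros)
    also have "(3 * c - 4 * z) * bspline k 0
       - ((0 - 4) * prim (bspline k) z + bspline k z * (3 * c - 4 * z)) - 4 * prim (bspline k) z
       - e * (c * (3 * z\<^sup>2) - 4 * z ^ 3) = (3 * c - 4 * z) * (D z - e * z\<^sup>2)"
      by (simp add: D_def power2_eq_square power3_eq_cube algebra_simps)
    finally show ?thesis .
  qed
  have ge: "z\<^sup>2 * e \<le> D z" if "0 < z" "z \<le> 3 * c / 4" for z
    using bspline_drop_scaled[OF that, of k] assms
    by (simp add: e_def D_def field_simps)
  have le: "D z \<le> z\<^sup>2 * e" if "3 * c / 4 \<le> z" for z
    using bspline_drop_scaled[of "3 * c / 4" z k] that assms
    by (simp add: e_def D_def field_simps)
  have nn: "(3 * c - 4 * z) * (D z - e * z\<^sup>2) \<ge> 0" if "0 < z" for z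
    using ge[of z] le[of z] that
    by (cases "z \<le> 3 * c / 4") (auto simp: mult.commute intro: mult_nonneg_nonneg mult_nonpos_nonpos)
  have mono: "\<phi> x \<le> \<phi> y" if "0 \<le> x" "x \<le> y" for x y
  proof (rule DERIV_nonneg_imp_increasing_open[where f = \<phi>, OF that(2)])
    show "\<exists>w. (\<phi> has_real_derivative w) (at z) \<and> w \<ge> 0" if "x < z" "z < y" for z
      using der[of z] nn[of z] that \<open>0 \<le> x\<close> by force
    show "continuous_on {x..y} \<phi>"
      using DERIV_isCont[OF der] by (intro continuous_at_imp_continuous_on) blast
  qed
  have "\<phi> 0 < \<phi> c"
  \<comment> \<open>In the first case the integrand is positive at \<open>c\<close>. Otherwise
    \<open>D z / z\<^sup>2\<close> has not dropped below \<open>e\<close> at \<open>c\<close>, hence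
    not at 1 either, and \<open>bspline_drop_half\<close> makes it exceed \<open>e\<close> at 1/2,
    where the weight is positive as \<open>c \<ge> 1\<close>.\<close>
  proof (cases "D c < c\<^sup>2 * e")
    case True
    then have "(3 * c - 4 * c) * (D c - e * c\<^sup>2) > 0" using assms by (intro mult_neg_neg) (auto simp: mult.commute)
    from DERIV_pos_inc_left[OF der this] obtain \<delta> where
      \<delta>: "\<delta> > 0" "\<And>h. 0 < h \<Longrightarrow> h < \<delta> \<Longrightarrow> \<phi> (c - h) < \<phi> c" by auto
    define h where "h = min (\<delta> / 2) (1/2)"
    have h: "0 < h" "h < \<delta>" "h < 1" using \<delta>(1) by (auto simp: h_def)
    show ?thesis using \<delta>(2)[OF h(1,2)] mono[of 0 "c - h"] h assms by simp
  next
    case False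
    have "D 1 \<ge> e"
      using bspline_drop_scaled[of 1 c k] False assms
      by (simp add: D_def) (smt (verit, best) mult_le_cancel_left_pos zero_less_power)
    then have "e / 4 < D (1/2)" using bspline_drop_half[of k] by (simp add: D_def)
    then have "(3 * c - 4 * (1/2)) * (D (1/2) - e * (1/2)\<^sup>2) > 0"
      using assms by (intro mult_pos_pos) (auto simp: power2_eq_square)
    from DERIV_pos_inc_left[OF der this] obtain \<delta> where
      \<delta>: "\<delta> > 0" "\<And>h. 0 < h \<Longrightarrow> h < \<delta> \<Longrightarrow> \<phi> (1/2 - h) < \<phi> (1/2)" by auto
    define h where "h = min (\<delta> / 2) (1/4)"
    have h: "0 < h" "h < \<delta>" "h < 1/2" using \<delta>(1) by (auto simp: h_def)
    show ?thesis using \<delta>(2)[OF h(1,2)] mono[of 0 "1/2 - h"] mono[of "1/2" c] h assms by simp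
  qed
  then show ?thesis by (simp add: \<phi>_def power2_eq_square power3_eq_cube power4_eq_xxxx algebra_simps)
qed

section \<open>The B-spline recurrence and the values at 1\<close>

text \<open>The Cox-de Boor recurrence for uniform knots, centred at 0. In the induction step the
  difference \<open>E\<close> of both sides has derivative 0 by the recurrence one level below at
  \<open>z + 1/2\<close> and \<open>z - 1/2\<close>, and it vanishes beyond all supports.\<close>

lemma bspline_recurrence:
  "real (k + 2) * bspline (Suc k) z =
   (real (k + 3) / 2 + z) * bspline k (z + 1/2) + (real (k + 3) / 2 - z) * bspline k (z - 1/2)"
proof (induction k arbitrary: z)
  case 0
  have pos: "2 * bspline (Suc 0) z =
     (3 / 2 + z) * bspline 0 (z + 1/2) + (3 / 2 - z) * bspline 0 (z - 1/2)" if "z \<ge> 0" for z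
  proof -
    have m: "prim (bspline 0) (z - 1/2) = - prim (bspline 0) (1/2 - z)"
      using prim_bspline_minus[of 0 "1/2 - z"] by simp
    have out: "prim (bspline 0) x = 1/2" if "x \<ge> 1" for x
      using that prim_bspline_outside[of 0 x] by simp
    consider "z < 1/2" | "1/2 \<le> z" "z \<le> 3/2" | "z > 3/2" by linarith
    then show ?thesis
    proof cases
      case 1
      then show ?thesis using that
        by (simp add: bspline.simps(2) m prim_tri) (simp add: bspline.simps max_def abs_if power2_eq_square field_simps)
    next
      case 2
      then show ?thesis using that
        by (simp add: bspline.simps(2) out prim_tri) (simp add: bspline.simps max_def abs_if power2_eq_square field_simps)
    next
      case 3
      then show ?thesis using that
        by (simp add: bspline.simps(2) out) (simp add: bspline.simps max_def abs_if power2_eq_square field_simps)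
    qed
  qed
  show ?case
  proof (cases "z \<ge> 0")
    case True then show ?thesis using pos[of z] by simp
  next
    case False
    have "bspline 0 (- z + 1/2) = bspline 0 (z - 1/2)" "bspline 0 (- z - 1/2) = bspline 0 (z + 1/2)"
      using bspline_even[of 0 "z - 1/2"] bspline_even[of 0 "z + 1/2"] by (simp_all add: add.commute del: bspline_even)
    then show ?thesis using pos[of "-z"] False by simp
  qed
next
  case (Suc k)
  define E where "E z = real (k + 3) * bspline (Suc (Suc k)) z
     - (real (k + 4) / 2 + z) * bspline (Suc k) (z + 1/2) - (real (k + 4) / 2 - z) * bspline (Suc k) (z - 1/2)" for z
  have "(E has_real_derivative 0) (at z)" for z
  proof -
    have R1: "real (k + 2) * bspline (Suc k) (z + 1/2) =
      (real (k + 3) / 2 + (z + 1/2)) * bspline k (z + 1) + (real (k + 3) / 2 - (z + 1/2)) * bspline k z"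
      using Suc.IH[of "z + 1/2"] by (simp add: add.assoc)
    have R2: "real (k + 2) * bspline (Suc k) (z - 1/2) =
      (real (k + 3) / 2 + (z - 1/2)) * bspline k z + (real (k + 3) / 2 - (z - 1/2)) * bspline k (z - 1)"
      using Suc.IH[of "z - 1/2"] by simp
    have d1: "((\<lambda>z. bspline (Suc k) (z + 1/2)) has_real_derivative bspline k (z + 1) - bspline k z) (at z)"
      using DERIV_bspline_Suc[of k "z + 1/2"] DERIV_shift[of "bspline (Suc k)" _ z "1/2"]
      by (simp add: add.assoc)
    have d2: "((\<lambda>z. bspline (Suc k) (z - 1/2)) has_real_derivative bspline k z - bspline k (z - 1)) (at z)"
      using DERIV_bspline_Suc[of k "z - 1/2"] DERIV_shift[of "bspline (Suc k)" _ z "-1/2"] by simp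
    have "(E has_real_derivative
       real (k + 3) * (bspline (Suc k) (z + 1/2) - bspline (Suc k) (z - 1/2))
       - (bspline (Suc k) (z + 1/2) + (real (k + 4) / 2 + z) * (bspline k (z + 1) - bspline k z))
       - (- bspline (Suc k) (z - 1/2) + (real (k + 4) / 2 - z) * (bspline k z - bspline k (z - 1)))) (at z)"
      unfolding E_def by (auto intro!: derivative_eq_intros DERIV_bspline_Suc d1 d2)
    moreover have "real (k + 3) * (bspline (Suc k) (z + 1/2) - bspline (Suc k) (z - 1/2))
       - (bspline (Suc k) (z + 1/2) + (real (k + 4) / 2 + z) * (bspline k (z + 1) - bspline k z))
       - (- bspline (Suc k) (z - 1/2) + (real (k + 4) / 2 - z) * (bspline k z - bspline k (z - 1))) = 0"
      using R1 R2 by (simp add: field_simps)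
    ultimately show ?thesis by simp
  qed
  then have "E z = E (real (k + 5) + \<bar>z\<bar>)" by (intro DERIV_isconst_all) auto
  also have "\<dots> = 0" by (simp add: E_def bspline_outside)
  finally show ?case by (simp add: E_def add.commute)
qed

text \<open>The recurrence at 1/2, where the shifted arguments are 1 and 0. It serves to eliminate
  \<open>bspline k 1\<close> from the derivative of \<open>psi\<close> at 1.\<close>

lemma prim_bspline_1: "2 * real (k + 2) * prim (bspline k) 1 = real (k + 2) * bspline k 0 + real (k + 4) * bspline k 1"
proof -
  have "bspline (Suc k) (1/2) = prim (bspline k) 1" by (simp add: bspline.simps(2))
  then show ?thesis using bspline_recurrence[of k "1/2"] by (simp add: field_simps)
qed

text \<open>The recurrence one level up at 0, where evenness merges the two terms. It amounts to
  \<open>psi k 1 = 0\<close>: the main diagonal is a critical point of the family.\<close>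

lemma prim2_bspline_1: "2 * real (k + 3) * prim (prim (bspline k)) 1 = real (k + 4) * prim (bspline k) 1"
proof -
  have "bspline (Suc k) (1/2) = prim (bspline k) 1" by (simp add: bspline.simps(2))
  moreover have "bspline (Suc (Suc k)) 0 = 2 * prim (prim (bspline k)) 1"
    using prim_bspline_minus[of "Suc k" "1/2"] by (simp add: bspline.simps(2) prim_bspline_Suc)
  moreover have "bspline (Suc k) (-1/2) = bspline (Suc k) (1/2)" using bspline_even[of "Suc k" "1/2"] by simp
  ultimately show ?thesis using bspline_recurrence[of "Suc k" 0] by (simp add: field_simps)
qed

section \<open>Comparison of a section with its rotation in two coordinates\<close>

text \<open>The ratio \<open>bdesc k u / u\<close> decreases and is 0 beyond the support, hence it
  is nonnegative before.\<close>

lemma bspline_antimono: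
  assumes "0 \<le> x" "x \<le> y" shows "bspline k y \<le> bspline k x"
proof (cases k)
  case 0 then show ?thesis using assms by (simp add: bspline.simps)
next
  case (Suc l)
  have nn: "bdesc k u \<ge> 0" if "u > 0" for u
  proof -
    define v where "v = u + real (l + 3)"
    have "bdesc k v = 0" using that by (simp add: Suc bdesc.simps v_def bspline_outside)
    then show ?thesis
      using ratio_decreasing_mult[OF ratio_decreasing_bdesc[of k], of u v] that
      by (simp add: v_def zero_le_mult_iff)
  qed
  show ?thesis
  proof (rule DERIV_nonpos_imp_decreasing_open[OF assms(2)])
    fix u assume "x < u" "u < y"
    then have "u > 0" using assms by simp
    from DERIV_bspline_pos[of u k] nn[OF this] this Suc
    show "\<exists>w. (bspline k has_real_derivative w) (at u) \<and> w \<le> 0" by force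
  qed (rule continuous_bspline)
qed

text \<open>The primitive of the spline is concave on the nonnegative axis, because the spline
  decreases there, and it vanishes at 0.\<close>

lemma prim_bspline_chord:
  assumes "0 \<le> u" "u \<le> c"
  shows "u * prim (bspline k) c \<le> c * prim (bspline k) u"
proof -
  define \<phi> where "\<phi> s = c * prim (bspline k) (u * s) - u * prim (bspline k) (c * s)" for s
  have "\<phi> 0 \<le> \<phi> 1"
  proof (rule DERIV_nonneg_imp_increasing_open[where f = \<phi>])
    show "continuous_on {0..1} \<phi>" unfolding \<phi>_def
      by (intro continuous_intros continuous_on_compose2[OF continuous_on_prim[OF continuous_bspline, of UNIV]]) auto
    fix s :: real assume s: "0 < s" "s < 1"
    have "(\<phi> has_real_derivative c * (u * bspline k (u * s)) - u * (c * bspline k (c * s))) (at s)"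
      unfolding \<phi>_def
      by (auto intro!: derivative_eq_intros DERIV_chain2[OF DERIV_prim_bspline])
    moreover have "c * u * bspline k (c * s) \<le> c * u * bspline k (u * s)"
      using s assms by (intro mult_left_mono bspline_antimono) (auto intro: mult_right_mono)
    ultimately show "\<exists>y. (\<phi> has_real_derivative y) (at s) \<and> y \<ge> 0" by (force simp: mult_ac)
  qed simp
  then show ?thesis by (simp add: \<phi>_def)
qed

text \<open>As a function of \<open>r\<^sup>2\<close> the second primitive \<open>K\<close> has
  derivative \<open>K' r / (2 * r)\<close>, which decreases by \<open>prim_bspline_chord\<close>; so
  \<open>K\<close> is concave in \<open>r\<^sup>2\<close> and lies below its tangent at
  \<open>c\<^sup>2\<close>.\<close>

lemma prim2_bspline_tangent:
  assumes "0 \<le> r" "r \<le> c" "0 < c"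
  shows "prim (prim (bspline k)) r \<le> prim (prim (bspline k)) c - prim (bspline k) c * (c\<^sup>2 - r\<^sup>2) / (2 * c)"
proof -
  define e where "e = prim (bspline k) c / c"
  have "prim (prim (bspline k)) r - e * r\<^sup>2 / 2 \<le> prim (prim (bspline k)) c - e * c\<^sup>2 / 2"
  proof (rule DERIV_nonneg_imp_increasing_open[where f = "\<lambda>u. prim (prim (bspline k)) u - e * u\<^sup>2 / 2", OF assms(2)])
    show "continuous_on {r..c} (\<lambda>u. prim (prim (bspline k)) u - e * u\<^sup>2 / 2)"
      by (intro continuous_intros continuous_on_prim continuous_bspline) auto
    fix u assume u: "r < u" "u < c"
    have "((\<lambda>u. prim (prim (bspline k)) u - e * u\<^sup>2 / 2) has_real_derivative prim (bspline k) u - e * u) (at u)"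
      by (auto intro!: derivative_eq_intros DERIV_prim2_bspline)
    moreover have "prim (bspline k) u - e * u \<ge> 0"
      using prim_bspline_chord[of u c k] u assms by (simp add: e_def field_simps)
    ultimately show "\<exists>y. ((\<lambda>u. prim (prim (bspline k)) u - e * u\<^sup>2 / 2) has_real_derivative y) (at u) \<and> y \<ge> 0"
      by blast
  qed
  then show ?thesis using assms by (simp add: e_def right_diff_distrib diff_divide_distrib mult.commute)
qed

lemma prim2_bspline_ge:
  assumes "0 \<le> q" "\<And>u. 0 \<le> u \<Longrightarrow> u \<le> q \<Longrightarrow> \<gamma> \<le> bspline k u"
  shows "\<gamma> * q\<^sup>2 / 2 \<le> prim (prim (bspline k)) q"
proof -
  have 1: "prim (bspline k) 0 - \<gamma> * 0 \<le> prim (bspline k) u - \<gamma> * u" if "0 \<le> u" "u \<le> q" for u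
    by (rule DERIV_nonneg_imp_nondecreasing[OF that(1)])
       (use that assms in \<open>auto intro!: derivative_eq_intros DERIV_prim_bspline exI\<close>)
  have "prim (prim (bspline k)) 0 - \<gamma> * 0\<^sup>2 / 2 \<le> prim (prim (bspline k)) q - \<gamma> * q\<^sup>2 / 2"
    by (rule DERIV_nonneg_imp_nondecreasing[OF assms(1)])
       (use 1 in \<open>auto intro!: derivative_eq_intros DERIV_prim2_bspline exI simp: mult.commute\<close>)
  then show ?thesis by simp
qed

text \<open>The two sides are the section volumes, up to a common positive factor, for first two
  coordinates \<open>p + q\<close>, \<open>p - q\<close> with \<open>p\<^sup>2 + q\<^sup>2 = c\<^sup>2\<close>, and \<open>c\<close>, \<open>c\<close>; the other coordinates are \<open>1\<close>.\<close>

lemma rotated_section_less: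
  assumes "c \<ge> 1"
  shows "\<exists>\<eta>>0. \<forall>q. 0 < q \<longrightarrow> q < \<eta> \<longrightarrow>
    c\<^sup>2 * (prim (prim (bspline k)) (sqrt (c\<^sup>2 - q\<^sup>2)) - prim (prim (bspline k)) q)
      < (c\<^sup>2 - 2 * q\<^sup>2) * prim (prim (bspline k)) c"
proof -
  define K K1 where "K = prim (prim (bspline k))" and "K1 = prim (bspline k)"
  have trap: "4 * K c < c * K1 c + c\<^sup>2 * bspline k 0"
    using bspline_trapezoid[OF assms, of k] by (simp add: K_def K1_def)
  have "(4 * K c - c * K1 c) / c\<^sup>2 < bspline k 0"
    using trap assms by (simp add: field_simps)
  \<comment> \<open>The strict inequality leaves room to lower \<open>bspline k 0\<close> to some
    \<open>\<gamma>\<close>, which then bounds the spline from below on a whole neighbourhood of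
    0.\<close>
  then obtain \<gamma> where \<gamma>: "\<gamma> < bspline k 0" "(4 * K c - c * K1 c) / c\<^sup>2 < \<gamma>"
    using dense by blast
  from \<gamma>(2) have \<gamma>c: "4 * K c < c * K1 c + c\<^sup>2 * \<gamma>" using assms by (simp add: field_simps)
  have "\<forall>e>0. \<exists>d>0. \<forall>u. dist u 0 < d \<longrightarrow> dist (bspline k u) (bspline k 0) < e"
    using isCont_bspline[where k = k and x = 0] unfolding continuous_at_eps_delta .
  then obtain \<eta> where "\<eta> > 0" "\<And>u. dist u 0 < \<eta> \<Longrightarrow> dist (bspline k u) (bspline k 0) < bspline k 0 - \<gamma>"
    using \<gamma>(1) by (metis diff_gt_0_iff_gt)
  then have \<eta>: "\<eta> > 0" "\<And>u. \<bar>u\<bar> < \<eta> \<Longrightarrow> \<gamma> < bspline k u"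
    by (auto simp: dist_real_def abs_less_iff)
  have "c\<^sup>2 * (K (sqrt (c\<^sup>2 - q\<^sup>2)) - K q) < (c\<^sup>2 - 2 * q\<^sup>2) * K c" if q: "0 < q" "q < min \<eta> c" for q
  proof -
    have qc: "q\<^sup>2 < c\<^sup>2" using q by (intro power_strict_mono) auto
    have "sqrt (c\<^sup>2 - q\<^sup>2) \<le> c" using assms by (intro real_le_lsqrt) auto
    \<comment> \<open>The tangent bound is linear in \<open>c\<^sup>2 - q\<^sup>2\<close>, so the
      loss is a pure multiple of \<open>q\<^sup>2\<close>, without remainder.\<close>
    then have "K (sqrt (c\<^sup>2 - q\<^sup>2)) \<le> K c - K1 c * q\<^sup>2 / (2 * c)"
      using prim2_bspline_tangent[of "sqrt (c\<^sup>2 - q\<^sup>2)" c k] qc assms by (simp add: K_def K1_def)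
    moreover have "\<gamma> * q\<^sup>2 / 2 \<le> K q"
      unfolding K_def using q \<eta>(2) by (intro prim2_bspline_ge) (auto intro: less_imp_le)
    ultimately have "c\<^sup>2 * (K (sqrt (c\<^sup>2 - q\<^sup>2)) - K q) \<le> c\<^sup>2 * (K c - K1 c * q\<^sup>2 / (2 * c) - \<gamma> * q\<^sup>2 / 2)"
      by (intro mult_left_mono) auto
    also have "\<dots> = c\<^sup>2 * K c - q\<^sup>2 / 2 * (c * K1 c + c\<^sup>2 * \<gamma>)"
      using assms by (simp add: field_simps power2_eq_square)
    also have "\<dots> < c\<^sup>2 * K c - q\<^sup>2 / 2 * (4 * K c)"
      using \<gamma>c q by (intro diff_strict_left_mono mult_strict_left_mono) auto
    finally show ?thesis by (simp add: algebra_simps)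
  qed
  then show ?thesis using \<eta>(1) assms unfolding K_def by (intro exI[of _ "min \<eta> c"]) auto
qed

text \<open>Up to a positive factor, \<open>psi k c\<close> is the derivative of the section volume along the family
  \<open>(a, a, b, \<dots>, b)\<close> at the point with \<open>a / b = c\<close>, in dimension \<open>n = k + 4\<close>.\<close>

definition psi :: "nat \<Rightarrow> real \<Rightarrow> real" where
  "psi k c = c * (real (k + 2) + 2 * c\<^sup>2) * prim (bspline k) c - 2 * (real (k + 2) + c\<^sup>2) * prim (prim (bspline k)) c"

text \<open>\<open>psi\<close> vanishes at 1, so its sign just to the right is that of its
  derivative there.\<close>

lemma psi_negative_right_of_1: "\<exists>\<epsilon>>0. \<forall>c. 1 < c \<longrightarrow> c < 1 + \<epsilon> \<longrightarrow> psi k c < 0"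
proof -
  define m where "m = real (k + 2)"
  have "(psi k has_real_derivative
     (m + 6 * 1\<^sup>2) * prim (bspline k) 1 + 1 * (m + 2 * 1\<^sup>2) * bspline k 1
     - 4 * 1 * prim (prim (bspline k)) 1 - 2 * (m + 1\<^sup>2) * prim (bspline k) 1) (at 1)" (is "(_ has_real_derivative ?d) _")
    unfolding psi_def[abs_def] m_def[symmetric]
    by (auto intro!: derivative_eq_intros DERIV_prim_bspline DERIV_prim2_bspline simp: algebra_simps)
  moreover have "?d < 0"
  proof -
    have 1: "2 * m * prim (bspline k) 1 = m * bspline k 0 + (m + 2) * bspline k 1"
      using prim_bspline_1[of k] by (simp add: m_def add.commute add.left_commute)
    have 2: "2 * (m + 1) * prim (prim (bspline k)) 1 = (m + 2) * prim (bspline k) 1"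
      using prim2_bspline_1[of k] by (simp add: m_def add.commute add.left_commute)
    have "m * (4 * prim (prim (bspline k)) 1) < m * (prim (bspline k) 1 + bspline k 0)"
      using bspline_trapezoid[of 1 k] by (intro mult_strict_left_mono) (auto simp: m_def)
    with 1 2 show ?thesis by (simp add: algebra_simps)
  qed
  ultimately obtain \<delta> where \<delta>: "\<delta> > 0" "\<And>h. 0 < h \<Longrightarrow> h < \<delta> \<Longrightarrow> psi k (1 + h) < psi k 1"
    using DERIV_neg_dec_right by blast
  have "psi k 1 = 0"
    using prim2_bspline_1[of k] by (simp add: psi_def algebra_simps)
  then have "psi k c < 0" if "1 < c" "c < 1 + \<delta>" for c
    using \<delta>(2)[of "c - 1"] that by simp
  with \<delta>(1) show ?thesis by blast
qed

text \<open>Beyond the support, \<open>prim (bspline k)\<close> is 1/2 and \<open>K c\<close> is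
  \<open>c / 2\<close> minus a positive constant, namely \<open>f (m / 2)\<close>. In
  \<open>psi\<close> the cubic terms cancel, and the term \<open>2 * f (m / 2) * c\<^sup>2\<close>
  dominates.\<close>

lemma psi_eventually_positive: "\<exists>c>1. psi k c > 0"
proof -
  define m where "m = real (k + 2)"
  define K where "K = prim (prim (bspline k))"
  have m: "m \<ge> 2" by (simp add: m_def)
  define f where "f c = c / 2 - K c" for c
  have der: "(f has_real_derivative 1 / 2 - prim (bspline k) c) (at c)" for c
    unfolding f_def K_def by (auto intro!: derivative_eq_intros DERIV_prim2_bspline)
  have le: "prim (bspline k) c \<le> 1/2" for c
    using prim_bspline_mono[of c m k] prim_bspline_outside[of k m] prim_bspline_outside[of k c]
    by (cases "c \<le> m") (auto simp: m_def)
  have "1 / 2 - prim (bspline k) 0 > 0" by simp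
  from DERIV_pos_inc_right[OF der this] obtain \<delta> where "\<delta> > 0" "\<And>h. 0 < h \<Longrightarrow> h < \<delta> \<Longrightarrow> f 0 < f (0 + h)"
    by blast
  moreover define h where "h = min (\<delta> / 2) (m / 2)"
  ultimately have h: "0 < h" "h \<le> m / 2" "f 0 < f h" using m by (auto simp: min_def)
  note h(3)
  also have "f h \<le> f (m / 2)"
  proof (rule DERIV_nonneg_imp_nondecreasing[OF h(2)])
    show "\<exists>y. (f has_real_derivative y) (at x) \<and> 0 \<le> y" for x
      using der[of x] le[of x] by (intro exI[of _ "1 / 2 - prim (bspline k) x"]) simp
  qed
  finally have e: "f (m / 2) > 0" by (simp add: f_def K_def)
  have const: "f c = f (m / 2)" if "c > m / 2" for c
  proof (rule DERIV_isconst_end[OF that])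
    show "continuous_on {m / 2..c} f"
      using DERIV_isCont[OF der] by (intro continuous_at_imp_continuous_on) blast
    show "(f has_real_derivative 0) (at x)" if "m / 2 < x" for x
    proof -
      have "1 / 2 - prim (bspline k) x = 0"
        using prim_bspline_outside[of k x] that by (simp add: m_def)
      with der[of x] show ?thesis by metis
    qed
  qed
  \<comment> \<open>The second bound makes \<open>2 * f (m / 2) * c\<^sup>2\<close> at least
    \<open>c * m / 2\<close>, the amount of the only negative term left.\<close>
  define c where "c = max (m + 1) (m / (4 * f (m / 2)))"
  have "m + 1 \<le> c" by (simp add: c_def)
  then have c: "c > m / 2" "c > 1" using m by auto
  have "4 * f (m / 2) * c \<ge> m" using e by (simp add: c_def max_def field_simps)
  then have cm: "c * m \<le> c * (4 * f (m / 2) * c)" using c by (intro mult_left_mono) auto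
  have fm: "f (m / 2) * m > 0" using e m by simp
  have Kc: "K c = c / 2 - f (m / 2)" using const[OF c(1)] by (simp add: f_def)
  have Pc: "prim (bspline k) c = 1/2" using c by (intro prim_bspline_outside) (simp add: m_def)
  have "psi k c = c * (m + 2 * c\<^sup>2) * prim (bspline k) c - 2 * (m + c\<^sup>2) * K c"
    by (simp add: psi_def m_def K_def)
  also have "\<dots> = 2 * (f (m / 2) * m) + (c * (4 * f (m / 2) * c) - c * m) / 2"
    unfolding Kc Pc by (simp add: power2_eq_square field_simps)
  also have "\<dots> > 0"
    using cm fm by (intro add_pos_nonneg) auto
  finally have "psi k c > 0" .
  with c show ?thesis by blast
qed

section \<open>The first local minimum\<close>

text \<open>One-sided germs replace a list of breakpoints: a piecewise polynomial is polynomial just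
  to the right of every point, knots included, and this passes through shifts, products and
  primitives. The right side suffices, because a set can approach its infimum only from
  there.\<close>

definition right_polynomial :: "(real \<Rightarrow> real) \<Rightarrow> bool" where
  "right_polynomial f \<longleftrightarrow> (\<forall>x. \<exists>\<delta>>0. \<exists>p. \<forall>y. x \<le> y \<longrightarrow> y < x + \<delta> \<longrightarrow> f y = poly p y)"

lemma right_polynomial_poly: "(\<And>x. f x = poly p x) \<Longrightarrow> right_polynomial f"
  unfolding right_polynomial_def by (intro allI exI[of _ 1] conjI exI[of _ p]) auto

lemma right_polynomial_combine:
  assumes "right_polynomial f" "right_polynomial g"
    "\<And>p q. \<exists>r. \<forall>y. h (poly p y) (poly q y) = poly r y"
  shows "right_polynomial (\<lambda>x. h (f x) (g x))"
  unfolding right_polynomial_def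
proof
  fix x
  from assms(1,2) obtain \<delta> p \<epsilon> q where "\<delta> > 0" "\<epsilon> > 0" and
    p: "\<And>y. x \<le> y \<Longrightarrow> y < x + \<delta> \<Longrightarrow> f y = poly p y" and
    q: "\<And>y. x \<le> y \<Longrightarrow> y < x + \<epsilon> \<Longrightarrow> g y = poly q y"
    unfolding right_polynomial_def by meson
  moreover from assms(3)[of p q] obtain r where "\<And>y. h (poly p y) (poly q y) = poly r y" by blast
  ultimately show "\<exists>\<delta>>0. \<exists>p. \<forall>y. x \<le> y \<longrightarrow> y < x + \<delta> \<longrightarrow> h (f y) (g y) = poly p y"
    by (intro exI[of _ "min \<delta> \<epsilon>"] conjI exI[of _ r]) auto
qed

lemma right_polynomial_diff: "right_polynomial f \<Longrightarrow> right_polynomial g \<Longrightarrow> right_polynomial (\<lambda>x. f x - g x)"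
  by (rule right_polynomial_combine[where h = "(-)"]) (auto simp flip: poly_diff)

lemma right_polynomial_mult: "right_polynomial f \<Longrightarrow> right_polynomial g \<Longrightarrow> right_polynomial (\<lambda>x. f x * g x)"
  by (rule right_polynomial_combine[where h = "(*)"]) (auto simp flip: poly_mult)

lemma right_polynomial_shift:
  assumes "right_polynomial f" shows "right_polynomial (\<lambda>x. f (x + a))"
  unfolding right_polynomial_def
proof
  fix x
  from assms obtain \<delta> p where "\<delta> > 0" "\<And>y. x + a \<le> y \<Longrightarrow> y < x + a + \<delta> \<Longrightarrow> f y = poly p y"
    unfolding right_polynomial_def by meson
  then show "\<exists>\<delta>>0. \<exists>p. \<forall>y. x \<le> y \<longrightarrow> y < x + \<delta> \<longrightarrow> f (y + a) = poly p y"
    by (intro exI[of _ \<delta>] conjI exI[of _ "pcompose p [:a, 1:]"]) (auto simp: poly_pcompose add.commute)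
qed

lemma poly_antiderivative: "\<exists>q. pderiv q = (p :: real poly)"
proof
  have "pderiv (\<Sum>i\<le>degree p. monom (coeff p i / real (Suc i)) (Suc i)) = (\<Sum>i\<le>degree p. monom (coeff p i) i)"
    by (simp add: pderiv_monom higher_pderiv_sum[of 1, simplified])
  then show "pderiv (\<Sum>i\<le>degree p. monom (coeff p i / real (Suc i)) (Suc i)) = p"
    by (simp add: poly_as_sum_of_monoms)
qed

lemma right_polynomial_prim:
  assumes "right_polynomial f" "continuous_on UNIV f"
  shows "right_polynomial (prim f)"
  unfolding right_polynomial_def
proof
  fix x
  from assms obtain \<delta> p where \<delta>: "\<delta> > 0" and p: "\<And>y. x \<le> y \<Longrightarrow> y < x + \<delta> \<Longrightarrow> f y = poly p y"
    unfolding right_polynomial_def by meson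
  obtain q where q: "pderiv q = p" using poly_antiderivative by blast
  have "prim f y = poly (q + [:prim f x - poly q x:]) y" if "x \<le> y" "y < x + \<delta>" for y
  proof (cases "x = y")
    case False
    have "prim f y - poly q y = prim f x - poly q x"
    proof (rule DERIV_isconst_end[where f = "\<lambda>y. prim f y - poly q y"])
      show "x < y" using that False by simp
      show "continuous_on {x..y} (\<lambda>y. prim f y - poly q y)"
        by (intro continuous_intros continuous_on_prim assms)
      fix z assume "x < z" "z < y"
      then have "f z = poly (pderiv q) z" using p[of z] that q by simp
      then show "((\<lambda>y. prim f y - poly q y) has_real_derivative 0) (at z)"
        using DERIV_diff[OF DERIV_prim[OF assms(2), of z] poly_DERIV[of q z]] by simp
    qed
    then show ?thesis by simp
  qed simp
  with \<delta> show "\<exists>\<delta>>0. \<exists>p. \<forall>y. x \<le> y \<longrightarrow> y < x + \<delta> \<longrightarrow> prim f y = poly p y" by blast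
qed

lemma right_polynomial_bspline: "right_polynomial (bspline k)"
proof (induction k)
  case 0
  have "\<exists>\<delta>>0. \<exists>p. \<forall>y. x \<le> y \<longrightarrow> y < x + \<delta> \<longrightarrow> bspline 0 y = poly p y" for x
  proof -
    consider "x < -1" | "-1 \<le> x" "x < 0" | "0 \<le> x" "x < 1" | "x \<ge> 1" by linarith
    then show ?thesis
    proof cases
      case 1 then show ?thesis by (intro exI[of _ "- 1 - x"] conjI exI[of _ 0]) (auto simp: bspline.simps)
    next
      case 2 then show ?thesis by (intro exI[of _ "- x"] conjI exI[of _ "[:1, 1:]"]) (auto simp: bspline.simps)
    next
      case 3 then show ?thesis by (intro exI[of _ "1 - x"] conjI exI[of _ "[:1, -1:]"]) (auto simp: bspline.simps)
    next
      case 4 then show ?thesis by (intro exI[of _ 1] conjI exI[of _ 0]) (auto simp: bspline.simps)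
    qed
  qed
  then show ?case by (simp add: right_polynomial_def)
next
  case (Suc k)
  have "right_polynomial (prim (bspline k))"
    by (intro right_polynomial_prim Suc continuous_bspline)
  from right_polynomial_diff[OF right_polynomial_shift[OF this, of "1/2"] right_polynomial_shift[OF this, of "-1/2"]]
  show ?case by (simp add: bspline.simps(2)[abs_def])
qed

lemma right_polynomial_psi: "right_polynomial (psi k)"
proof -
  have 1: "right_polynomial (prim (bspline k))"
    by (intro right_polynomial_prim right_polynomial_bspline continuous_bspline)
  have 2: "right_polynomial (prim (prim (bspline k)))"
    by (intro right_polynomial_prim 1 continuous_on_prim continuous_bspline)
  show ?thesis unfolding psi_def[abs_def]
    by (intro right_polynomial_diff right_polynomial_mult 1 2
        right_polynomial_poly[of "\<lambda>c. c * (real (k + 2) + 2 * c\<^sup>2)" "[:0, real (k + 2), 0, 2:]"]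
        right_polynomial_poly[of "\<lambda>c. 2 * (real (k + 2) + c\<^sup>2)" "[:2 * real (k + 2), 0, 2:]"])
       (auto simp: algebra_simps power2_eq_square)
qed

lemma right_polynomial_zeros:
  assumes "right_polynomial f"
  shows "\<exists>\<delta>>0. (\<forall>y. x < y \<longrightarrow> y < x + \<delta> \<longrightarrow> f y = 0) \<or> (\<forall>y. x < y \<longrightarrow> y < x + \<delta> \<longrightarrow> f y \<noteq> 0)"
proof -
  from assms obtain \<delta> p where \<delta>: "\<delta> > 0" and p: "\<And>y. x \<le> y \<Longrightarrow> y < x + \<delta> \<Longrightarrow> f y = poly p y"
    unfolding right_polynomial_def by meson
  show ?thesis
  proof (cases "p = 0")
    case True then show ?thesis using \<delta> p by auto
  next
    case False
    then have "finite {y. poly p y = 0}" by (rule poly_roots_finite)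
    from finite_set_avoid[OF this, of x] obtain d where
      d: "d > 0" "\<And>y. poly p y = 0 \<Longrightarrow> y \<noteq> x \<Longrightarrow> d \<le> dist x y" by auto
    have "f y \<noteq> 0" if "x < y" "y < x + min \<delta> d" for y
      using p[of y] d(2)[of y] that by (auto simp: dist_real_def)
    then show ?thesis using \<delta> d(1) by (intro exI[of _ "min \<delta> d"]) auto
  qed
qed

section \<open>First local minima of a function of one variable\<close>

lemma local_min_on_open:
  "open S \<Longrightarrow> local_min_on f S x \<longleftrightarrow> x \<in> S \<and> (\<forall>\<^sub>F y in at x. f x \<le> f y)"
  by (metis at_within_open local_min_on_def)

lemma interior_argmin_local_min:
  fixes f :: "real \<Rightarrow> real"
  assumes "open S" "{x0..y0} \<subseteq> S" "x0 < t" "t < y0" "\<And>y. x0 \<le> y \<Longrightarrow> y \<le> y0 \<Longrightarrow> f t \<le> f y"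
  shows "local_min_on f S t"
proof -
  have "\<forall>\<^sub>F y in at t. y \<in> {x0<..<y0}"
    using assms by (intro eventually_at_in_open') auto
  then have "\<forall>\<^sub>F y in at t. f t \<le> f y" by eventually_elim (use assms in auto)
  then show ?thesis using assms by (auto simp: local_min_on_open)
qed

text \<open>Only the consequence \<open>zeros\<close> of the piecewise polynomial form enters. It
  survives the change of variable from \<open>a / b\<close> to \<open>a\<close>, whereas being
  piecewise polynomial need not.\<close>

locale initially_decreasing =
  fixes f f' :: "real \<Rightarrow> real" and l u \<epsilon> x1 :: real
  assumes der: "\<And>x. l < x \<Longrightarrow> x < u \<Longrightarrow> (f has_real_derivative f' x) (at x)"
    and \<epsilon>: "\<epsilon> > 0" and neg: "\<And>x. l < x \<Longrightarrow> x < l + \<epsilon> \<Longrightarrow> x < u \<Longrightarrow> f' x < 0"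
    and x1: "l < x1" "x1 < u" "f' x1 > 0"
    and zeros: "\<And>x. l < x \<Longrightarrow> x < u \<Longrightarrow> \<exists>\<delta>>0.
      (\<forall>y. x < y \<longrightarrow> y < x + \<delta> \<longrightarrow> y < u \<longrightarrow> f' y = 0) \<or> (\<forall>y. x < y \<longrightarrow> y < x + \<delta> \<longrightarrow> y < u \<longrightarrow> f' y \<noteq> 0)"
begin

lemma argmin:
  assumes "l < a" "a < b" "b < u" "a < l + \<epsilon>"
  obtains t where "a < t" "t \<le> b" "\<And>y. a \<le> y \<Longrightarrow> y \<le> b \<Longrightarrow> f t \<le> f y"
proof -
  have "continuous_on {a..b} f"
    using assms by (intro continuous_at_imp_continuous_on ballI DERIV_isCont[OF der]) auto
  then obtain t where t: "t \<in> {a..b}" "\<And>y. y \<in> {a..b} \<Longrightarrow> f t \<le> f y"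
    using continuous_attains_inf[of "{a..b}" f] assms by auto
  have "t \<noteq> a"
  proof
    assume "t = a"
    have "(f has_real_derivative f' a) (at a)" "f' a < 0" using assms by (auto intro: der neg)
    from DERIV_neg_dec_right[OF this] obtain d where d: "d > 0" "\<And>h. 0 < h \<Longrightarrow> h < d \<Longrightarrow> f (a + h) < f a"
      by blast
    define h where "h = min (d / 2) (b - a)"
    have "0 < h" "h < d" "a + h \<in> {a..b}" using d(1) assms by (auto simp: h_def)
    with d(2)[of h] t(2)[of "a + h"] \<open>t = a\<close> show False by simp
  qed
  with t show ?thesis by (intro that[of t]) auto
qed

lemma local_min_deriv: "local_min_on f {l<..<u} \<zeta> \<Longrightarrow> f' \<zeta> = 0"
proof -
  assume "local_min_on f {l<..<u} \<zeta>"
  then have z: "l < \<zeta>" "\<zeta> < u" and "\<forall>\<^sub>F y in at \<zeta>. f \<zeta> \<le> f y" by (auto simp: local_min_on_open)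
  then obtain d where "d > 0" "\<And>y. y \<noteq> \<zeta> \<Longrightarrow> dist y \<zeta> < d \<Longrightarrow> f \<zeta> \<le> f y"
    by (auto simp: eventually_at)
  then have "f \<zeta> \<le> f y" if "\<bar>\<zeta> - y\<bar> < d" for y
    using that by (cases "y = \<zeta>") (auto simp: dist_real_def abs_minus_commute)
  with \<open>d > 0\<close> show ?thesis
    by (intro DERIV_local_min[OF der[OF z], of d]) auto
qed

text \<open>If \<open>f\<close> failed to drop from \<open>x\<close> to \<open>y\<close>, a
  minimiser over \<open>{a..y}\<close>, with \<open>a\<close> in the initial range of descent, could
  be taken in the interior and would be a local minimum before \<open>s\<close>.\<close>

lemma decreasing_before:
  assumes "\<And>\<zeta>. local_min_on f {l<..<u} \<zeta> \<Longrightarrow> s \<le> \<zeta>" "l < x" "x < y" "y \<le> s" "y < u"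
  shows "f y < f x"
proof (rule ccontr)
  assume "\<not> f y < f x"
  define a where "a = (l + min x (l + \<epsilon>)) / 2"
  have a: "l < a" "a < x" "a < l + \<epsilon>" using assms \<epsilon> by (auto simp: a_def min_def field_simps)
  obtain t where t: "a < t" "t \<le> y" "\<And>z. a \<le> z \<Longrightarrow> z \<le> y \<Longrightarrow> f t \<le> f z"
    using argmin[of a y] a assms by auto
  obtain t' where t': "a < t'" "t' < y" "\<And>z. a \<le> z \<Longrightarrow> z \<le> y \<Longrightarrow> f t' \<le> f z"
  \<comment> \<open>A minimiser at the right end can be exchanged for \<open>x\<close>, whose value
    is no larger.\<close>
  proof (cases "t = y")
    case True
    with t \<open>\<not> f y < f x\<close> a assms show ?thesis by (intro that[of x]) force+
  next
    case False
    with t show ?thesis by (intro that[of t]) auto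
  qed
  have "local_min_on f {l<..<u} t'"
    by (rule interior_argmin_local_min[of _ a y]) (use t' a assms in auto)
  with assms(1,4) t'(2) show False by force
qed

text \<open>The infimum \<open>\<xi>\<close> of the local minima is the candidate. Were it not
  attained, zeros of \<open>f'\<close> would accumulate at it from the right, and \<open>f\<close>
  would be constant there by \<open>zeros\<close>. As \<open>f\<close> decreases up to
  \<open>\<xi>\<close>, and local minima need not be strict, \<open>\<xi>\<close> would be one after
  all.\<close>

lemma first_min_exists:
  "\<exists>\<xi>. local_min_on f {l<..<u} \<xi> \<and> (\<forall>\<zeta>. local_min_on f {l<..<u} \<zeta> \<longrightarrow> \<xi> \<le> \<zeta>)"
proof -
  define S where "S = {\<zeta>. local_min_on f {l<..<u} \<zeta>}"
  have SI: "l < \<zeta>" "\<zeta> < u" "f' \<zeta> = 0" if "\<zeta> \<in> S" for \<zeta>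
    using that local_min_deriv by (auto simp: S_def local_min_on_def)
  have lb: "l + \<epsilon> \<le> \<zeta>" if "\<zeta> \<in> S" for \<zeta> using neg[of \<zeta>] SI[OF that] by force
  have bdd: "bdd_below S" using lb by (rule bdd_belowI)
  have "S \<noteq> {}"
  proof -
    define a where "a = (l + min x1 (l + \<epsilon>)) / 2"
    have a: "l < a" "a < x1" "a < l + \<epsilon>" using x1 \<epsilon> by (auto simp: a_def min_def field_simps)
    obtain t where t: "a < t" "t \<le> x1" "\<And>z. a \<le> z \<Longrightarrow> z \<le> x1 \<Longrightarrow> f t \<le> f z"
      using argmin[of a x1] a x1 by auto
    have "t \<noteq> x1"
    proof
      assume "t = x1"
      from DERIV_pos_inc_left[OF der[OF x1(1,2)] x1(3)] obtain d where
        d: "d > 0" "\<And>h. 0 < h \<Longrightarrow> h < d \<Longrightarrow> f (x1 - h) < f x1" by blast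
      define h where "h = min (d / 2) (x1 - a)"
      have "0 < h" "h < d" "a \<le> x1 - h" "x1 - h \<le> x1" using d(1) a by (auto simp: h_def)
      with d(2)[of h] t(3)[of "x1 - h"] \<open>t = x1\<close> show False by simp
    qed
    then have "local_min_on f {l<..<u} t"
      by (intro interior_argmin_local_min[of _ a x1]) (use t a x1 in auto)
    then show ?thesis by (auto simp: S_def)
  qed
  define \<xi> where "\<xi> = Inf S"
  have le: "\<xi> \<le> \<zeta>" if "\<zeta> \<in> S" for \<zeta> unfolding \<xi>_def using that bdd by (rule cInf_lower)
  have "l + \<epsilon> \<le> \<xi>" unfolding \<xi>_def using \<open>S \<noteq> {}\<close> lb by (rule cInf_greatest)
  then have \<xi>: "l < \<xi>" "\<xi> < u" using \<epsilon> le SI \<open>S \<noteq> {}\<close> by (auto, force)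
  have "\<xi> \<in> S"
  proof (rule ccontr)
    assume "\<xi> \<notin> S"
    obtain \<delta> where \<delta>: "\<delta> > 0" and dich: "(\<forall>y. \<xi> < y \<longrightarrow> y < \<xi> + \<delta> \<longrightarrow> y < u \<longrightarrow> f' y = 0) \<or> (\<forall>y. \<xi> < y \<longrightarrow> y < \<xi> + \<delta> \<longrightarrow> y < u \<longrightarrow> f' y \<noteq> 0)"
      using zeros[OF \<xi>] by blast
    obtain \<zeta> where "\<zeta> \<in> S" "\<zeta> < \<xi> + \<delta>"
      using cInf_lessD[OF \<open>S \<noteq> {}\<close>, of "\<xi> + \<delta>"] \<delta> by (auto simp: \<xi>_def)
    moreover from this have "\<xi> < \<zeta>" using le \<open>\<xi> \<notin> S\<close> by (metis le_less)
    ultimately have zero: "f' y = 0" if "\<xi> < y" "y < \<xi> + \<delta>" "y < u" for y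
      using dich SI that by blast
    have "f \<xi> \<le> f y" if "y \<in> {l<..<min (\<xi> + \<delta>) u}" for y
    proof -
      consider "y < \<xi>" | "y = \<xi>" | "y > \<xi>" by linarith
      then show ?thesis
      proof cases
        case 1
        have "f \<xi> < f y"
          by (rule decreasing_before[of \<xi>]) (use 1 that le \<xi> in \<open>auto simp: S_def\<close>)
        then show ?thesis by simp
      next
        case 3
        have "f y = f \<xi>"
        proof (rule DERIV_isconst_end[OF 3])
          show "continuous_on {\<xi>..y} f"
            using \<xi> that by (intro continuous_at_imp_continuous_on ballI DERIV_isCont[OF der]) auto
          show "(f has_real_derivative 0) (at z)" if "\<xi> < z" "z < y" for z
            using der[of z] zero[of z] \<open>y \<in> _\<close> that \<xi> by auto
        qed
        then show ?thesis by simp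
      qed simp
    qed
    moreover have "\<forall>\<^sub>F y in at \<xi>. y \<in> {l<..<min (\<xi> + \<delta>) u}"
      using \<xi> \<delta> by (intro eventually_at_in_open') auto
    ultimately have "\<forall>\<^sub>F y in at \<xi>. f \<xi> \<le> f y" by (auto elim: eventually_mono)
    then have "\<xi> \<in> S" using \<xi> by (auto simp: S_def local_min_on_open)
    with \<open>\<xi> \<notin> S\<close> show False ..
  qed
  with le show ?thesis by (auto simp: S_def)
qed

end

section \<open>Lebesgue measure in orthonormal coordinates\<close>

lemma product_sigma_finite_lborel: "product_sigma_finite (\<lambda>_. lborel :: real measure)"
  by standard

lemma distr_PiM_lborel_translate:
  assumes "finite B"
  shows "distr (\<Pi>\<^sub>M b\<in>B. lborel) (\<Pi>\<^sub>M b\<in>B. lborel) (\<lambda>f. \<lambda>b\<in>B. f b + t b) = (\<Pi>\<^sub>M b\<in>B. (lborel :: real measure))"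
proof (rule product_sigma_finite.PiM_eqI[OF product_sigma_finite_lborel assms])
  fix A :: "'a \<Rightarrow> real set" assume A: "\<And>b. b \<in> B \<Longrightarrow> A b \<in> sets lborel"
  have meas: "(\<lambda>f. \<lambda>b\<in>B. f b + t b) \<in> (\<Pi>\<^sub>M b\<in>B. lborel) \<rightarrow>\<^sub>M (\<Pi>\<^sub>M b\<in>B. (lborel :: real measure))"
    by measurable
  have shift: "emeasure lborel ((\<lambda>x. x + t b) -` A b) = emeasure lborel (A b)" if "b \<in> B" for b
  proof -
    have "emeasure lborel (A b) = emeasure (distr lborel borel ((+) (t b))) (A b)"
      by (simp add: lborel_distr_plus)
    also have "\<dots> = emeasure lborel ((+) (t b) -` A b)"
      using A[OF that] by (subst emeasure_distr) auto
    finally show ?thesis by (simp add: add.commute[of "t b"] vimage_def)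
  qed
  have "emeasure (distr (\<Pi>\<^sub>M b\<in>B. lborel) (\<Pi>\<^sub>M b\<in>B. lborel) (\<lambda>f. \<lambda>b\<in>B. f b + t b)) (Pi\<^sub>E B A)
     = emeasure (\<Pi>\<^sub>M b\<in>B. lborel) ((\<lambda>f. \<lambda>b\<in>B. f b + t b) -` Pi\<^sub>E B A \<inter> space (\<Pi>\<^sub>M b\<in>B. (lborel :: real measure)))"
    using A assms by (intro emeasure_distr meas sets_PiM_I_finite)
  also have "(\<lambda>f. \<lambda>b\<in>B. f b + t b) -` Pi\<^sub>E B A \<inter> space (\<Pi>\<^sub>M b\<in>B. (lborel :: real measure))
     = (\<Pi>\<^sub>E b\<in>B. (\<lambda>x. x + t b) -` A b)"
    by (auto simp: space_PiM PiE_iff)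
  also have "emeasure (\<Pi>\<^sub>M b\<in>B. lborel) \<dots> = (\<Prod>b\<in>B. emeasure lborel ((\<lambda>x. x + t b) -` A b))"
  proof (rule product_sigma_finite.emeasure_PiM[OF product_sigma_finite_lborel assms])
    fix b assume "b \<in> B"
    then have "(\<lambda>x. x + t b) -` A b \<inter> space borel \<in> sets borel"
      using A[of b] by (intro measurable_sets[of _ borel borel]) auto
    then show "(\<lambda>x. x + t b) -` A b \<in> sets lborel" by simp
  qed
  also have "\<dots> = (\<Prod>b\<in>B. emeasure lborel (A b))"
    using shift by (intro prod.cong) auto
  finally show "emeasure (distr (\<Pi>\<^sub>M b\<in>B. lborel) (\<Pi>\<^sub>M b\<in>B. lborel) (\<lambda>f. \<lambda>b\<in>B. f b + t b)) (Pi\<^sub>E B A)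
     = (\<Prod>b\<in>B. emeasure lborel (A b))" .
qed simp

lemma sum_scaleR_measurable [measurable]:
  "(\<lambda>f. \<Sum>b\<in>B. f b *\<^sub>R b) \<in> (\<Pi>\<^sub>M b\<in>B. lborel) \<rightarrow>\<^sub>M (borel :: 'a::euclidean_space measure)"
  by (intro borel_measurable_sum borel_measurable_scaleR) auto

lemma nn_integral_PiM_translate:
  fixes B :: "'a::euclidean_space set"
  assumes "finite B" and h: "h \<in> borel_measurable borel"
  shows "(\<integral>\<^sup>+f. h (\<Sum>b\<in>B. (f b + t b) *\<^sub>R b) \<partial>(\<Pi>\<^sub>M b\<in>B. lborel)) = (\<integral>\<^sup>+f. h (\<Sum>b\<in>B. f b *\<^sub>R b) \<partial>(\<Pi>\<^sub>M b\<in>B. lborel))"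
proof -
  have "(\<integral>\<^sup>+f. h (\<Sum>b\<in>B. f b *\<^sub>R b) \<partial>(\<Pi>\<^sub>M b\<in>B. lborel))
     = (\<integral>\<^sup>+f. h (\<Sum>b\<in>B. f b *\<^sub>R b) \<partial>distr (\<Pi>\<^sub>M b\<in>B. lborel) (\<Pi>\<^sub>M b\<in>B. lborel) (\<lambda>f. \<lambda>b\<in>B. f b + t b))"
    by (simp add: distr_PiM_lborel_translate assms)
  also have "\<dots> = (\<integral>\<^sup>+f. h (\<Sum>b\<in>B. (\<lambda>b\<in>B. f b + t b) b *\<^sub>R b) \<partial>(\<Pi>\<^sub>M b\<in>B. lborel))"
    using h by (subst nn_integral_distr) (measurable, auto)
  also have "\<dots> = (\<integral>\<^sup>+f. h (\<Sum>b\<in>B. (f b + t b) *\<^sub>R b) \<partial>(\<Pi>\<^sub>M b\<in>B. lborel))"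
    by (intro nn_integral_cong arg_cong[where f=h] sum.cong) auto
  finally show ?thesis ..
qed

lemma nn_integral_lborel_shift:
  fixes c :: "'a::euclidean_space"
  assumes [measurable]: "h \<in> borel_measurable borel"
  shows "(\<integral>\<^sup>+y. h (c + y) \<partial>lborel) = (\<integral>\<^sup>+y. h y \<partial>lborel)"
  by (subst (2) lborel_distr_plus[of c, symmetric]) (simp add: nn_integral_distr)

lemma nn_integral_lborel_reflect:
  fixes c :: "'a::euclidean_space"
  assumes [measurable]: "h \<in> borel_measurable borel"
  shows "(\<integral>\<^sup>+y. h (c - y) \<partial>lborel) = (\<integral>\<^sup>+y. h y \<partial>lborel)"
  by (subst (2) lborel_affine[of "-1" c]) (simp_all add: nn_integral_density nn_integral_distr)

text \<open>Fubini for the image measure and \<open>lborel\<close> yields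
  \<open>\<mu> A * \<lambda> E = \<lambda> A * \<mu> E\<close>, with \<open>E\<close> the unit ball
  as normalisation. Hypotheses are put on \<open>N\<close> and \<open>T\<close>, since
  sigma-finiteness is at hand for a product measure \<open>N\<close> but not beforehand for its
  image.\<close>

lemma translation_invariant_eq_lborel:
  fixes T :: "'b \<Rightarrow> 'a::euclidean_space"
  assumes N: "sigma_finite_measure N" and T [measurable]: "T \<in> N \<rightarrow>\<^sub>M borel"
    and inv: "\<And>c h. h \<in> borel_measurable borel \<Longrightarrow> (\<integral>\<^sup>+x. h (T x + c) \<partial>N) = (\<integral>\<^sup>+x. h (T x) \<partial>N)"
    and ball: "emeasure (distr N borel T) (cball 0 1) = emeasure lborel (cball 0 (1::real) :: 'a set)"
  shows "distr N borel T = lborel"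
proof (rule measure_eqI)
  interpret N: sigma_finite_measure N by fact
  interpret P: pair_sigma_finite N "lborel :: 'a measure" ..
  fix A assume "A \<in> sets (distr N borel T)"
  then have A [measurable]: "A \<in> sets borel" by simp
  define E :: "'a set" where "E = cball 0 1"
  have [measurable]: "E \<in> sets borel" by (simp add: E_def)
  have \<mu>: "(\<integral>\<^sup>+x. indicator C (T x) \<partial>N) = emeasure (distr N borel T) C" if [measurable]: "C \<in> sets borel" for C
    by (subst nn_integral_distr[symmetric, of T N borel "indicator C"]) auto
  have "emeasure (distr N borel T) A * emeasure lborel E
      = (\<integral>\<^sup>+x. \<integral>\<^sup>+y. indicator A (T x) * indicator E y \<partial>lborel \<partial>N)"
    by (simp add: nn_integral_cmult nn_integral_multc \<mu>)
  also have "\<dots> = (\<integral>\<^sup>+x. \<integral>\<^sup>+y. indicator A (T x) * indicator E (T x + y) \<partial>lborel \<partial>N)"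
  proof (rule nn_integral_cong)
    fix x
    show "(\<integral>\<^sup>+y. indicator A (T x) * indicator E y \<partial>lborel) = (\<integral>\<^sup>+y. indicator A (T x) * indicator E (T x + y) \<partial>lborel)"
      using nn_integral_lborel_shift[of "\<lambda>z. indicator A (T x) * indicator E z" "T x"] by simp
  qed
  also have "\<dots> = (\<integral>\<^sup>+y. \<integral>\<^sup>+x. indicator A (T x) * indicator E (T x + y) \<partial>N \<partial>lborel)"
    by (rule P.Fubini'[symmetric]) measurable
  also have "\<dots> = (\<integral>\<^sup>+y. \<integral>\<^sup>+x. indicator A (T x - y) * indicator E (T x) \<partial>N \<partial>lborel)"
  proof (rule nn_integral_cong)
    fix y :: 'a
    show "(\<integral>\<^sup>+x. indicator A (T x) * indicator E (T x + y) \<partial>N) = (\<integral>\<^sup>+x. indicator A (T x - y) * indicator E (T x) \<partial>N)"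
      using inv[of "\<lambda>z. indicator A (z - y) * indicator E z" y] by simp
  qed
  also have "\<dots> = (\<integral>\<^sup>+x. \<integral>\<^sup>+y. indicator A (T x - y) * indicator E (T x) \<partial>lborel \<partial>N)"
    by (rule P.Fubini') measurable
  also have "\<dots> = (\<integral>\<^sup>+x. emeasure lborel A * indicator E (T x) \<partial>N)"
    by (intro nn_integral_cong) (simp add: nn_integral_multc nn_integral_lborel_reflect)
  also have "\<dots> = emeasure lborel A * emeasure (distr N borel T) E"
    by (simp add: nn_integral_cmult \<mu>)
  also have "\<dots> = emeasure lborel A * emeasure lborel E" by (simp add: E_def ball)
  finally have eq: "emeasure lborel E * emeasure (distr N borel T) A = emeasure lborel E * emeasure lborel A"
    by (simp add: mult.commute)
  have "emeasure lborel E \<noteq> 0" "emeasure lborel E \<noteq> \<infinity>"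
    by (auto simp: E_def emeasure_cball ennreal_eq_0_iff not_le)
  with eq show "emeasure (distr N borel T) A = emeasure lborel A"
    by (simp add: ennreal_mult_cancel_left)
qed simp

lemma orthonormal_basis_of_finite:
  fixes B :: "'a::euclidean_space set"
  assumes "orthonormal_basis_of L B" shows "independent B" "finite B"
proof -
  have "0 \<notin> B" using assms by (auto simp: orthonormal_basis_of_def)
  then show "independent B"
    using assms unfolding orthonormal_basis_of_def by (intro pairwise_orthogonal_independent) auto
  then show "finite B" by (rule independent_imp_finite)
qed

lemma orthonormal_basis_of_expand:
  fixes B :: "'a::euclidean_space set"
  assumes "orthonormal_basis_of L B" "x \<in> L" shows "(\<Sum>b\<in>B. (x \<bullet> b) *\<^sub>R b) = x"
  using assms orthonormal_basis_of_finite[OF assms(1)]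
  by (intro orthonormal_basis_expand) (auto simp: orthonormal_basis_of_def)

text \<open>A translation by \<open>c\<close> shifts the coordinates by
  \<open>c \<bullet> b\<close>, and the norm is the root of the sum of their squares, so the unit
  ball has the standard volume in any orthonormal coordinates.\<close>

lemma distr_orthonormal_basis:
  fixes B :: "'a::euclidean_space set"
  assumes B: "orthonormal_basis_of UNIV B"
  shows "distr (\<Pi>\<^sub>M b\<in>B. lborel) borel (\<lambda>f. \<Sum>b\<in>B. f b *\<^sub>R b) = lborel"
proof (rule translation_invariant_eq_lborel)
  note fin = orthonormal_basis_of_finite[OF B]
  show "sigma_finite_measure (\<Pi>\<^sub>M b\<in>B. (lborel :: real measure))"
    by (rule product_sigma_finite.sigma_finite[OF product_sigma_finite_lborel fin(2)])
  show "(\<integral>\<^sup>+f. h ((\<Sum>b\<in>B. f b *\<^sub>R b) + c) \<partial>(\<Pi>\<^sub>M b\<in>B. lborel)) = (\<integral>\<^sup>+f. h (\<Sum>b\<in>B. f b *\<^sub>R b) \<partial>(\<Pi>\<^sub>M b\<in>B. lborel))"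
    if "h \<in> borel_measurable borel" for h c
  proof -
    have "(\<Sum>b\<in>B. f b *\<^sub>R b) + c = (\<Sum>b\<in>B. (f b + c \<bullet> b) *\<^sub>R b)" for f
      using orthonormal_basis_of_expand[OF B, of c] by (simp add: scaleR_add_left sum.distrib)
    then show ?thesis
      using nn_integral_PiM_translate[OF fin(2) that, of "\<lambda>b. c \<bullet> b"] by simp
  qed
  have card: "card B = DIM('a)"
    using B fin by (metis dim_UNIV orthonormal_basis_of_def dim_span_eq_card_independent)
  have nrm: "norm (\<Sum>b\<in>B. f b *\<^sub>R b) = sqrt (\<Sum>b\<in>B. (f b)\<^sup>2)" for f
  proof -
    have "(norm (\<Sum>b\<in>B. f b *\<^sub>R b))\<^sup>2 = (\<Sum>b\<in>B. (norm (f b *\<^sub>R b))\<^sup>2)"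
      using B fin(2) by (intro norm_sum_Pythagorean)
        (auto simp: orthonormal_basis_of_def pairwise_def orthogonal_def)
    also have "\<dots> = (\<Sum>b\<in>B. (f b)\<^sup>2)"
      using B by (intro sum.cong) (auto simp: orthonormal_basis_of_def power_mult_distrib)
    finally show ?thesis by (metis norm_ge_zero real_sqrt_unique)
  qed
  have "emeasure (distr (\<Pi>\<^sub>M b\<in>B. lborel) borel (\<lambda>f. \<Sum>b\<in>B. f b *\<^sub>R b)) (cball 0 1)
      = emeasure (\<Pi>\<^sub>M b\<in>B. lborel) ({f. sqrt (\<Sum>b\<in>B. (f b)\<^sup>2) \<le> 1} \<inter> space (\<Pi>\<^sub>M b\<in>B. (lborel :: real measure)))"
    by (subst emeasure_distr) (auto simp: nrm intro!: arg_cong2[where f=emeasure])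
  also have "\<dots> = emeasure lborel (cball 0 1 :: 'a set)"
    using emeasure_cball_aux[OF fin(2), of 1] by (simp add: emeasure_cball card)
  finally show "emeasure (distr (\<Pi>\<^sub>M b\<in>B. lborel) borel (\<lambda>f. \<Sum>b\<in>B. f b *\<^sub>R b)) (cball 0 1)
      = emeasure lborel (cball 0 1 :: 'a set)" .
qed simp

section \<open>Section volumes\<close>

definition unit_cube :: "'a::euclidean_space set" where
  "unit_cube = {y. \<forall>b\<in>Basis. \<bar>y \<bullet> b\<bar> \<le> 1/2}"

lemma closed_unit_cube: "closed (unit_cube :: 'a::euclidean_space set)"
proof -
  have "unit_cube = (\<Inter>b\<in>Basis. {y :: 'a. \<bar>y \<bullet> b\<bar> \<le> 1/2})" by (auto simp: unit_cube_def)
  also have "closed \<dots>" by (intro closed_INT ballI closed_Collect_le continuous_intros)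
  finally show ?thesis .
qed

lemma unit_cube_borel [measurable]: "unit_cube \<in> sets borel"
  using closed_unit_cube by (rule borel_closed)

lemma orthonormal_basis_insert:
  fixes v :: "'a::euclidean_space"
  assumes "norm v = 1" and B: "orthonormal_basis_of {x. v \<bullet> x = 0} B"
  shows "v \<notin> B" "orthonormal_basis_of UNIV (insert v B)"
proof -
  have perp: "v \<bullet> b = 0" if "b \<in> B" for b
    using B that by (auto simp: orthonormal_basis_of_def intro: span_base)
  have vv: "v \<bullet> v = 1" using assms(1) by (simp add: norm_eq_1)
  with perp show "v \<notin> B" by force
  have "x \<in> span (insert v B)" for x
  proof -
    have "x - (v \<bullet> x) *\<^sub>R v \<in> span B"
      using B vv by (simp add: orthonormal_basis_of_def inner_diff_right)
    then show ?thesis by (auto simp: span_breakdown_eq)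
  qed
  then show "orthonormal_basis_of UNIV (insert v B)"
    using B assms(1) perp
    by (auto simp: orthonormal_basis_of_def pairwise_insert orthogonal_def inner_commute)
qed

text \<open>The union of the sections \<open>unit_cube \<inter> {x. v \<bullet> x = 0}\<close>, translated along \<open>e\<close> from the
  hyperplane \<open>v \<bullet> x = 0\<close> to \<open>v \<bullet> x = 1\<close>: its volume is computed both in an orthonormal basis
  containing \<open>v\<close> and in the standard basis.\<close>

definition sheared_slab :: "'a::euclidean_space \<Rightarrow> 'a \<Rightarrow> 'a set" where
  "sheared_slab v e = {y. 0 \<le> v \<bullet> y \<and> v \<bullet> y \<le> 1 \<and> y - ((v \<bullet> y) / (v \<bullet> e)) *\<^sub>R e \<in> unit_cube}"

lemma sheared_slab_borel: "sheared_slab v e \<in> sets borel"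
proof -
  have "(\<lambda>y. y - ((v \<bullet> y) / (v \<bullet> e)) *\<^sub>R e) \<in> borel \<rightarrow>\<^sub>M borel" by measurable
  from measurable_sets[OF this unit_cube_borel]
  have [measurable]: "{y. y - ((v \<bullet> y) / (v \<bullet> e)) *\<^sub>R e \<in> unit_cube} \<in> sets borel" by (simp add: vimage_def)
  have "sheared_slab v e = {y. 0 \<le> v \<bullet> y} \<inter> {y. v \<bullet> y \<le> 1} \<inter> {y. y - ((v \<bullet> y) / (v \<bullet> e)) *\<^sub>R e \<in> unit_cube}"
    by (auto simp: sheared_slab_def)
  also have "\<dots> \<in> sets borel" by measurable
  finally show ?thesis .
qed

text \<open>Fubini along \<open>v\<close>: the slice at height \<open>s\<close> is a translate of
  the central section, so its measure \<open>c\<close> does not depend on \<open>s\<close>, and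
  \<open>s\<close> runs over an interval of length 1.\<close>

lemma emeasure_central_section:
  fixes v :: "'a::euclidean_space"
  assumes v: "norm v = 1" and B: "orthonormal_basis_of {x. v \<bullet> x = 0} B"
    and e: "v \<bullet> e > 0"
  shows "emeasure lborel (sheared_slab v e)
    = emeasure (distr (\<Pi>\<^sub>M b\<in>B. lborel) borel (\<lambda>f. \<Sum>b\<in>B. f b *\<^sub>R b)) (unit_cube \<inter> {x. v \<bullet> x = 0})"
proof -
  note fin = orthonormal_basis_of_finite(2)[OF B]
  note vB = orthonormal_basis_insert[OF v B]
  have vv: "v \<bullet> v = 1" using v by (simp add: norm_eq_1)
  have perp: "v \<bullet> b = 0" if "b \<in> B" for b
    using B that by (auto simp: orthonormal_basis_of_def intro: span_base)
  have perp_sum: "v \<bullet> (\<Sum>b\<in>B. f b *\<^sub>R b) = 0" for f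
    by (simp add: inner_sum_right perp)
  define S where "S = sheared_slab v e"
  have S [measurable]: "S \<in> sets borel" by (simp add: S_def sheared_slab_borel)
  define c where "c = (\<integral>\<^sup>+f. indicator unit_cube (\<Sum>b\<in>B. f b *\<^sub>R b) \<partial>(\<Pi>\<^sub>M b\<in>B. lborel))"
  \<comment> \<open>The hyperplane component of \<open>e\<close>, after \<open>e\<close> is rescaled
    to height 1 over the hyperplane.\<close>
  define u where "u = (1 / (v \<bullet> e)) *\<^sub>R e - v"
  have u: "(\<Sum>b\<in>B. (u \<bullet> b) *\<^sub>R b) = u"
    using e vv by (intro orthonormal_basis_of_expand[OF B]) (simp add: u_def inner_diff_right)
  have inner: "indicator S (\<Sum>b\<in>insert v B. (f(v := s)) b *\<^sub>R b)
      = (indicator {0..1} s * indicator unit_cube (\<Sum>b\<in>B. (f b + (- s) * (u \<bullet> b)) *\<^sub>R b) :: ennreal)" for f s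
  proof -
    have y: "(\<Sum>b\<in>insert v B. (f(v := s)) b *\<^sub>R b) = s *\<^sub>R v + (\<Sum>b\<in>B. f b *\<^sub>R b)"
      using fin vB(1) by (auto intro!: sum.cong)
    have vy: "v \<bullet> (s *\<^sub>R v + (\<Sum>b\<in>B. f b *\<^sub>R b)) = s" by (simp add: inner_add_right vv perp_sum)
    have "(\<Sum>b\<in>B. (f b + (- s) * (u \<bullet> b)) *\<^sub>R b) = (\<Sum>b\<in>B. f b *\<^sub>R b) - s *\<^sub>R (\<Sum>b\<in>B. (u \<bullet> b) *\<^sub>R b)"
      by (simp add: scaleR_add_left scaleR_diff_left sum_subtractf scaleR_sum_right)
    then have sh: "s *\<^sub>R v + (\<Sum>b\<in>B. f b *\<^sub>R b) - (s / (v \<bullet> e)) *\<^sub>R e = (\<Sum>b\<in>B. (f b + (- s) * (u \<bullet> b)) *\<^sub>R b)"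
      unfolding u by (simp add: u_def scaleR_diff_right)
    show ?thesis
      unfolding y S_def sheared_slab_def indicator_def mem_Collect_eq vy sh by simp
  qed
  interpret product_sigma_finite "\<lambda>_. lborel :: real measure" by (rule product_sigma_finite_lborel)
  have "emeasure lborel S = (\<integral>\<^sup>+y. indicator S y \<partial>distr (\<Pi>\<^sub>M b\<in>insert v B. lborel) borel (\<lambda>f. \<Sum>b\<in>insert v B. f b *\<^sub>R b))"
    by (simp add: distr_orthonormal_basis[OF vB(2)])
  also have "\<dots> = (\<integral>\<^sup>+f. indicator S (\<Sum>b\<in>insert v B. f b *\<^sub>R b) \<partial>(\<Pi>\<^sub>M b\<in>insert v B. lborel))"
    by (rule nn_integral_distr) measurable
  also have "\<dots> = (\<integral>\<^sup>+s. \<integral>\<^sup>+f. indicator S (\<Sum>b\<in>insert v B. (f(v := s)) b *\<^sub>R b) \<partial>(\<Pi>\<^sub>M b\<in>B. lborel) \<partial>lborel)"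
    using fin vB(1) by (intro product_nn_integral_insert_rev) (auto intro!: measurable_compose[OF sum_scaleR_measurable])
  also have "\<dots> = (\<integral>\<^sup>+s. indicator {0..1::real} s * c \<partial>lborel)"
  proof (rule nn_integral_cong)
    fix s :: real
    have "(\<integral>\<^sup>+f. indicator S (\<Sum>b\<in>insert v B. (f(v := s)) b *\<^sub>R b) \<partial>(\<Pi>\<^sub>M b\<in>B. lborel))
      = (\<integral>\<^sup>+f. indicator {0..1} s * indicator unit_cube (\<Sum>b\<in>B. (f b + (- s) * (u \<bullet> b)) *\<^sub>R b) \<partial>(\<Pi>\<^sub>M b\<in>B. lborel))"
      by (simp only: inner)
    also have "\<dots> = indicator {0..1} s * (\<integral>\<^sup>+f. indicator unit_cube (\<Sum>b\<in>B. (f b + (- s) * (u \<bullet> b)) *\<^sub>R b) \<partial>(\<Pi>\<^sub>M b\<in>B. lborel))"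
      by (cases "s \<in> {0..1}") auto
    also have "\<dots> = indicator {0..1} s * c"
      using nn_integral_PiM_translate[OF fin, of "indicator unit_cube" "\<lambda>b. (- s) * (u \<bullet> b)"] by (simp add: c_def)
    finally show "(\<integral>\<^sup>+f. indicator S (\<Sum>b\<in>insert v B. (f(v := s)) b *\<^sub>R b) \<partial>(\<Pi>\<^sub>M b\<in>B. lborel)) = indicator {0..1} s * c" .
  qed
  also have "\<dots> = c" by (simp add: nn_integral_multc)
  also have "c = (\<integral>\<^sup>+f. indicator (unit_cube \<inter> {x. v \<bullet> x = 0}) (\<Sum>b\<in>B. f b *\<^sub>R b) \<partial>(\<Pi>\<^sub>M b\<in>B. lborel))"
    unfolding c_def by (intro nn_integral_cong) (simp add: indicator_def perp_sum)
  also have "\<dots> = emeasure (distr (\<Pi>\<^sub>M b\<in>B. lborel) borel (\<lambda>f. \<Sum>b\<in>B. f b *\<^sub>R b)) (unit_cube \<inter> {x. v \<bullet> x = 0})"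
  proof -
    have [measurable]: "unit_cube \<inter> {x. v \<bullet> x = 0} \<in> sets borel"
      by (intro borel_closed closed_Int closed_unit_cube closed_Collect_eq continuous_intros)
    have "(\<integral>\<^sup>+f. indicator (unit_cube \<inter> {x. v \<bullet> x = 0}) (\<Sum>b\<in>B. f b *\<^sub>R b) \<partial>(\<Pi>\<^sub>M b\<in>B. lborel))
      = (\<integral>\<^sup>+y. indicator (unit_cube \<inter> {x. v \<bullet> x = 0}) y \<partial>distr (\<Pi>\<^sub>M b\<in>B. lborel) borel (\<lambda>f. \<Sum>b\<in>B. f b *\<^sub>R b))"
      by (rule nn_integral_distr[symmetric]) measurable
    then show ?thesis by simp
  qed
  finally show ?thesis by (simp add: S_def)
qed

text \<open>Fubini along \<open>e\<close>: moving \<open>y\<close> in direction \<open>e\<close>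
  does not alter the sheared point, so a line parallel to \<open>e\<close> meets the slab in nothing
  or in a segment of length \<open>1 / (v \<bullet> e)\<close>. The last condition on
  \<open>f\<close> bounds the \<open>e\<close>-coordinate of the sheared point.\<close>

lemma emeasure_sheared_slab:
  fixes v e :: "'a::euclidean_space"
  assumes e: "e \<in> Basis" "v \<bullet> e > 0"
  defines "J \<equiv> Basis - {e}"
  shows "emeasure lborel (sheared_slab v e)
    = ennreal (1 / (v \<bullet> e)) * emeasure (\<Pi>\<^sub>M b\<in>J. lborel)
        {f \<in> space (\<Pi>\<^sub>M b\<in>J. lborel). (\<forall>b\<in>J. \<bar>f b\<bar> \<le> 1/2) \<and> \<bar>\<Sum>b\<in>J. f b * (v \<bullet> b)\<bar> \<le> (v \<bullet> e) / 2}"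
proof -
  have J: "finite J" "e \<notin> J" "insert e J = Basis" "J \<subseteq> Basis" using e by (auto simp: J_def)
  define S where "S = sheared_slab v e"
  have S [measurable]: "S \<in> sets borel" by (simp add: S_def sheared_slab_borel)
  define P where "P = (\<Pi>\<^sub>M b\<in>J. (lborel :: real measure))"
  define W where "W = {f \<in> space P. (\<forall>b\<in>J. \<bar>f b\<bar> \<le> 1/2) \<and> \<bar>\<Sum>b\<in>J. f b * (v \<bullet> b)\<bar> \<le> (v \<bullet> e) / 2}"
  have W [measurable]: "W \<in> sets P" unfolding W_def P_def using J(1) by measurable
  define s where "s f = (\<Sum>b\<in>J. f b * (v \<bullet> b))" for f
  have inner: "indicator S (\<Sum>b\<in>insert e J. (f(e := t)) b *\<^sub>R b)
      = (indicator W f * indicator {- s f / (v \<bullet> e) .. (1 - s f) / (v \<bullet> e)} t :: ennreal)" if f: "f \<in> space P" for f t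
  proof -
    define y where "y = (\<Sum>b\<in>insert e J. (f(e := t)) b *\<^sub>R b)"
    have yb: "y \<bullet> b = (f(e := t)) b" if "b \<in> Basis" for b
      unfolding y_def J(3) by (rule inner_sum_left_Basis[OF that])
    have vy: "v \<bullet> y = t * (v \<bullet> e) + s f"
    proof -
      have "v \<bullet> y = (\<Sum>b\<in>insert e J. (f(e := t)) b * (v \<bullet> b))" by (simp add: y_def inner_sum_right)
      also have "\<dots> = t * (v \<bullet> e) + s f" using J(1,2) by (auto simp: s_def intro!: sum.cong)
      finally show ?thesis .
    qed
    have cube: "y - ((v \<bullet> y) / (v \<bullet> e)) *\<^sub>R e \<in> unit_cube \<longleftrightarrow> (\<forall>b\<in>J. \<bar>f b\<bar> \<le> 1/2) \<and> \<bar>s f\<bar> \<le> (v \<bullet> e) / 2"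
    proof -
      have "(y - ((v \<bullet> y) / (v \<bullet> e)) *\<^sub>R e) \<bullet> b = f b" if "b \<in> J" for b
        using that J e yb[of b] by (auto simp: inner_diff_left inner_Basis)
      moreover have "(y - ((v \<bullet> y) / (v \<bullet> e)) *\<^sub>R e) \<bullet> e = - s f / (v \<bullet> e)"
        using e yb[of e] by (simp add: inner_diff_left vy field_simps)
      moreover have "\<bar>- s f / (v \<bullet> e)\<bar> \<le> 1/2 \<longleftrightarrow> \<bar>s f\<bar> \<le> (v \<bullet> e) / 2"
        using e by (simp add: abs_divide field_simps)
      ultimately show ?thesis unfolding unit_cube_def J(3)[symmetric] by auto
    qed
    have "0 \<le> v \<bullet> y \<and> v \<bullet> y \<le> 1 \<longleftrightarrow> t \<in> {- s f / (v \<bullet> e) .. (1 - s f) / (v \<bullet> e)}"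
      using e(2) unfolding vy by (auto simp: field_simps)
    with cube f show ?thesis
      unfolding y_def[symmetric] by (auto simp: S_def sheared_slab_def W_def s_def[symmetric] indicator_def)
  qed
  interpret product_sigma_finite "\<lambda>_. lborel :: real measure" by (rule product_sigma_finite_lborel)
  have "emeasure lborel S = (\<integral>\<^sup>+y. indicator S y \<partial>distr (\<Pi>\<^sub>M b\<in>Basis. lborel) borel (\<lambda>f. \<Sum>b\<in>Basis. f b *\<^sub>R b))"
    by (simp add: lborel_eq[symmetric])
  also have "\<dots> = (\<integral>\<^sup>+f. indicator S (\<Sum>b\<in>insert e J. f b *\<^sub>R b) \<partial>(\<Pi>\<^sub>M b\<in>insert e J. lborel))"
    unfolding J(3) by (rule nn_integral_distr) measurable
  also have "\<dots> = (\<integral>\<^sup>+f. \<integral>\<^sup>+t. indicator S (\<Sum>b\<in>insert e J. (f(e := t)) b *\<^sub>R b) \<partial>lborel \<partial>P)"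
    unfolding P_def using J(1,2) by (intro product_nn_integral_insert) (auto intro!: measurable_compose[OF sum_scaleR_measurable])
  also have "\<dots> = (\<integral>\<^sup>+f. indicator W f * ennreal (1 / (v \<bullet> e)) \<partial>P)"
  proof (rule nn_integral_cong)
    fix f assume f: "f \<in> space P"
    have "(\<integral>\<^sup>+t. indicator S (\<Sum>b\<in>insert e J. (f(e := t)) b *\<^sub>R b) \<partial>lborel)
      = (\<integral>\<^sup>+t. indicator W f * indicator {- s f / (v \<bullet> e) .. (1 - s f) / (v \<bullet> e)} t \<partial>lborel)"
      by (simp only: inner[OF f])
    also have "\<dots> = indicator W f * ennreal (1 / (v \<bullet> e))"
      using e(2) by (simp add: nn_integral_cmult divide_right_mono diff_divide_distrib)
    finally show "(\<integral>\<^sup>+t. indicator S (\<Sum>b\<in>insert e J. (f(e := t)) b *\<^sub>R b) \<partial>lborel) = indicator W f * ennreal (1 / (v \<bullet> e))" .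
  qed
  also have "\<dots> = ennreal (1 / (v \<bullet> e)) * emeasure P W"
    by (simp add: nn_integral_multc mult.commute)
  finally show ?thesis by (simp add: S_def W_def P_def)
qed

lemma measure_central_section:
  fixes v e :: "'a::euclidean_space"
  assumes "norm v = 1" "e \<in> Basis" "v \<bullet> e > 0"
  defines "J \<equiv> Basis - {e}"
  shows "measure (subspace_lborel {x. v \<bullet> x = 0}) (unit_cube \<inter> {x. v \<bullet> x = 0})
    = measure (\<Pi>\<^sub>M b\<in>J. lborel)
        {f \<in> space (\<Pi>\<^sub>M b\<in>J. lborel). (\<forall>b\<in>J. \<bar>f b\<bar> \<le> 1/2) \<and> \<bar>\<Sum>b\<in>J. f b * (v \<bullet> b)\<bar> \<le> (v \<bullet> e) / 2} / (v \<bullet> e)"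
proof -
  define B where "B = (SOME B. orthonormal_basis_of {x. v \<bullet> x = 0} B)"
  have B: "orthonormal_basis_of {x. v \<bullet> x = 0} B"
    unfolding B_def by (rule someI_ex) (intro orthonormal_basis_of_exists subspace_hyperplane)
  define W where "W = {f \<in> space (\<Pi>\<^sub>M b\<in>J. lborel). (\<forall>b\<in>J. \<bar>f b\<bar> \<le> 1/2) \<and> \<bar>\<Sum>b\<in>J. f b * (v \<bullet> b)\<bar> \<le> (v \<bullet> e) / 2}"
  have "emeasure (subspace_lborel {x. v \<bullet> x = 0}) (unit_cube \<inter> {x. v \<bullet> x = 0}) = ennreal (1 / (v \<bullet> e)) * emeasure (\<Pi>\<^sub>M b\<in>J. lborel) W"
    unfolding subspace_lborel_def Let_def B_def[symmetric] W_def J_def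
    by (simp only: emeasure_central_section[OF assms(1) B assms(3), symmetric] emeasure_sheared_slab[OF assms(2,3)])
  then show ?thesis
    using assms(3) unfolding W_def[symmetric] measure_def by (simp add: enn2real_mult)
qed

section \<open>Distribution functions of weighted sums of uniform variables\<close>

definition cube_slab :: "'i set \<Rightarrow> ('i \<Rightarrow> real) \<Rightarrow> real \<Rightarrow> ('i \<Rightarrow> real) set" where
  "cube_slab J w x = {f \<in> space (\<Pi>\<^sub>M b\<in>J. (lborel :: real measure)). (\<forall>b\<in>J. \<bar>f b\<bar> \<le> 1/2) \<and> (\<Sum>b\<in>J. f b * w b) \<le> x}"

text \<open>The distribution function of a sum of \<open>w b * U b\<close> with \<open>U b\<close>
  independent and uniform on \<open>[-1/2, 1/2]\<close>: the cube has volume 1.\<close>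

definition cube_cdf :: "'i set \<Rightarrow> ('i \<Rightarrow> real) \<Rightarrow> real \<Rightarrow> real" where
  "cube_cdf J w x = measure (\<Pi>\<^sub>M b\<in>J. lborel) (cube_slab J w x)"

lemma cube_slab_sets [measurable]: "finite J \<Longrightarrow> cube_slab J w x \<in> sets (\<Pi>\<^sub>M b\<in>J. lborel)"
  unfolding cube_slab_def by measurable

lemma emeasure_subset_cube:
  assumes "finite J" "A \<subseteq> {f \<in> space (\<Pi>\<^sub>M b\<in>J. (lborel :: real measure)). \<forall>b\<in>J. \<bar>f b\<bar> \<le> 1/2}"
  shows "emeasure (\<Pi>\<^sub>M b\<in>J. (lborel :: real measure)) A \<le> 1"
proof -
  have "A \<subseteq> (\<Pi>\<^sub>E b\<in>J. {-1/2..1/2::real})"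
  proof
    fix f assume "f \<in> A"
    with assms(2) have "f \<in> space (\<Pi>\<^sub>M b\<in>J. (lborel :: real measure))" "\<forall>b\<in>J. \<bar>f b\<bar> \<le> 1/2" by auto
    then show "f \<in> (\<Pi>\<^sub>E b\<in>J. {-1/2..1/2::real})" by (force simp: space_PiM PiE_iff abs_le_iff)
  qed
  then have "emeasure (\<Pi>\<^sub>M b\<in>J. (lborel :: real measure)) A \<le> emeasure (\<Pi>\<^sub>M b\<in>J. lborel) (\<Pi>\<^sub>E b\<in>J. {-1/2..1/2::real})"
    using assms(1) by (intro emeasure_mono) (auto intro!: sets_PiM_I_finite)
  also have "\<dots> = (\<Prod>b\<in>J. emeasure lborel {-1/2..1/2::real})"
    by (rule product_sigma_finite.emeasure_PiM[OF product_sigma_finite_lborel assms(1)]) simp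
  also have "\<dots> = 1" by simp
  finally show ?thesis .
qed

lemma emeasure_cube_slab:
  assumes "finite J" shows "emeasure (\<Pi>\<^sub>M b\<in>J. lborel) (cube_slab J w x) = ennreal (cube_cdf J w x)"
proof -
  have "emeasure (\<Pi>\<^sub>M b\<in>J. lborel) (cube_slab J w x) \<le> 1"
    by (rule emeasure_subset_cube[OF assms]) (auto simp: cube_slab_def)
  then have "emeasure (\<Pi>\<^sub>M b\<in>J. lborel) (cube_slab J w x) \<noteq> \<infinity>" by (auto simp: top_unique)
  then show ?thesis unfolding cube_cdf_def by (intro emeasure_eq_ennreal_measure) auto
qed

lemma cube_cdf_nonneg: "0 \<le> cube_cdf J w x"
  by (simp add: cube_cdf_def)

lemma cube_cdf_mono:
  assumes "finite J" "x \<le> y" shows "cube_cdf J w x \<le> cube_cdf J w y"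
proof -
  have "emeasure (\<Pi>\<^sub>M b\<in>J. lborel) (cube_slab J w x) \<le> emeasure (\<Pi>\<^sub>M b\<in>J. lborel) (cube_slab J w y)"
    using assms by (intro emeasure_mono cube_slab_sets) (auto simp: cube_slab_def)
  then show ?thesis by (simp add: emeasure_cube_slab assms(1) cube_cdf_nonneg)
qed

text \<open>Conditioning on coordinate \<open>i\<close>; the convolution step behind the inductions
  over coordinates.\<close>

lemma cube_cdf_insert:
  assumes J: "finite J" "i \<notin> J"
  shows "((\<lambda>u. cube_cdf J w (x - w i * u)) has_integral cube_cdf (insert i J) w x) {-1/2..1/2}"
proof -
  interpret product_sigma_finite "\<lambda>_. lborel :: real measure" by (rule product_sigma_finite_lborel)
  define P where "P = (\<Pi>\<^sub>M b\<in>J. (lborel :: real measure))"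
  have [measurable]: "cube_slab (insert i J) w x \<in> sets (\<Pi>\<^sub>M b\<in>insert i J. (lborel :: real measure))"
    using J by (intro cube_slab_sets) simp
  have [measurable]: "cube_cdf J w \<in> borel_measurable borel"
    by (intro borel_measurable_mono monoI cube_cdf_mono J)
  have mem: "indicator (cube_slab (insert i J) w x) (f(i := u)) = (indicator {-1/2..1/2} u * indicator (cube_slab J w (x - w i * u)) f :: ennreal)"
    if f: "f \<in> space P" for f u
  proof -
    have sp: "f(i := u) \<in> space (\<Pi>\<^sub>M b\<in>insert i J. (lborel :: real measure))"
      using f by (auto simp: P_def space_PiM PiE_iff extensional_def)
    have "(\<Sum>b\<in>insert i J. (f(i := u)) b * w b) = w i * u + (\<Sum>b\<in>J. f b * w b)"
      using J by (auto intro!: sum.cong)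
    moreover have "(\<forall>b\<in>insert i J. \<bar>(f(i := u)) b\<bar> \<le> 1/2) \<longleftrightarrow> u \<in> {-1/2..1/2} \<and> (\<forall>b\<in>J. \<bar>f b\<bar> \<le> 1/2)"
      using J by (auto simp: abs_le_iff)
    ultimately show ?thesis
      using f sp unfolding cube_slab_def indicator_def mem_Collect_eq P_def by (auto simp: algebra_simps)
  qed
  have "ennreal (cube_cdf (insert i J) w x) = (\<integral>\<^sup>+f. indicator (cube_slab (insert i J) w x) f \<partial>(\<Pi>\<^sub>M b\<in>insert i J. lborel))"
    using J by (simp add: emeasure_cube_slab[symmetric])
  also have "\<dots> = (\<integral>\<^sup>+u. \<integral>\<^sup>+f. indicator (cube_slab (insert i J) w x) (f(i := u)) \<partial>P \<partial>lborel)"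
    unfolding P_def using J by (intro product_nn_integral_insert_rev) auto
  also have "\<dots> = (\<integral>\<^sup>+u. ennreal (indicator {-1/2..1/2} u * cube_cdf J w (x - w i * u)) \<partial>lborel)"
  proof (rule nn_integral_cong)
    fix u :: real
    have "(\<integral>\<^sup>+f. indicator (cube_slab (insert i J) w x) (f(i := u)) \<partial>P)
      = (\<integral>\<^sup>+f. indicator {-1/2..1/2} u * indicator (cube_slab J w (x - w i * u)) f \<partial>P)"
      by (intro nn_integral_cong mem)
    also have "\<dots> = indicator {-1/2..1/2} u * emeasure P (cube_slab J w (x - w i * u))"
      unfolding P_def using J by (simp add: nn_integral_cmult)
    also have "\<dots> = ennreal (indicator {-1/2..1/2} u * cube_cdf J w (x - w i * u))"
      unfolding P_def emeasure_cube_slab[OF J(1)] by (simp add: indicator_def)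
    finally show "(\<integral>\<^sup>+f. indicator (cube_slab (insert i J) w x) (f(i := u)) \<partial>P)
      = ennreal (indicator {-1/2..1/2} u * cube_cdf J w (x - w i * u))" .
  qed
  finally have "((\<lambda>u. indicator {-1/2..1/2} u * cube_cdf J w (x - w i * u)) has_integral cube_cdf (insert i J) w x) UNIV"
    by (intro nn_integral_has_integral) (auto simp: cube_cdf_nonneg)
  also have "(\<lambda>u. indicator {-1/2..1/2} u * cube_cdf J w (x - w i * u)) = (\<lambda>u. if u \<in> {-1/2..1/2} then cube_cdf J w (x - w i * u) else 0)"
    by (auto simp: indicator_def)
  finally show ?thesis by (simp only: has_integral_restrict_UNIV)
qed

lemma cube_cdf_empty: "cube_cdf {} w x = (if 0 \<le> x then 1 else 0)"
proof -
  have "cube_slab {} w x = (if 0 \<le> x then {\<lambda>_. undefined} else {})"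
    by (auto simp: cube_slab_def space_PiM)
  then show ?thesis by (simp add: cube_cdf_def PiM_empty measure_def)
qed

text \<open>Unlike \<open>max 0 x ^ n\<close>, this is the unit step for \<open>n = 0\<close>.\<close>

definition trunc_power :: "nat \<Rightarrow> real \<Rightarrow> real" where
  "trunc_power n x = (if x \<ge> 0 then x ^ n else 0)"

section \<open>Truncated powers and their iterated differences\<close>

lemma DERIV_trunc_power_nonzero:
  assumes "x \<noteq> 0"
  shows "(trunc_power (Suc n) has_real_derivative real (Suc n) * trunc_power n x) (at x)"
proof (cases "x > 0")
  case True
  have "((\<lambda>x. x ^ Suc n) has_real_derivative real (Suc n) * trunc_power n x) (at x)"
    using True by (auto intro!: derivative_eq_intros simp: trunc_power_def simp del: power_Suc of_nat_Suc)
  then show ?thesis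
    by (rule has_field_derivative_transform_within_open[of _ _ _ "{0<..}"]) (use True in \<open>auto simp: trunc_power_def\<close>)
next
  case False
  have "((\<lambda>x. 0) has_real_derivative real (Suc n) * trunc_power n x) (at x)"
    using False assms by (auto simp: trunc_power_def)
  then show ?thesis
    by (rule has_field_derivative_transform_within_open[of _ _ _ "{..<0}"]) (use False assms in \<open>auto simp: trunc_power_def\<close>)
qed

lemma trunc_power_Suc_eq: "trunc_power (Suc n) = (\<lambda>x. max 0 x ^ Suc n)"
  by (auto simp: trunc_power_def fun_eq_iff max_def)

lemma continuous_trunc_power: "continuous_on S (trunc_power (Suc n))"
  unfolding trunc_power_Suc_eq by (intro continuous_intros)

lemma DERIV_trunc_power:
  "(trunc_power (Suc (Suc n)) has_real_derivative real (Suc (Suc n)) * trunc_power (Suc n) x) (at x)"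
proof (cases "x = 0")
  case True
  have "((\<lambda>h. trunc_power (Suc n) h) \<longlongrightarrow> trunc_power (Suc n) 0) (at 0)"
    using continuous_trunc_power[of UNIV n] by (simp add: continuous_on_eq_continuous_at isCont_def)
  moreover have "\<forall>\<^sub>F h in at 0. trunc_power (Suc n) h = (trunc_power (Suc (Suc n)) (0 + h) - trunc_power (Suc (Suc n)) 0) / h"
    by (auto simp: eventually_at trunc_power_def intro!: exI[of _ 1])
  ultimately have "((\<lambda>h. (trunc_power (Suc (Suc n)) (0 + h) - trunc_power (Suc (Suc n)) 0) / h) \<longlongrightarrow> trunc_power (Suc n) 0) (at 0)"
    by (rule Lim_transform_eventually)
  then show ?thesis using True by (simp add: DERIV_def trunc_power_def)
qed (rule DERIV_trunc_power_nonzero)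

lemma trunc_power_integral:
  assumes "a > 0"
  shows "((\<lambda>u. trunc_power n (c - a * u)) has_integral
     (trunc_power (Suc n) (c + a / 2) - trunc_power (Suc n) (c - a / 2)) / (a * real (Suc n))) {-1/2..1/2}"
proof -
  define A where "A u = - trunc_power (Suc n) (c - a * u) / (a * real (Suc n))" for u
  have "((\<lambda>u. trunc_power n (c - a * u)) has_integral (A (1/2) - A (-1/2))) {-1/2..1/2}"
  \<comment> \<open>The point \<open>c / a\<close> is excepted because for \<open>n = 0\<close> the
    integrand jumps there and \<open>A\<close> has a kink.\<close>
  proof (rule fundamental_theorem_of_calculus_interior_strong[of "{c / a}"])
    show "continuous_on {-1/2..1/2} A" unfolding A_def
      using assms by (intro continuous_intros continuous_on_compose2[OF continuous_trunc_power[of UNIV]]) auto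
    fix u assume "u \<in> {-1/2<..<1/2} - {c / a}"
    then have "c - a * u \<noteq> 0" using assms by (auto simp: field_simps)
    from DERIV_trunc_power_nonzero[OF this, of n]
    have "((\<lambda>u. trunc_power (Suc n) (c - a * u)) has_real_derivative real (Suc n) * trunc_power n (c - a * u) * (- a)) (at u)"
      by (rule DERIV_chain2) (auto intro!: derivative_eq_intros)
    then have "(A has_real_derivative - (real (Suc n) * trunc_power n (c - a * u) * (- a)) / (a * real (Suc n))) (at u)"
      unfolding A_def by (intro DERIV_cdivide DERIV_minus)
    then show "(A has_vector_derivative trunc_power n (c - a * u)) (at u)"
      using assms by (simp add: has_real_derivative_iff_has_vector_derivative)
  qed auto
  then show ?thesis by (simp add: A_def diff_divide_distrib)
qed

text \<open>The iterated central difference of \<open>trunc_power n\<close> with steps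
  \<open>w b\<close>, expanded over the set \<open>S\<close> of coordinates in which the shift is
  negative.\<close>

definition trunc_sum :: "nat \<Rightarrow> 'i set \<Rightarrow> ('i \<Rightarrow> real) \<Rightarrow> real \<Rightarrow> real" where
  "trunc_sum n J w x = (\<Sum>S\<in>Pow J. (-1) ^ card S * trunc_power n (x + (sum w (J - S) - sum w S) / 2))"

lemma trunc_sum_insert:
  assumes "finite J" "i \<notin> J"
  shows "trunc_sum n (insert i J) w x = trunc_sum n J w (x + w i / 2) - trunc_sum n J w (x - w i / 2)"
proof -
  have "trunc_sum n (insert i J) w x
    = (\<Sum>S\<in>Pow J. (-1) ^ card S * trunc_power n (x + (sum w (insert i J - S) - sum w S) / 2))
    + (\<Sum>S\<in>insert i ` Pow J. (-1) ^ card S * trunc_power n (x + (sum w (insert i J - S) - sum w S) / 2))"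
    unfolding trunc_sum_def Pow_insert using assms by (intro sum.union_disjoint) auto
  also have "(\<Sum>S\<in>insert i ` Pow J. (-1) ^ card S * trunc_power n (x + (sum w (insert i J - S) - sum w S) / 2))
    = (\<Sum>S\<in>Pow J. (-1) ^ card (insert i S) * trunc_power n (x + (sum w (insert i J - insert i S) - sum w (insert i S)) / 2))"
    using assms(2) by (subst sum.reindex) (auto simp: inj_on_def)
  also have "\<dots> = - trunc_sum n J w (x - w i / 2)"
    unfolding trunc_sum_def sum_negf[symmetric]
  proof (rule sum.cong)
    fix S assume "S \<in> Pow J"
    then have S: "finite S" "i \<notin> S" "insert i J - insert i S = J - S"
      using assms finite_subset by auto
    have eq: "x + (sum w (J - S) - (w i + sum w S)) / 2 = x - w i / 2 + (sum w (J - S) - sum w S) / 2"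
      by (simp add: field_simps)
    with S show "(-1) ^ card (insert i S) * trunc_power n (x + (sum w (insert i J - insert i S) - sum w (insert i S)) / 2)
      = - ((-1) ^ card S * trunc_power n (x - w i / 2 + (sum w (J - S) - sum w S) / 2))" by (simp add: eq)
  qed simp
  also have "(\<Sum>S\<in>Pow J. (-1) ^ card S * trunc_power n (x + (sum w (insert i J - S) - sum w S) / 2)) = trunc_sum n J w (x + w i / 2)"
    unfolding trunc_sum_def
  proof (rule sum.cong)
    fix S assume "S \<in> Pow J"
    then have S: "insert i J - S = insert i (J - S)" "finite (J - S)" "i \<notin> J - S" using assms by auto
    have eq: "x + (w i + sum w (J - S) - sum w S) / 2 = x + w i / 2 + (sum w (J - S) - sum w S) / 2"
      by (simp add: field_simps)
    with S show "(-1) ^ card S * trunc_power n (x + (sum w (insert i J - S) - sum w S) / 2)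
      = (-1) ^ card S * trunc_power n (x + w i / 2 + (sum w (J - S) - sum w S) / 2)" by (simp add: eq)
  qed simp
  finally show ?thesis by simp
qed

text \<open>Integrating out a coordinate raises the degree by one and takes one central difference.
  Continuity, symmetry and differentiability of the volume are read off from this closed
  form.\<close>

lemma cube_cdf_eq_trunc_sum:
  assumes "finite J" "\<And>b. b \<in> J \<Longrightarrow> w b > 0"
  shows "cube_cdf J w x = trunc_sum (card J) J w x / (fact (card J) * prod w J)"
  using assms
proof (induction J arbitrary: x rule: finite_induct)
  case empty
  then show ?case by (simp add: cube_cdf_empty trunc_sum_def trunc_power_def)
next
  case (insert i J)
  define C where "C = (fact (card J) * prod w J :: real)"
  have "((\<lambda>u. (\<Sum>S\<in>Pow J. (-1) ^ card S * trunc_power (card J) (x + (sum w (J - S) - sum w S) / 2 - w i * u)))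
     has_integral (\<Sum>S\<in>Pow J. (-1) ^ card S * ((trunc_power (Suc (card J)) (x + (sum w (J - S) - sum w S) / 2 + w i / 2)
        - trunc_power (Suc (card J)) (x + (sum w (J - S) - sum w S) / 2 - w i / 2)) / (w i * real (Suc (card J)))))) {-1/2..1/2}"
    using insert by (intro has_integral_sum has_integral_mult_right trunc_power_integral) auto
  also have "(\<Sum>S\<in>Pow J. (-1) ^ card S * ((trunc_power (Suc (card J)) (x + (sum w (J - S) - sum w S) / 2 + w i / 2)
        - trunc_power (Suc (card J)) (x + (sum w (J - S) - sum w S) / 2 - w i / 2)) / (w i * real (Suc (card J)))))
     = trunc_sum (Suc (card J)) (insert i J) w x / (w i * real (Suc (card J)))"
    unfolding trunc_sum_insert[OF insert(1,2)]
    by (simp add: trunc_sum_def sum_subtractf[symmetric] sum_divide_distrib right_diff_distrib diff_divide_distrib algebra_simps)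
  finally have "((\<lambda>u. (\<Sum>S\<in>Pow J. (-1) ^ card S * trunc_power (card J) (x + (sum w (J - S) - sum w S) / 2 - w i * u)) / C)
      has_integral trunc_sum (Suc (card J)) (insert i J) w x / (w i * real (Suc (card J))) / C) {-1/2..1/2}"
    by (rule has_integral_divide)
  moreover have "cube_cdf J w (x - w i * u) = (\<Sum>S\<in>Pow J. (-1) ^ card S * trunc_power (card J) (x + (sum w (J - S) - sum w S) / 2 - w i * u)) / C" for u
    using insert.IH[of "x - w i * u"] insert.prems by (simp add: trunc_sum_def C_def add_diff_eq diff_add_eq)
  ultimately have "((\<lambda>u. cube_cdf J w (x - w i * u)) has_integral trunc_sum (Suc (card J)) (insert i J) w x / (w i * real (Suc (card J))) / C) {-1/2..1/2}"
    by (simp only:)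
  from has_integral_unique[OF cube_cdf_insert[OF insert(1,2)] this]
  show ?case using insert by (simp add: C_def mult_ac)
qed

lemma isCont_cube_cdf:
  assumes "finite J" "J \<noteq> {}" "\<And>b. b \<in> J \<Longrightarrow> w b > 0"
  shows "isCont (cube_cdf J w) x"
proof -
  obtain n where n: "card J = Suc n" using assms(1,2) by (metis card_0_eq not0_implies_Suc)
  have "cube_cdf J w = (\<lambda>x. trunc_sum (Suc n) J w x / (fact (card J) * prod w J))"
    using cube_cdf_eq_trunc_sum[of J w] assms n by (simp add: fun_eq_iff)
  moreover have "continuous_on UNIV (\<lambda>x. trunc_sum (Suc n) J w x / (fact (card J) * prod w J))"
    unfolding trunc_sum_def divide_inverse
    by (intro continuous_intros continuous_on_const continuous_on_compose2[OF continuous_trunc_power[of UNIV]]) auto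
  ultimately show ?thesis by (simp add: continuous_on_eq_continuous_at)
qed

text \<open>The right side leaves out the face where the sum equals \<open>- r\<close>. That face is
  null by continuity of \<open>cube_cdf\<close>, which requires at least one coordinate.\<close>

lemma measure_two_sided_slab:
  assumes J: "finite J" "J \<noteq> {}" and w: "\<And>b. b \<in> J \<Longrightarrow> w b > 0" and "r \<ge> 0"
  shows "measure (\<Pi>\<^sub>M b\<in>J. (lborel :: real measure))
      {f \<in> space (\<Pi>\<^sub>M b\<in>J. (lborel :: real measure)). (\<forall>b\<in>J. \<bar>f b\<bar> \<le> 1/2) \<and> \<bar>\<Sum>b\<in>J. f b * w b\<bar> \<le> r}
    = cube_cdf J w r - cube_cdf J w (- r)"
proof -
  define P where "P = (\<Pi>\<^sub>M b\<in>J. (lborel :: real measure))"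
  define M0 where "M0 = {f \<in> space P. (\<forall>b\<in>J. \<bar>f b\<bar> \<le> 1/2) \<and> (\<Sum>b\<in>J. f b * w b) < - r}"
  have fm: "A \<in> fmeasurable P" if "A \<in> sets P" "A \<subseteq> {f \<in> space P. \<forall>b\<in>J. \<bar>f b\<bar> \<le> 1/2}" for A
    using emeasure_subset_cube[OF J(1) that(2)[unfolded P_def]] that(1)
    by (intro fmeasurableI) (auto simp: P_def top_unique less_top[symmetric])
  have M0_sets: "M0 \<in> sets P" unfolding M0_def P_def using J(1) by measurable
  have M0: "M0 \<in> fmeasurable P" by (rule fm[OF M0_sets]) (auto simp: M0_def)
  have slab: "cube_slab J w x \<in> fmeasurable P" for x
    by (rule fm) (use J in \<open>auto simp: P_def cube_slab_def intro: cube_slab_sets[unfolded cube_slab_def]\<close>)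
  have "measure P M0 \<le> cube_cdf J w (- r)"
    unfolding cube_cdf_def P_def[symmetric]
    by (rule measure_mono_fmeasurable[OF _ M0_sets slab]) (auto simp: M0_def cube_slab_def P_def)
  moreover have "cube_cdf J w (- r) \<le> measure P M0"
  proof (rule LIMSEQ_le_const2)
    have "(\<lambda>n. - r - inverse (real (Suc n))) \<longlonglongrightarrow> - r - 0"
      by (intro tendsto_intros LIMSEQ_inverse_real_of_nat)
    then show "(\<lambda>n. cube_cdf J w (- r - inverse (real (Suc n)))) \<longlonglongrightarrow> cube_cdf J w (- r)"
      by (intro isCont_tendsto_compose[OF isCont_cube_cdf[OF J w]]) auto
    have below: "cube_cdf J w t \<le> measure P M0" if "t < - r" for t
      unfolding cube_cdf_def P_def[symmetric]
      by (rule measure_mono_fmeasurable[OF _ fmeasurableD[OF slab] M0])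
         (use that in \<open>auto simp: M0_def cube_slab_def P_def\<close>)
    have "cube_cdf J w (- r - inverse (real (Suc n))) \<le> measure P M0" for n
      by (rule below) (simp del: of_nat_Suc)
    then show "\<exists>N. \<forall>n\<ge>N. cube_cdf J w (- r - inverse (real (Suc n))) \<le> measure P M0" by blast
  qed
  moreover have "measure P (cube_slab J w r - M0) = cube_cdf J w r - measure P M0"
    unfolding cube_cdf_def P_def[symmetric]
    using \<open>r \<ge> 0\<close> by (intro measure_Diff[OF _ fmeasurableD[OF slab] M0_sets])
      (use fmeasurableD2[OF slab] in \<open>auto simp: M0_def cube_slab_def P_def\<close>)
  moreover have "cube_slab J w r - M0 = {f \<in> space P. (\<forall>b\<in>J. \<bar>f b\<bar> \<le> 1/2) \<and> \<bar>\<Sum>b\<in>J. f b * w b\<bar> \<le> r}"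
    by (auto simp: M0_def cube_slab_def P_def)
  ultimately show ?thesis by (simp add: P_def)
qed

text \<open>The difference across \<open>e\<close> in \<open>section_fun_eq_cdf\<close> extends the
  sum over subsets from \<open>I - {e}\<close> to \<open>I\<close>, so the choice of the projection
  coordinate \<open>e\<close> disappears.\<close>

definition section_fun :: "'i set \<Rightarrow> ('i \<Rightarrow> real) \<Rightarrow> real" where
  "section_fun I w = trunc_sum (card I - 1) I w 0 / (fact (card I - 1) * prod w I)"

lemma section_fun_eq_cdf:
  assumes "finite I" "e \<in> I" "\<And>b. b \<in> I \<Longrightarrow> w b > 0"
  shows "section_fun I w = (cube_cdf (I - {e}) w (w e / 2) - cube_cdf (I - {e}) w (- w e / 2)) / w e"
proof -
  define J where "J = I - {e}"
  have J: "I = insert e J" "finite J" "e \<notin> J" using assms by (auto simp: J_def)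
  have pos: "\<And>b. b \<in> J \<Longrightarrow> w b > 0" using assms J by auto
  have "section_fun I w = (trunc_sum (card J) J w (w e / 2) - trunc_sum (card J) J w (- w e / 2)) / (fact (card J) * (w e * prod w J))"
    using J trunc_sum_insert[OF J(2,3), of "card J" w 0] by (simp add: section_fun_def)
  moreover have "cube_cdf J w x = trunc_sum (card J) J w x / (fact (card J) * prod w J)" for x
    using J(2) pos by (rule cube_cdf_eq_trunc_sum)
  ultimately show ?thesis
    unfolding J_def[symmetric] by (simp add: diff_divide_distrib mult_ac)
qed

lemma section_volume:
  fixes v :: "'a::euclidean_space"
  assumes "norm v = 1" "DIM('a) \<ge> 2" "\<And>b. b \<in> Basis \<Longrightarrow> v \<bullet> b > 0"
  shows "measure (subspace_lborel {x. v \<bullet> x = 0}) (unit_cube \<inter> {x. v \<bullet> x = 0}) = section_fun Basis (\<lambda>b. v \<bullet> b)"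
proof -
  obtain e :: 'a where e: "e \<in> Basis" using nonempty_Basis by blast
  have "card (Basis - {e}) = DIM('a) - 1" using e by simp
  with assms(2) have ne: "Basis - {e} \<noteq> {}" by (metis Suc_1 Suc_le_eq card.empty less_numeral_extra(3) zero_less_diff)
  have "section_fun Basis (\<lambda>b. v \<bullet> b) = (cube_cdf (Basis - {e}) (\<lambda>b. v \<bullet> b) (v \<bullet> e / 2) - cube_cdf (Basis - {e}) (\<lambda>b. v \<bullet> b) (- (v \<bullet> e / 2))) / (v \<bullet> e)"
    using section_fun_eq_cdf[OF finite_Basis e, of "\<lambda>b. v \<bullet> b"] assms(3) by simp
  then show ?thesis
    unfolding measure_central_section[OF assms(1) e assms(3)[OF e]]
    using measure_two_sided_slab[of "Basis - {e}" "\<lambda>b. v \<bullet> b" "v \<bullet> e / 2"] ne assms(3) e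
    by (simp add: less_imp_le)
qed

text \<open>For equal weights the density is a rescaled spline, and 1/2 is the mass to the left of
  0. The induction starts with two coordinates, matching the shifted index of
  \<open>bspline\<close>.\<close>

lemma cube_cdf_const:
  assumes "finite J" "card J = k + 2" "b > 0" "\<And>i. i \<in> J \<Longrightarrow> w i = b"
  shows "cube_cdf J w x = 1/2 + prim (bspline k) (x / b)"
  using assms
proof (induction k arbitrary: J x)
  case 0
  then obtain i j where J: "J = {i, j}" "i \<noteq> j" by (metis card_2_iff add_0)
  have pos: "\<And>l. l \<in> J \<Longrightarrow> w l > 0" using 0 by simp
  have "cube_cdf J w x = trunc_sum 2 {i, j} w x / (2 * b\<^sup>2)"
    using cube_cdf_eq_trunc_sum[of J w x] pos 0 J by (simp add: power2_eq_square numeral_2_eq_2)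
  also have "trunc_sum 2 {i, j} w x = trunc_power 2 (x + b) - 2 * trunc_power 2 x + trunc_power 2 (x - b)"
    using J 0 by (simp add: trunc_sum_insert) (simp add: trunc_sum_def add.commute)
  also have "(trunc_power 2 (x + b) - 2 * trunc_power 2 x + trunc_power 2 (x - b)) / (2 * b\<^sup>2) = 1/2 + prim (bspline 0) (x / b)"
  proof -
    have out: "prim (bspline 0) z = 1/2" if "z \<ge> 1" for z
      using that prim_bspline_outside[of 0 z] by simp
    have minus: "prim (bspline 0) z = - prim (bspline 0) (- z)" for z by simp
    consider "x \<ge> b" | "0 \<le> x" "x < b" | "- b \<le> x" "x < 0" | "x < - b" by linarith
    then show ?thesis
    proof cases
      case 1
      then show ?thesis using 0(3)
        by (subst out) (auto simp: trunc_power_def power2_eq_square field_simps)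
    next
      case 2
      then show ?thesis using 0(3)
        by (subst prim_tri) (auto simp: trunc_power_def power2_eq_square field_simps)
    next
      case 3
      then show ?thesis using 0(3)
        by (subst minus, subst prim_tri) (auto simp: trunc_power_def power2_eq_square field_simps)
    next
      case 4
      then show ?thesis using 0(3)
        by (subst minus, subst out) (auto simp: trunc_power_def power2_eq_square field_simps)
    qed
  qed
  finally show ?case .
next
  case (Suc k)
  then obtain i where i: "i \<in> J" by (metis card.empty ex_in_conv add_Suc nat.distinct(1))
  define R where "R = J - {i}"
  have R: "J = insert i R" "i \<notin> R" "finite R" "card R = k + 2"
    using Suc.prems i by (auto simp: R_def)
  have IH: "cube_cdf R w x = 1/2 + prim (bspline k) (x / b)" for x
    using Suc.IH[OF R(3,4)] Suc.prems R by auto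
  define A where "A u = u / 2 - prim (prim (bspline k)) (x / b - u)" for u
  have "((\<lambda>u. 1/2 + prim (bspline k) (x / b - u)) has_integral A (1/2) - A (-1/2)) {-1/2..1/2}"
  proof (rule fundamental_theorem_of_calculus)
    fix u :: real
    have "((\<lambda>u. prim (prim (bspline k)) (x / b - u)) has_real_derivative prim (bspline k) (x / b - u) * (- 1)) (at u)"
      by (rule DERIV_chain2[OF DERIV_prim2_bspline]) (auto intro!: derivative_eq_intros)
    then have "(A has_real_derivative 1/2 - prim (bspline k) (x / b - u) * (- 1)) (at u)"
      unfolding A_def by (intro DERIV_diff) (auto intro!: derivative_eq_intros)
    then show "(A has_vector_derivative 1/2 + prim (bspline k) (x / b - u)) (at u within {-1/2..1/2})"
      by (simp add: has_real_derivative_iff_has_vector_derivative has_vector_derivative_at_within)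
  qed simp
  moreover have "((\<lambda>u. 1/2 + prim (bspline k) (x / b - u)) has_integral cube_cdf J w x) {-1/2..1/2}"
    using cube_cdf_insert[OF R(3,2), of w x] Suc.prems(3) Suc.prems(4)[of i] i
    unfolding R(1)[symmetric] IH by (simp add: diff_divide_distrib)
  ultimately have "cube_cdf J w x = A (1/2) - A (-1/2)" by (rule has_integral_unique[rotated])
  then show ?case by (simp add: A_def prim_bspline_Suc)
qed

text \<open>\<open>i1\<close> serves as projection coordinate, \<open>i2\<close> is integrated out,
  and the others enter through the spline. Evenness of the second primitive pairs up the four terms,
  whence the factor 2.\<close>

lemma section_fun_pair:
  assumes I: "finite I" "card I = k + 4" "i1 \<in> I" "i2 \<in> I" "i1 \<noteq> i2"
    and w: "w i1 = x" "w i2 = y" "\<And>i. i \<in> I - {i1, i2} \<Longrightarrow> w i = b" and pos: "x > 0" "y > 0" "b > 0"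
  shows "section_fun I w = 2 * b / (x * y) *
     (prim (prim (bspline k)) ((x + y) / (2 * b)) - prim (prim (bspline k)) ((x - y) / (2 * b)))"
proof -
  define R where "R = I - {i1, i2}"
  define K where "K = prim (prim (bspline k))"
  have R: "finite R" "card R = k + 2" "i2 \<notin> R" "I - {i1} = insert i2 R"
    using I by (auto simp: R_def card_Diff_subset)
  have cdfR: "cube_cdf R w t = 1/2 + prim (bspline k) (t / b)" for t
    using R w(3) pos by (intro cube_cdf_const) (auto simp: R_def)
  have cdf: "cube_cdf (insert i2 R) w t = 1/2 + b / y * (K ((t + y / 2) / b) - K ((t - y / 2) / b))" for t
  proof -
    define A where "A u = u / 2 - b / y * K ((t - y * u) / b)" for u
    have "((\<lambda>u. 1/2 + prim (bspline k) ((t - y * u) / b)) has_integral A (1/2) - A (-1/2)) {-1/2..1/2}"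
    proof (rule fundamental_theorem_of_calculus)
      fix u :: real
      have "((\<lambda>u. K ((t - y * u) / b)) has_real_derivative prim (bspline k) ((t - y * u) / b) * (- y / b)) (at u)"
        unfolding K_def
        by (rule DERIV_chain2[OF DERIV_prim2_bspline]) (use pos in \<open>auto intro!: derivative_eq_intros\<close>)
      then have "(A has_real_derivative 1/2 - b / y * (prim (bspline k) ((t - y * u) / b) * (- y / b))) (at u)"
        unfolding A_def by (intro DERIV_diff DERIV_cmult) (auto intro!: derivative_eq_intros)
      then show "(A has_vector_derivative 1/2 + prim (bspline k) ((t - y * u) / b)) (at u within {-1/2..1/2})"
        using pos by (simp add: has_real_derivative_iff_has_vector_derivative has_vector_derivative_at_within)
    qed simp
    moreover have "((\<lambda>u. 1/2 + prim (bspline k) ((t - y * u) / b)) has_integral cube_cdf (insert i2 R) w t) {-1/2..1/2}"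
      using cube_cdf_insert[OF R(1,3), of w t] w(2) unfolding cdfR by simp
    ultimately have "cube_cdf (insert i2 R) w t = A (1/2) - A (-1/2)" by (rule has_integral_unique[rotated])
    then show ?thesis by (simp add: A_def right_diff_distrib)
  qed
  have wpos: "w i > 0" if "i \<in> I" for i using w pos that by (cases "i \<in> {i1, i2}") auto
  have e1: "(x / 2 + y / 2) / b = (x + y) / (2 * b)" "(x / 2 - y / 2) / b = (x - y) / (2 * b)"
    "(- x / 2 - y / 2) / b = - ((x + y) / (2 * b))" "(- x / 2 + y / 2) / b = - ((x - y) / (2 * b))"
    using pos by (simp_all add: field_simps)
  have even: "K (- z) = K z" for z by (simp add: K_def)
  have "section_fun I w = (cube_cdf (insert i2 R) w (x / 2) - cube_cdf (insert i2 R) w (- x / 2)) / x"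
    using section_fun_eq_cdf[OF I(1,3), of w] wpos R(4) w(1) by simp
  moreover have "((1/2 + b / y * (p - q)) - (1/2 + b / y * (q - p))) / x = 2 * b / (x * y) * (p - q)" for p q
    using pos by (simp add: field_simps)
  ultimately show ?thesis
    unfolding cdf e1 even K_def[symmetric] by simp
qed

section \<open>Symmetry and differentiability in all coordinates\<close>

lemma trunc_sum_permute:
  assumes "\<pi> permutes I" "finite I"
  shows "trunc_sum n I (w \<circ> \<pi>) x = trunc_sum n I w x"
proof -
  have inj: "inj_on \<pi> A" for A using permutes_inj[OF assms(1)] by (rule inj_on_subset) simp
  have "trunc_sum n I w x = (\<Sum>S\<in>(`) \<pi> ` Pow I. (-1) ^ card S * trunc_power n (x + (sum w (I - S) - sum w S) / 2))"
    using permutes_image[OF assms(1)] by (simp add: trunc_sum_def image_Pow_surj)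
  also have "\<dots> = (\<Sum>S\<in>Pow I. (-1) ^ card (\<pi> ` S) * trunc_power n (x + (sum w (I - \<pi> ` S) - sum w (\<pi> ` S)) / 2))"
    using inj by (subst sum.reindex) (auto simp: inj_on_image_Pow)
  also have "\<dots> = trunc_sum n I (w \<circ> \<pi>) x"
    unfolding trunc_sum_def
  proof (rule sum.cong)
    fix S assume "S \<in> Pow I"
    have "I - \<pi> ` S = \<pi> ` (I - S)"
      using permutes_image[OF assms(1)] permutes_inj[OF assms(1)] by (metis image_set_diff)
    then show "(-1) ^ card (\<pi> ` S) * trunc_power n (x + (sum w (I - \<pi> ` S) - sum w (\<pi> ` S)) / 2)
       = (-1) ^ card S * trunc_power n (x + (sum (w \<circ> \<pi>) (I - S) - sum (w \<circ> \<pi>) S) / 2)"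
      using inj by (simp add: card_image sum.reindex)
  qed simp
  finally show ?thesis ..
qed

lemma section_fun_permute:
  assumes "\<pi> permutes I" "finite I"
  shows "section_fun I (w \<circ> \<pi>) = section_fun I w"
  using trunc_sum_permute[OF assms] prod.permute[OF assms(1), of w] by (simp add: section_fun_def)

text \<open>From dimension 3 on the exponent is at least 2, so the truncated powers are
  differentiable at 0 too.\<close>

lemma section_fun_differentiable:
  fixes v :: "'a::euclidean_space"
  assumes "DIM('a) \<ge> 3" "\<And>b. b \<in> Basis \<Longrightarrow> v \<bullet> b > 0"
  shows "(\<lambda>v. section_fun Basis (\<lambda>b. v \<bullet> b)) differentiable (at v)"
proof -
  define n where "n = DIM('a) - 3"
  have n: "DIM('a) - 1 = Suc (Suc n)" using assms(1) by (simp add: n_def)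
  have tp: "(\<lambda>v. trunc_power (Suc (Suc n)) (f v)) differentiable (at v)" if "f differentiable (at v)" for f :: "'a \<Rightarrow> real"
  proof -
    have "trunc_power (Suc (Suc n)) differentiable (at (f v))"
      using DERIV_trunc_power[of n "f v"] real_differentiable_def by blast
    from differentiable_chain_at[OF that this] show ?thesis by (simp add: o_def)
  qed
  have inn: "(\<lambda>v. v \<bullet> b) differentiable (at v)" for b :: 'a
    by (intro bounded_linear_imp_differentiable bounded_linear_inner_left)
  have "(\<lambda>v. trunc_sum (Suc (Suc n)) Basis (\<lambda>b. v \<bullet> b) 0) differentiable (at v)"
    unfolding trunc_sum_def
    by (intro differentiable_sum ballI differentiable_mult differentiable_const tp differentiable_add differentiable_divide differentiable_diff inn) (auto intro: finite_subset)
  moreover have "(\<lambda>v. \<Prod>b\<in>Basis. v \<bullet> b) differentiable (at v)"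
    using finite_Basis by (induction rule: finite_induct) (auto intro: differentiable_mult inn)
  moreover have "(\<Prod>b\<in>Basis. v \<bullet> b) \<noteq> 0" using assms(2) by force
  ultimately show ?thesis
    unfolding section_fun_def n
    by (intro differentiable_divide differentiable_mult differentiable_const) auto
qed

section \<open>The directions with two distinguished coordinates\<close>

lemma section_fun_cong:
  assumes "\<And>i. i \<in> I \<Longrightarrow> w i = w' i" shows "section_fun I w = section_fun I w'"
proof -
  have "sum w (I - S) = sum w' (I - S)" "sum w S = sum w' S" if "S \<in> Pow I" for S
    using assms that by (auto intro!: sum.cong)
  then have "trunc_sum n I w x = trunc_sum n I w' x" for n x
    unfolding trunc_sum_def by (intro sum.cong) auto
  moreover have "prod w I = prod w' I" using assms by (intro prod.cong) auto
  ultimately show ?thesis by (simp add: section_fun_def)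
qed

lemma centered_cube_eq: "(centered_cube :: (real ^ 'n) set) = unit_cube"
proof -
  have "- 1 / 2 \<le> t \<and> t \<le> 1 / 2 \<longleftrightarrow> \<bar>t\<bar> \<le> 1 / 2" for t :: real by arith
  then show ?thesis
    by (simp add: set_eq_iff centered_cube_def unit_cube_def mem_box_cart Basis_vec_def inner_axis)
qed

text \<open>A formula on all vectors, matched with \<open>central_section\<close> for positive unit
  vectors. It is homogeneous of degree -1, so its gradient may have a component along the vector,
  harmless on the sphere.\<close>

definition cube_section :: "real ^ 'n \<Rightarrow> real" where
  "cube_section v = section_fun Basis (\<lambda>b. v \<bullet> b)"

lemma central_section_eq:
  fixes v :: "real ^ 'n"
  assumes "CARD('n) \<ge> 2" "norm v = 1" "\<And>i. v $ i > 0"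
  shows "central_section v = cube_section v"
  unfolding central_section_def orth_hyperplane_def centered_cube_eq cube_section_def
proof (rule section_volume)
  show "DIM(real ^ 'n) \<ge> 2" using assms(1) by simp
  show "v \<bullet> b > 0" if "b \<in> Basis" for b using that assms(3) by (auto simp: Basis_vec_def inner_axis)
qed (use assms in auto)

lemma cube_section_swap:
  fixes v :: "real ^ 'n"
  shows "cube_section (\<chi> k. v $ Transposition.transpose i j k) = cube_section v"
proof -
  define \<pi> where "\<pi> = Transposition.transpose (axis i 1 :: real ^ 'n) (axis j 1)"
  have "\<pi> permutes Basis" unfolding \<pi>_def by (intro permutes_swap_id) auto
  have "(\<chi> k. v $ Transposition.transpose i j k) \<bullet> b = ((\<lambda>b. v \<bullet> b) \<circ> \<pi>) b" if bB: "b \<in> Basis" for b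
  proof -
    obtain k where b: "b = axis k 1" using bB by (auto simp: Basis_vec_def)
    have "\<pi> b = axis (Transposition.transpose i j k) 1"
      by (auto simp: \<pi>_def b Transposition.transpose_def axis_eq_axis)
    then show ?thesis by (simp add: b inner_axis)
  qed
  then have "section_fun Basis (\<lambda>b. (\<chi> k. v $ Transposition.transpose i j k) \<bullet> b) = section_fun Basis ((\<lambda>b. v \<bullet> b) \<circ> \<pi>)"
    by (intro section_fun_cong) auto
  also have "\<dots> = section_fun Basis (\<lambda>b. v \<bullet> b)"
    by (intro section_fun_permute \<open>\<pi> permutes Basis\<close> finite_Basis)
  finally show ?thesis by (simp add: cube_section_def)
qed

text \<open>A Lagrange multiplier: subtracting \<open>\<kappa> / 2 * (y \<bullet> y)\<close>, which
  is constant on the sphere, removes a gradient parallel to \<open>w\<close>.\<close>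

lemma has_derivative_0_on_sphere:
  fixes f :: "'a::euclidean_space \<Rightarrow> real"
  assumes "(f has_derivative (\<lambda>h. \<kappa> * (w \<bullet> h))) (at w)" "w \<in> sphere 0 1" "open U" "w \<in> U"
    and eq: "\<And>y. y \<in> sphere 0 1 \<inter> U \<Longrightarrow> g y = f y"
  shows "(g has_derivative (\<lambda>h. 0)) (at w within sphere 0 1)"
proof -
  have "((\<lambda>y. f y - \<kappa> / 2 * (y \<bullet> y) + \<kappa> / 2) has_derivative (\<lambda>h. \<kappa> * (w \<bullet> h) - \<kappa> / 2 * (w \<bullet> h + h \<bullet> w) + 0)) (at w within sphere 0 1)"
    by (intro derivative_intros has_derivative_at_withinI[OF assms(1)])
  then have der: "((\<lambda>y. f y - \<kappa> / 2 * (y \<bullet> y) + \<kappa> / 2) has_derivative (\<lambda>h. 0)) (at w within sphere 0 1)"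
    by (simp add: inner_commute)
  obtain d where d: "d > 0" "ball w d \<subseteq> U" using assms(3,4) openE by blast
  show ?thesis
  proof (rule has_derivative_transform_within[OF der d(1) assms(2)])
    fix y assume y: "y \<in> sphere 0 1" "dist y w < d"
    then have "y \<bullet> y = 1" by (simp add: dot_square_norm)
    moreover have "y \<in> U" using y d by (auto simp: dist_commute)
    ultimately show "f y - \<kappa> / 2 * (y \<bullet> y) + \<kappa> / 2 = g y" using eq y by auto
  qed
qed

locale two_coordinates =
  fixes i1 i2 :: "'n::finite"
  assumes card4: "CARD('n) \<ge> 4" and neq: "i1 \<noteq> i2"
begin

definition k :: nat where "k = CARD('n) - 4"
definition m :: real where "m = real (k + 2)"
definition K :: "real \<Rightarrow> real" where "K = prim (prim (bspline k))"

definition vec3 :: "real \<Rightarrow> real \<Rightarrow> real \<Rightarrow> real ^ 'n" where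
  "vec3 x y b = (\<chi> i. if i = i1 then x else if i = i2 then y else b)"

definition bb :: "real \<Rightarrow> real" where "bb a = sqrt ((1 - 2 * a\<^sup>2) / m)"
definition cc :: "real \<Rightarrow> real" where "cc a = a / bb a"
definition lo :: real where "lo = 1 / sqrt (real CARD('n))"
definition hi :: real where "hi = 1 / sqrt 2"

lemma m: "m = real CARD('n) - 2" "m \<ge> 2"
  using card4 by (auto simp: m_def k_def of_nat_diff)

lemma v_two_eq: "v_two i1 i2 a = vec3 a a (bb a)"
  by (auto simp: v_two_def vec3_def bb_def m(1) vec_eq_iff)

lemma sum_coordinates: "(\<Sum>i\<in>UNIV. f i) = f i1 + f i2 + sum f (UNIV - {i1, i2})" for f :: "'n \<Rightarrow> real"
  using neq by (subst sum.subset_diff[of "{i1, i2}"]) auto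

lemma card_rest: "real (card (UNIV - {i1, i2})) = m"
  using neq card4 m(1) by (simp add: card_Diff_subset of_nat_diff)

lemma inner_vec3: "vec3 x y b \<bullet> h = x * h $ i1 + y * h $ i2 + b * (\<Sum>i\<in>UNIV - {i1, i2}. h $ i)"
proof -
  have "(\<Sum>i\<in>UNIV - {i1, i2}. vec3 x y b $ i * h $ i) = (\<Sum>i\<in>UNIV - {i1, i2}. b * h $ i)"
    by (intro sum.cong) (auto simp: vec3_def)
  then show ?thesis
    using neq by (simp add: inner_vec_def sum_coordinates vec3_def sum_distrib_left)
qed

lemma norm_vec3: "norm (vec3 x y b) = sqrt (x\<^sup>2 + y\<^sup>2 + m * b\<^sup>2)"
proof -
  have "(\<Sum>i\<in>UNIV - {i1, i2}. vec3 x y b $ i) = (\<Sum>i\<in>UNIV - {i1, i2}. b)"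
    by (intro sum.cong) (auto simp: vec3_def)
  then have "(\<Sum>i\<in>UNIV - {i1, i2}. vec3 x y b $ i) = m * b" by (simp add: card_rest)
  then have "vec3 x y b \<bullet> vec3 x y b = x\<^sup>2 + y\<^sup>2 + m * b\<^sup>2"
    using neq by (simp add: inner_vec3 power2_eq_square) (simp add: vec3_def)
  then show ?thesis by (simp add: norm_eq_sqrt_inner)
qed

lemma cube_section_vec3:
  assumes "x > 0" "y > 0" "b > 0"
  shows "cube_section (vec3 x y b) = 2 * b / (x * y) * (K ((x + y) / (2 * b)) - K ((x - y) / (2 * b)))"
  unfolding cube_section_def K_def
proof (rule section_fun_pair)
  show "axis i1 1 \<noteq> (axis i2 1 :: real ^ 'n)" using neq by (simp add: axis_eq_axis)
  show "card (Basis :: (real ^ 'n) set) = k + 4" using card4 by (simp add: k_def)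
  show "vec3 x y b \<bullet> i = b" if "i \<in> Basis - {axis i1 1, axis i2 1}" for i
    using that by (auto simp: Basis_vec_def inner_axis vec3_def axis_eq_axis)
qed (use assms neq in \<open>auto simp: inner_axis vec3_def\<close>)

lemma central_section_vec3:
  assumes "x > 0" "y > 0" "b > 0" "x\<^sup>2 + y\<^sup>2 + m * b\<^sup>2 = 1"
  shows "central_section (vec3 x y b) = 2 * b / (x * y) * (K ((x + y) / (2 * b)) - K ((x - y) / (2 * b)))"
  using central_section_eq[of "vec3 x y b"] assms card4 cube_section_vec3[OF assms(1-3)]
  by (simp add: norm_vec3) (simp add: vec3_def)

lemma lo_hi: "0 < lo" "lo < hi"
  using card4 by (auto simp: lo_def hi_def intro!: divide_strict_left_mono)

lemma bb:
  assumes "0 < a" "a < hi"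
  shows "bb a > 0" "m * (bb a)\<^sup>2 = 1 - 2 * a\<^sup>2"
proof -
  have "a\<^sup>2 < hi\<^sup>2" using assms by (intro power_strict_mono) auto
  then have "1 - 2 * a\<^sup>2 > 0" by (simp add: hi_def power_divide)
  then show "bb a > 0" "m * (bb a)\<^sup>2 = 1 - 2 * a\<^sup>2" using m(2) by (auto simp: bb_def)
qed

lemma sigma_hat_eq:
  assumes "0 < a" "a < hi"
  shows "sigma_hat i1 i2 a = 2 * bb a / a\<^sup>2 * K (cc a)"
proof -
  have "sigma_hat i1 i2 a = 2 * bb a / (a * a) * (K ((a + a) / (2 * bb a)) - K ((a - a) / (2 * bb a)))"
    unfolding sigma_hat_def v_two_eq
    using assms bb[OF assms] by (intro central_section_vec3) auto
  then show ?thesis by (simp add: cc_def K_def power2_eq_square)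
qed

lemma DERIV_bb:
  assumes "0 < a" "a < hi"
  shows "(bb has_real_derivative - 2 * a / (m * bb a)) (at a)"
proof -
  have pos: "(1 - 2 * a\<^sup>2) / m > 0" using bb[OF assms] m(2) by (simp add: bb_def)
  have "((\<lambda>a. (1 - 2 * a\<^sup>2) / m) has_real_derivative - 4 * a / m) (at a)"
    using m(2) by (auto intro!: derivative_eq_intros simp: field_simps)
  from DERIV_chain2[OF DERIV_real_sqrt[OF pos] this]
  show ?thesis unfolding bb_def[abs_def] by (simp add: inverse_eq_divide field_simps)
qed

lemma DERIV_cc:
  assumes "0 < a" "a < hi"
  shows "(cc has_real_derivative 1 / (m * bb a ^ 3)) (at a)"
proof -
  note b = bb[OF assms]
  have "(cc has_real_derivative (1 * bb a - a * (- 2 * a / (m * bb a))) / (bb a * bb a)) (at a)"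
    unfolding cc_def[abs_def] using b by (intro DERIV_divide DERIV_ident DERIV_bb assms) auto
  also have "1 * bb a - a * (- 2 * a / (m * bb a)) = (m * (bb a)\<^sup>2 + 2 * a\<^sup>2) / (m * bb a)"
    using b(1) m(2) by (simp add: field_simps power2_eq_square)
  also have "m * (bb a)\<^sup>2 + 2 * a\<^sup>2 = 1" using b by simp
  finally show ?thesis by (simp add: power3_eq_cube mult_ac)
qed

definition dsigma :: "real \<Rightarrow> real" where "dsigma a = 2 * bb a / (m * a ^ 3) * psi k (cc a)"

lemma DERIV_sigma_hat:
  assumes "0 < a" "a < hi"
  shows "(sigma_hat i1 i2 has_real_derivative dsigma a) (at a)"
proof -
  note b = bb[OF assms]
  define K1 where "K1 = prim (bspline k)"
  have dK: "(K has_real_derivative K1 x) (at x)" for x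
    unfolding K_def K1_def by (rule DERIV_prim2_bspline)
  have "((\<lambda>a. 2 * bb a / a\<^sup>2 * K (cc a)) has_real_derivative
     ((2 * (- 2 * a / (m * bb a))) * a\<^sup>2 - 2 * bb a * (2 * a)) / (a\<^sup>2 * a\<^sup>2) * K (cc a)
       + K1 (cc a) * (1 / (m * bb a ^ 3)) * (2 * bb a / a\<^sup>2)) (at a)"
    using assms
    by (intro DERIV_mult DERIV_divide DERIV_cmult DERIV_bb DERIV_chain2[OF dK DERIV_cc])
       (auto intro!: derivative_eq_intros)
  also have "((2 * (- 2 * a / (m * bb a))) * a\<^sup>2 - 2 * bb a * (2 * a)) / (a\<^sup>2 * a\<^sup>2) * K (cc a)
       + K1 (cc a) * (1 / (m * bb a ^ 3)) * (2 * bb a / a\<^sup>2) = dsigma a"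
  proof -
    define \<beta> where "\<beta> = bb a"
    have \<beta>: "\<beta> > 0" "m * \<beta>\<^sup>2 = 1 - 2 * a\<^sup>2" using b by (auto simp: \<beta>_def)
    have m0: "m > 0" using m(2) by simp
    \<comment> \<open>The norm condition \<open>m * \<beta>\<^sup>2 + 2 * a\<^sup>2 = 1\<close>,
      divided by \<open>\<beta>\<^sup>2\<close>.\<close>
    have 1: "m + 2 * (a / \<beta>)\<^sup>2 = 1 / \<beta>\<^sup>2" using \<beta> by (simp add: field_simps power2_eq_square)
    have 2: "2 * (m + (a / \<beta>)\<^sup>2) = 2 * (m * \<beta>\<^sup>2 + a\<^sup>2) / \<beta>\<^sup>2" using \<beta>(1) by (simp add: field_simps)
    have "psi k (a / \<beta>) = a / \<beta> * (m + 2 * (a / \<beta>)\<^sup>2) * K1 (a / \<beta>) - 2 * (m + (a / \<beta>)\<^sup>2) * K (a / \<beta>)"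
      by (simp add: psi_def K_def K1_def m_def)
    also have "\<dots> = a / \<beta> * (1 / \<beta>\<^sup>2) * K1 (a / \<beta>) - 2 * (m * \<beta>\<^sup>2 + a\<^sup>2) / \<beta>\<^sup>2 * K (a / \<beta>)"
      unfolding 1 2 ..
    finally have ps: "psi k (a / \<beta>) = a / \<beta> * (1 / \<beta>\<^sup>2) * K1 (a / \<beta>) - 2 * (m * \<beta>\<^sup>2 + a\<^sup>2) / \<beta>\<^sup>2 * K (a / \<beta>)" .
    show ?thesis
      unfolding dsigma_def cc_def \<beta>_def[symmetric] ps
      using assms(1) \<beta>(1) m0 by (simp add: field_simps power2_eq_square power3_eq_cube)
  qed
  finally show ?thesis
    by (rule has_field_derivative_transform_within_open[of _ _ _ "{0<..<hi}"])
       (use assms in \<open>auto simp: sigma_hat_eq\<close>)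
qed

lemma cc_strict_mono:
  assumes "0 < x" "x < y" "y < hi" shows "cc x < cc y"
  by (rule DERIV_pos_imp_increasing[OF assms(2)])
     (use assms bb m(2) DERIV_cc in \<open>fastforce intro: exI[of _ "1 / (m * bb _ ^ 3)"]\<close>)

lemma cc_lo: "cc lo = 1"
proof -
  have "1 - 2 * lo\<^sup>2 = m * lo\<^sup>2" using card4 m by (simp add: lo_def power_divide field_simps)
  then have "bb lo = lo" using lo_hi(1) m(2) by (simp add: bb_def)
  then show ?thesis using lo_hi by (simp add: cc_def)
qed

lemma cc_gt_1: "lo < a \<Longrightarrow> a < hi \<Longrightarrow> cc a > 1"
  using cc_strict_mono[of lo a] cc_lo lo_hi by simp

text \<open>Carries statements on right-hand neighbourhoods from \<open>a / b\<close>, the variable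
  of \<open>psi\<close>, back to \<open>a\<close>; strict monotonicity preserves the side.\<close>

lemma cc_right_nbhd:
  assumes "0 < x" "x < hi" "\<delta> > 0"
  shows "\<exists>\<epsilon>>0. \<forall>y. x < y \<longrightarrow> y < x + \<epsilon> \<longrightarrow> y < hi \<longrightarrow> cc x < cc y \<and> cc y < cc x + \<delta>"
proof -
  have "isCont cc x" using DERIV_cc[OF assms(1,2)] by (rule DERIV_isCont)
  then obtain \<epsilon> where "\<epsilon> > 0" "\<And>y. dist y x < \<epsilon> \<Longrightarrow> dist (cc y) (cc x) < \<delta>"
    using assms(3) unfolding continuous_at_eps_delta by blast
  then show ?thesis using cc_strict_mono[of x] assms(1)
    by (intro exI[of _ \<epsilon>]) (auto simp: dist_real_def, metis abs_less_iff diff_less_eq add.commute abs_of_pos diff_gt_0_iff_gt)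
qed

lemma dsigma_sign:
  assumes "0 < a" "a < hi"
  shows "dsigma a < 0 \<longleftrightarrow> psi k (cc a) < 0" "dsigma a > 0 \<longleftrightarrow> psi k (cc a) > 0" "dsigma a = 0 \<longleftrightarrow> psi k (cc a) = 0"
proof -
  define p where "p = 2 * bb a / (m * a ^ 3)"
  have "p > 0" using bb[OF assms] assms m(2) by (simp add: p_def)
  then show "dsigma a < 0 \<longleftrightarrow> psi k (cc a) < 0" "dsigma a > 0 \<longleftrightarrow> psi k (cc a) > 0" "dsigma a = 0 \<longleftrightarrow> psi k (cc a) = 0"
    unfolding dsigma_def p_def[symmetric] by (auto simp: mult_less_0_iff zero_less_mult_iff)
qed

lemma initially_decreasing_sigma_hat:
  "\<exists>\<epsilon> x1. initially_decreasing (sigma_hat i1 i2) dsigma lo hi \<epsilon> x1"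
proof -
  obtain \<epsilon>0 where e0: "\<epsilon>0 > 0" "\<And>c. 1 < c \<Longrightarrow> c < 1 + \<epsilon>0 \<Longrightarrow> psi k c < 0"
    using psi_negative_right_of_1 by blast
  obtain \<epsilon> where \<epsilon>: "\<epsilon> > 0" "\<And>y. lo < y \<Longrightarrow> y < lo + \<epsilon> \<Longrightarrow> y < hi \<Longrightarrow> cc lo < cc y \<and> cc y < cc lo + \<epsilon>0"
    using cc_right_nbhd[OF lo_hi e0(1)] by blast
  obtain c where c: "c > 1" "psi k c > 0" using psi_eventually_positive by blast
  \<comment> \<open>The norm of \<open>(c, c, 1, ..., 1)\<close>; dividing by it gives the member of
    the family with quotient \<open>c\<close>.\<close>
  define s where "s = sqrt (m + 2 * c\<^sup>2)"
  have s2: "s\<^sup>2 = m + 2 * c\<^sup>2" and s: "s > 0" using m(2) c(1) by (auto simp: s_def add_pos_nonneg)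
  define x1 where "x1 = c / s"
  have x1p: "x1 > 0" using c s by (simp add: x1_def)
  have "1 - 2 * x1\<^sup>2 = (s\<^sup>2 - 2 * c\<^sup>2) / s\<^sup>2" using s by (simp add: x1_def field_simps)
  also have "s\<^sup>2 - 2 * c\<^sup>2 = m" by (simp add: s2)
  finally have x1sq: "1 - 2 * x1\<^sup>2 = m / s\<^sup>2" .
  then have eq: "(1 - 2 * x1\<^sup>2) / m = (1 / s)\<^sup>2" using m(2) by (simp add: power_divide)
  have bx: "bb x1 = 1 / s" using s by (simp add: bb_def eq)
  then have ccx: "cc x1 = c" using s by (simp add: cc_def x1_def)
  have x1hi: "x1 < hi"
  proof -
    have "1 - 2 * x1\<^sup>2 > 0" unfolding x1sq using s m(2) by simp
    then have "x1\<^sup>2 < hi\<^sup>2" by (simp add: hi_def power_divide)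
    then show ?thesis using lo_hi by (auto intro: power_less_imp_less_base)
  qed
  have lox1: "lo < x1"
  proof (rule ccontr)
    assume "\<not> lo < x1"
    then have "cc x1 \<le> cc lo" using cc_strict_mono[of x1 lo] x1p lo_hi by (cases "x1 = lo") auto
    with ccx cc_lo c show False by simp
  qed
  have "initially_decreasing (sigma_hat i1 i2) dsigma lo hi \<epsilon> x1"
  proof
    fix x assume x: "lo < x" "x < hi"
    then have x0: "0 < x" using lo_hi by simp
    show "(sigma_hat i1 i2 has_real_derivative dsigma x) (at x)" using DERIV_sigma_hat x0 x by blast
    show "dsigma x < 0" if "x < lo + \<epsilon>" using dsigma_sign(1)[OF x0 x(2)] e0(2)[of "cc x"] \<epsilon>(2)[of x] x that cc_lo by simp
    obtain \<delta> where d: "\<delta> > 0" "(\<forall>y. cc x < y \<longrightarrow> y < cc x + \<delta> \<longrightarrow> psi k y = 0) \<or> (\<forall>y. cc x < y \<longrightarrow> y < cc x + \<delta> \<longrightarrow> psi k y \<noteq> 0)"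
      using right_polynomial_zeros[OF right_polynomial_psi] by blast
    obtain \<epsilon>' where e': "\<epsilon>' > 0" "\<And>y. x < y \<Longrightarrow> y < x + \<epsilon>' \<Longrightarrow> y < hi \<Longrightarrow> cc x < cc y \<and> cc y < cc x + \<delta>"
      using cc_right_nbhd[OF x0 x(2) d(1)] by blast
    have "dsigma y = 0 \<longleftrightarrow> psi k (cc y) = 0" if "x < y" "y < hi" for y
      using dsigma_sign(3)[of y] that x0 by simp
    with d(2) e' show "\<exists>\<delta>>0. (\<forall>y. x < y \<longrightarrow> y < x + \<delta> \<longrightarrow> y < hi \<longrightarrow> dsigma y = 0) \<or> (\<forall>y. x < y \<longrightarrow> y < x + \<delta> \<longrightarrow> y < hi \<longrightarrow> dsigma y \<noteq> 0)"
      by (intro exI[of _ \<epsilon>']) blast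
  qed (use \<epsilon> lox1 x1hi dsigma_sign(2)[OF x1p x1hi] ccx c in auto)
  then show ?thesis by blast
qed

lemma first_local_min_iff:
  "first_local_min i1 i2 \<xi> \<longleftrightarrow> local_min_on (sigma_hat i1 i2) {lo<..<hi} \<xi> \<and>
     (\<forall>\<zeta>. local_min_on (sigma_hat i1 i2) {lo<..<hi} \<zeta> \<longrightarrow> \<xi> \<le> \<zeta>)"
  by (simp add: first_local_min_def lo_def hi_def Let_def)

lemma first_local_min_exists: "\<exists>\<xi>. first_local_min i1 i2 \<xi>"
  using initially_decreasing_sigma_hat initially_decreasing.first_min_exists
  unfolding first_local_min_iff by blast

lemma first_local_minD:
  assumes "first_local_min i1 i2 \<xi>"
  shows "lo < \<xi>" "\<xi> < hi" "dsigma \<xi> = 0" "\<And>x. lo < x \<Longrightarrow> x < \<xi> \<Longrightarrow> sigma_hat i1 i2 \<xi> < sigma_hat i1 i2 x"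
proof -
  obtain \<epsilon> x1 where "initially_decreasing (sigma_hat i1 i2) dsigma lo hi \<epsilon> x1"
    using initially_decreasing_sigma_hat by blast
  then interpret initially_decreasing "sigma_hat i1 i2" dsigma lo hi \<epsilon> x1 .
  have lm: "local_min_on (sigma_hat i1 i2) {lo<..<hi} \<xi>" and
    first: "\<And>\<zeta>. local_min_on (sigma_hat i1 i2) {lo<..<hi} \<zeta> \<Longrightarrow> \<xi> \<le> \<zeta>"
    using assms by (auto simp: first_local_min_iff)
  show I: "lo < \<xi>" "\<xi> < hi" using lm by (auto simp: local_min_on_def)
  show "dsigma \<xi> = 0" using lm by (rule local_min_deriv)
  show "sigma_hat i1 i2 \<xi> < sigma_hat i1 i2 x" if "lo < x" "x < \<xi>" for x
    using decreasing_before[of \<xi> x \<xi>] first that I by blast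
qed

end

context two_coordinates
begin

lemma vec3_decompose: "vec3 x y b = x *\<^sub>R vec3 1 0 0 + y *\<^sub>R vec3 0 1 0 + b *\<^sub>R vec3 0 0 1"
  by (simp add: vec_eq_iff vec3_def)

lemma v_two_sphere: "0 < a \<Longrightarrow> a < hi \<Longrightarrow> v_two i1 i2 a \<in> sphere 0 1"
  using bb(2)[of a] by (simp add: v_two_eq norm_vec3)

lemma v_two_pos: "0 < a \<Longrightarrow> a < hi \<Longrightarrow> v_two i1 i2 a $ i > 0"
  using bb(1)[of a] by (simp add: v_two_eq vec3_def)

lemma v_two_has_derivative:
  assumes "0 < a" "a < hi"
  shows "(v_two i1 i2 has_derivative (\<lambda>t. t *\<^sub>R vec3 1 1 (- 2 * a / (m * bb a)))) (at a)"
proof -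
  have eq: "v_two i1 i2 = (\<lambda>a. a *\<^sub>R vec3 1 1 0 + bb a *\<^sub>R vec3 0 0 1)"
    by (auto simp: fun_eq_iff v_two_eq vec_eq_iff vec3_def)
  have "(bb has_derivative (\<lambda>t. - 2 * a / (m * bb a) * t)) (at a)"
    by (rule DERIV_bb[OF assms, unfolded has_field_derivative_def])
  then have "((\<lambda>a. a *\<^sub>R vec3 1 1 0 + bb a *\<^sub>R vec3 0 0 1) has_derivative
     (\<lambda>t. t *\<^sub>R vec3 1 1 0 + (- 2 * a / (m * bb a) * t) *\<^sub>R vec3 0 0 1)) (at a)"
    by (intro has_derivative_add has_derivative_scaleR_left has_derivative_ident)
  also have "(\<lambda>t. t *\<^sub>R vec3 1 1 0 + (- 2 * a / (m * bb a) * t) *\<^sub>R vec3 0 0 1) = (\<lambda>t. t *\<^sub>R vec3 1 1 (- 2 * a / (m * bb a)))"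
    by (auto simp: fun_eq_iff vec_eq_iff vec3_def)
  finally show ?thesis unfolding eq .
qed

text \<open>Symmetry leaves the gradient of \<open>cube_section\<close> at \<open>w\<close> two free
  values, \<open>\<alpha>\<close> on \<open>i1\<close> and \<open>i2\<close> and
  \<open>\<beta>\<close> elsewhere. The vanishing derivative along the family is a linear relation
  between them, which makes the gradient parallel to \<open>w\<close>.\<close>

lemma critical_v_two:
  assumes "0 < a" "a < hi" "dsigma a = 0"
  shows "critical_on_sphere central_section (v_two i1 i2 a)"
proof -
  define w where "w = v_two i1 i2 a"
  define U where "U = {v :: real ^ 'n. \<forall>i. v $ i > 0}"
  note b = bb[OF assms(1,2)]
  have wS: "w \<in> sphere 0 1" unfolding w_def by (rule v_two_sphere[OF assms(1,2)])
  have wpos: "w $ i > 0" for i unfolding w_def by (rule v_two_pos[OF assms(1,2)])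
  have "cube_section differentiable (at w)"
    unfolding cube_section_def[abs_def]
  proof (rule section_fun_differentiable)
    show "DIM(real ^ 'n) \<ge> 3" using card4 by simp
    show "w \<bullet> b > 0" if "b \<in> Basis" for b using that wpos by (auto simp: Basis_vec_def inner_axis)
  qed
  then obtain F' where F': "(cube_section has_derivative F') (at w)" unfolding differentiable_def by blast
  interpret F': bounded_linear F' using F' by (rule has_derivative_bounded_linear)
  \<comment> \<open>Swapping two equal coordinates preserves both \<open>w\<close> and
    \<open>cube_section\<close>, hence \<open>F'\<close>.\<close>
  have sym: "F' (axis i 1) = F' (axis j 1)" if ij: "w $ i = w $ j" for i j
  proof -
    define P where "P = (\<lambda>v :: real ^ 'n. \<chi> k. v $ Transposition.transpose i j k)"
    have "linear P" by (auto simp: P_def linear_iff vec_eq_iff)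
    then have P': "(P has_derivative P) (at w)" by (simp add: linear_imp_has_derivative)
    have Pw: "P w = w" using ij by (auto simp: P_def vec_eq_iff Transposition.transpose_def)
    have "(cube_section \<circ> P has_derivative F' \<circ> P) (at w)"
      by (rule diff_chain_at[OF P']) (simp add: Pw F')
    moreover have "cube_section \<circ> P = cube_section"
      by (simp add: fun_eq_iff P_def cube_section_swap)
    ultimately have "F' \<circ> P = F'" using F' by (metis has_derivative_unique)
    then have "F' (P (axis i 1)) = F' (axis i 1)" by (metis comp_apply)
    moreover have "P (axis i 1) = axis j 1"
      by (auto simp: P_def vec_eq_iff axis_def Transposition.transpose_def)
    ultimately show ?thesis by simp
  qed
  have "card (UNIV - {i1, i2}) \<noteq> 0" using card_rest m(2) by (metis of_nat_0 not_numeral_le_zero)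
  then obtain j where j: "j \<in> UNIV - {i1, i2}" by (metis card.empty ex_in_conv)
  define \<alpha> \<beta> where "\<alpha> = F' (axis i1 1)" and "\<beta> = F' (axis j 1)"
  have F'_eq: "F' h = \<alpha> * (h $ i1 + h $ i2) + \<beta> * (\<Sum>i\<in>UNIV - {i1, i2}. h $ i)" for h
  proof -
    have "h = (\<Sum>i\<in>UNIV. h $ i *\<^sub>R axis i 1)" using basis_expansion[of h] by (simp add: scalar_mult_eq_scaleR)
    then have "F' h = (\<Sum>i\<in>UNIV. h $ i * F' (axis i 1))" 
      using F'.sum[of "\<lambda>i. h $ i *\<^sub>R axis i 1" UNIV] by (simp add: F'.scaleR)
    also have "\<dots> = h $ i1 * F' (axis i1 1) + h $ i2 * F' (axis i2 1) + (\<Sum>i\<in>UNIV - {i1, i2}. h $ i * F' (axis i 1))"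
      by (rule sum_coordinates)
    also have "(\<Sum>i\<in>UNIV - {i1, i2}. h $ i * F' (axis i 1)) = (\<Sum>i\<in>UNIV - {i1, i2}. h $ i * \<beta>)"
      unfolding \<beta>_def by (intro sum.cong arg_cong2[where f="(*)"] refl sym) (use j in \<open>auto simp: w_def v_two_eq vec3_def\<close>)
    also have "F' (axis i2 1) = \<alpha>" unfolding \<alpha>_def by (rule sym) (auto simp: w_def v_two_eq vec3_def)
    finally show ?thesis by (simp add: \<alpha>_def sum_distrib_left algebra_simps)
  qed
  have "((\<lambda>x. cube_section (v_two i1 i2 x)) has_derivative (\<lambda>t. F' (t *\<^sub>R vec3 1 1 (- 2 * a / (m * bb a))))) (at a)"
    using has_derivative_compose[OF v_two_has_derivative[OF assms(1,2)]] F' unfolding w_def by blast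
  moreover have "cube_section (v_two i1 i2 x) = sigma_hat i1 i2 x" if "x \<in> {0<..<hi}" for x
    using that v_two_sphere[of x] v_two_pos[of x] card4
    by (simp add: sigma_hat_def central_section_eq)
  ultimately have "(sigma_hat i1 i2 has_derivative (\<lambda>t. F' (t *\<^sub>R vec3 1 1 (- 2 * a / (m * bb a))))) (at a)"
    using has_derivative_transform_within_open[of _ _ a UNIV "{0<..<hi}" "sigma_hat i1 i2"] assms by simp
  moreover have "(sigma_hat i1 i2 has_derivative (\<lambda>t. 0 * t)) (at a)"
    by (rule DERIV_sigma_hat[OF assms(1,2), unfolded has_field_derivative_def assms(3)])
  ultimately have "(\<lambda>t. F' (t *\<^sub>R vec3 1 1 (- 2 * a / (m * bb a)))) = (\<lambda>t. 0 * t)"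
    by (rule has_derivative_unique)
  then have "F' (vec3 1 1 (- 2 * a / (m * bb a))) = 0" by (metis mult_zero_left scaleR_one)
  moreover have "F' (vec3 1 1 t) = 2 * \<alpha> + \<beta> * (m * t)" for t
  proof -
    have "(\<Sum>i\<in>UNIV - {i1, i2}. vec3 1 1 t $ i) = (\<Sum>i\<in>UNIV - {i1, i2}. t)"
      by (intro sum.cong) (auto simp: vec3_def)
    also have "\<dots> = m * t" by (simp only: sum_constant card_rest)
    finally have "F' (vec3 1 1 t) = \<alpha> * (vec3 1 1 t $ i1 + vec3 1 1 t $ i2) + \<beta> * (m * t)"
      by (simp only: F'_eq)
    then show ?thesis by (simp add: vec3_def)
  qed
  ultimately have "2 * \<alpha> + \<beta> * (m * (- 2 * a / (m * bb a))) = 0" by simp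
  then have \<alpha>: "\<alpha> = \<beta> / bb a * a" using b(1) m(2) by (simp add: field_simps)
  have "F' h = \<beta> / bb a * (w \<bullet> h)" for h
    using b(1) unfolding F'_eq w_def v_two_eq inner_vec3 \<alpha> by (simp add: field_simps)
  then have "F' = (\<lambda>h. \<beta> / bb a * (w \<bullet> h))" by (rule ext)
  with F' have der: "(cube_section has_derivative (\<lambda>h. \<beta> / bb a * (w \<bullet> h))) (at w)" by simp
  have "U = (\<Inter>i. {v. 0 < v $ i})" by (auto simp: U_def)
  also have "open \<dots>" by (intro open_INT ballI open_Collect_less continuous_intros finite)
  finally have "open U" .
  have "(central_section has_derivative (\<lambda>h. 0)) (at w within sphere 0 1)"
    by (rule has_derivative_0_on_sphere[OF der wS \<open>open U\<close>])
       (use wpos card4 in \<open>auto simp: U_def central_section_eq\<close>)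
  with wS show ?thesis by (simp add: critical_on_sphere_def w_def)
qed

text \<open>All entries are positive, so a diagonal direction would have them all equal; but
  \<open>a / b > 1\<close>.\<close>

lemma not_diagonal_v_two:
  assumes "lo < a" "a < hi" shows "\<not> diagonal_direction (v_two i1 i2 a)"
proof
  assume "diagonal_direction (v_two i1 i2 a)"
  then obtain k p e where e: "\<And>i. e i \<in> {-1, 1 :: real}" and
    v: "v_two i1 i2 a = (\<chi> i. e i * (if p i \<le> k then 1 / sqrt (real k) else 0))"
    unfolding diagonal_direction_def by blast
  have a: "0 < a" using assms lo_hi by simp
  have abs: "v_two i1 i2 a $ i = 1 / sqrt (real k)" for i
  proof -
    have "v_two i1 i2 a $ i = e i * (if p i \<le> k then 1 / sqrt (real k) else 0)" by (simp add: v)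
    with v_two_pos[OF a assms(2), of i] have *: "v_two i1 i2 a $ i = e i * (1 / sqrt (real k))" by (auto split: if_splits)
    then have "e i = 1" using v_two_pos[OF a assms(2), of i] e[of i] by auto
    with * show ?thesis by simp
  qed
  have "card (UNIV - {i1, i2}) \<noteq> 0" using card_rest m(2) by (metis of_nat_0 not_numeral_le_zero)
  then obtain j where "j \<in> UNIV - {i1, i2}" by (metis card.empty ex_in_conv)
  then have "a = bb a" using abs[of i1] abs[of j] by (simp add: v_two_eq vec3_def)
  moreover have "cc a > 1" by (rule cc_gt_1[OF assms])
  ultimately show False using a by (simp add: cc_def)
qed

text \<open>Approaching along the family from the left, where the values are strictly larger,
  refutes even a non-strict maximum.\<close>

lemma not_local_max_v_two:
  assumes "first_local_min i1 i2 \<xi>"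
  shows "\<not> local_max_on central_section (sphere 0 1) (v_two i1 i2 \<xi>)"
proof
  note \<xi> = first_local_minD[OF assms]
  have \<xi>0: "0 < \<xi>" using \<xi>(1) lo_hi by simp
  assume "local_max_on central_section (sphere 0 1) (v_two i1 i2 \<xi>)"
  then have ev: "\<forall>\<^sub>F y in at (v_two i1 i2 \<xi>) within sphere 0 1. central_section y \<le> central_section (v_two i1 i2 \<xi>)"
    by (simp add: local_max_on_def)
  have near: "\<forall>\<^sub>F x in at_left \<xi>. x \<in> {lo<..<\<xi>}"
    by (rule eventually_at_leftI[OF _ \<xi>(1)]) simp
  have "isCont (v_two i1 i2) \<xi>" using v_two_has_derivative[OF \<xi>0 \<xi>(2)] by (rule has_derivative_continuous)
  then have "(v_two i1 i2 \<longlongrightarrow> v_two i1 i2 \<xi>) (at_left \<xi>)"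
    unfolding isCont_def by (rule tendsto_mono[OF at_le, rotated]) simp
  moreover have "\<forall>\<^sub>F x in at_left \<xi>. v_two i1 i2 x \<in> sphere 0 1 \<and> v_two i1 i2 x \<noteq> v_two i1 i2 \<xi>"
    using near
  proof eventually_elim
    case (elim x)
    have "v_two i1 i2 x $ i1 \<noteq> v_two i1 i2 \<xi> $ i1" using elim by (simp add: v_two_eq vec3_def)
    then show ?case using elim v_two_sphere[of x] lo_hi \<xi> by auto
  qed
  ultimately have "filterlim (v_two i1 i2) (at (v_two i1 i2 \<xi>) within sphere 0 1) (at_left \<xi>)"
    by (simp add: filterlim_at)
  from eventually_compose_filterlim[OF ev this]
  have "\<forall>\<^sub>F x in at_left \<xi>. sigma_hat i1 i2 x \<le> sigma_hat i1 i2 \<xi>" by (simp add: sigma_hat_def)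
  with near have "\<forall>\<^sub>F x in at_left \<xi>. False"
  proof eventually_elim
    case (elim x)
    with \<xi>(4)[of x] show False by simp
  qed
  then show False by simp
qed

lemma not_local_min_v_two:
  assumes "lo < a" "a < hi"
  shows "\<not> local_min_on central_section (sphere 0 1) (v_two i1 i2 a)"
proof
  have a0: "0 < a" using assms lo_hi by simp
  define b where "b = bb a"
  define c where "c = cc a"
  have b: "b > 0" "m * b\<^sup>2 = 1 - 2 * a\<^sup>2" using bb[OF a0 assms(2)] by (auto simp: b_def)
  have c: "c > 1" "a = b * c" using cc_gt_1[OF assms] b(1) by (auto simp: c_def cc_def b_def)
  \<comment> \<open>A rotation in the plane of \<open>i1\<close>, \<open>i2\<close>: with
    \<open>s\<^sup>2 = c\<^sup>2 - q\<^sup>2\<close> the squares of \<open>b * (s + q)\<close> and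
    \<open>b * (s - q)\<close> add up to \<open>2 * a\<^sup>2\<close>, and the arguments of
    \<open>K\<close> in the volume become \<open>s\<close> and \<open>q\<close>.\<close>
  define r where "r q = vec3 (b * (sqrt (c\<^sup>2 - q\<^sup>2) + q)) (b * (sqrt (c\<^sup>2 - q\<^sup>2) - q)) b" for q
  have r0: "r 0 = v_two i1 i2 a" using c by (simp add: r_def v_two_eq b_def)
  have K0: "K 0 = 0" by (simp add: K_def)
  obtain \<eta> where \<eta>: "\<eta> > 0" "\<And>q. 0 < q \<Longrightarrow> q < \<eta> \<Longrightarrow>
      c\<^sup>2 * (K (sqrt (c\<^sup>2 - q\<^sup>2)) - K q) < (c\<^sup>2 - 2 * q\<^sup>2) * K c"
    using rotated_section_less[of c k] c(1) unfolding K_def by auto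
  have sph: "r q \<in> sphere 0 1" and val: "central_section (r q) = 2 / (b * (c\<^sup>2 - 2 * q\<^sup>2)) * (K (sqrt (c\<^sup>2 - q\<^sup>2)) - K q)"
    if q: "0 \<le> q" "2 * q\<^sup>2 < c\<^sup>2" for q
  proof -
    define s where "s = sqrt (c\<^sup>2 - q\<^sup>2)"
    have "q\<^sup>2 \<le> c\<^sup>2" using q(2) zero_le_power2[of q] by linarith
    then have s2: "s\<^sup>2 = c\<^sup>2 - q\<^sup>2" by (simp add: s_def)
    have "q\<^sup>2 < s\<^sup>2" using q s2 by simp
    moreover have "s \<ge> 0" using \<open>q\<^sup>2 \<le> c\<^sup>2\<close> by (simp add: s_def)
    ultimately have qs: "q < s" by (rule power_less_imp_less_base)
    have nrm: "(b * (s + q))\<^sup>2 + (b * (s - q))\<^sup>2 + m * b\<^sup>2 = 1"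
    proof -
      have "(b * (s + q))\<^sup>2 + (b * (s - q))\<^sup>2 = 2 * b\<^sup>2 * (s\<^sup>2 + q\<^sup>2)" by (simp add: power2_eq_square algebra_simps)
      also have "\<dots> = 2 * a\<^sup>2" by (simp add: s2 c(2) power_mult_distrib)
      finally show ?thesis using b(2) by simp
    qed
    then show "r q \<in> sphere 0 1" by (simp add: r_def s_def[symmetric] norm_vec3)
    have "central_section (r q) = 2 * b / ((b * (s + q)) * (b * (s - q))) *
       (K ((b * (s + q) + b * (s - q)) / (2 * b)) - K ((b * (s + q) - b * (s - q)) / (2 * b)))"
      unfolding r_def s_def[symmetric] using b(1) qs q nrm by (intro central_section_vec3) auto
    also have "(b * (s + q) + b * (s - q)) / (2 * b) = s" using b(1) by (simp add: field_simps)
    also have "(b * (s + q) - b * (s - q)) / (2 * b) = q" using b(1) by (simp add: field_simps)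
    also have "(b * (s + q)) * (b * (s - q)) = b * (b * (s\<^sup>2 - q\<^sup>2))"
      by (simp add: power2_eq_square algebra_simps)
    also have "s\<^sup>2 - q\<^sup>2 = c\<^sup>2 - 2 * q\<^sup>2" by (simp add: s2)
    also have "2 * b / (b * (b * (c\<^sup>2 - 2 * q\<^sup>2))) = 2 / (b * (c\<^sup>2 - 2 * q\<^sup>2))" using b(1) by simp
    finally show "central_section (r q) = 2 / (b * (c\<^sup>2 - 2 * q\<^sup>2)) * (K (sqrt (c\<^sup>2 - q\<^sup>2)) - K q)"
      by (simp add: s_def)
  qed
  have v0: "central_section (v_two i1 i2 a) = 2 / (b * c\<^sup>2) * K c"
    using val[of 0] c(1) by (simp add: r0 K0)
  have less: "central_section (r q) < central_section (v_two i1 i2 a)" if q: "0 < q" "q < \<eta>" "2 * q\<^sup>2 < c\<^sup>2" for q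
  proof -
    have "(K (sqrt (c\<^sup>2 - q\<^sup>2)) - K q) / (c\<^sup>2 - 2 * q\<^sup>2) < K c / c\<^sup>2"
      using \<eta>(2)[OF q(1,2)] q(3) c(1) by (simp add: field_simps)
    then have "2 / b * ((K (sqrt (c\<^sup>2 - q\<^sup>2)) - K q) / (c\<^sup>2 - 2 * q\<^sup>2)) < 2 / b * (K c / c\<^sup>2)"
      using b(1) by (intro mult_strict_left_mono) auto
    then show ?thesis using val[of q] q v0 by simp
  qed
  assume "local_min_on central_section (sphere 0 1) (v_two i1 i2 a)"
  then have ev: "\<forall>\<^sub>F y in at (r 0) within sphere 0 1. central_section (r 0) \<le> central_section y"
    by (simp add: local_min_on_def r0)
  \<comment> \<open>The bound \<open>c / 2\<close> ensures \<open>2 * q\<^sup>2 < c\<^sup>2\<close>,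
    so both rotated entries stay positive and the volume formula applies.\<close>
  have near: "\<forall>\<^sub>F q in at_right 0. q \<in> {0<..<min \<eta> (c / 2)}"
    by (rule eventually_at_rightI[of 0 "min \<eta> (c / 2)"]) (use \<eta> c in auto)
  have small: "2 * q\<^sup>2 < c\<^sup>2" if "q \<in> {0<..<min \<eta> (c / 2)}" for q
  proof -
    have "q\<^sup>2 < (c / 2)\<^sup>2" using that by (intro power_strict_mono) auto
    then have "4 * q\<^sup>2 < c\<^sup>2" by (simp add: power_divide)
    then show ?thesis using zero_le_power2[of q] by linarith
  qed
  have "isCont r 0"
    unfolding r_def vec3_decompose[of "b * _" "b * _" b] by (intro continuous_intros)
  then have "(r \<longlongrightarrow> r 0) (at_right 0)"
    unfolding isCont_def by (rule tendsto_mono[OF at_le, rotated]) simp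
  moreover have "\<forall>\<^sub>F q in at_right 0. r q \<in> sphere 0 1 \<and> r q \<noteq> r 0"
    using near
  proof eventually_elim
    case (elim q)
    then have "central_section (r q) < central_section (r 0)" using less[of q] small[of q] by (simp add: r0)
    then have "r q \<noteq> r 0" by auto
    with sph[of q] small[of q] elim show ?case by auto
  qed
  ultimately have "filterlim r (at (r 0) within sphere 0 1) (at_right 0)" by (simp add: filterlim_at)
  from eventually_compose_filterlim[OF ev this] near
  have "\<forall>\<^sub>F q in at_right (0::real). False"
  proof eventually_elim
    case (elim q)
    with less[of q] small[of q] show False by (simp add: r0)
  qed
  then show False by simp
qed

end

theorem mainTheorem5:
  fixes i1 i2 :: "'n::finite"
  assumes "CARD('n) \<ge> 4" and "i1 \<noteq> i2"
  shows "(\<exists>\<xi>. first_local_min i1 i2 \<xi>) \<and>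
    (\<forall>\<xi>. first_local_min i1 i2 \<xi> \<longrightarrow>
      (let w = v_two i1 i2 \<xi> in
         critical_on_sphere central_section w \<and>
         \<not> diagonal_direction w \<and>
         \<not> local_min_on central_section (sphere 0 1) w \<and>
         \<not> local_max_on central_section (sphere 0 1) w))"
proof -
  interpret two_coordinates i1 i2 using assms by unfold_locales
  have "critical_on_sphere central_section (v_two i1 i2 \<xi>) \<and>
      \<not> diagonal_direction (v_two i1 i2 \<xi>) \<and>
      \<not> local_min_on central_section (sphere 0 1) (v_two i1 i2 \<xi>) \<and>
      \<not> local_max_on central_section (sphere 0 1) (v_two i1 i2 \<xi>)" if "first_local_min i1 i2 \<xi>" for \<xi>
    using first_local_minD[OF that] lo_hi critical_v_two not_diagonal_v_two not_local_min_v_two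
      not_local_max_v_two[OF that] by (metis order.strict_trans)
  then show ?thesis using first_local_min_exists by (simp add: Let_def)
qed

end
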